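(* Let $r_1,r_2,r_3\in\mathbb R$ satisfy $r_1+r_2+r_3=4$, $r_1<2$, $0<r_2<2$, and let $v_1,v_2,v_3$ be multiplier systems on $\Gamma=\mathrm{SL}_2(\mathbb Z)$ corresponding to the weights $r_1,r_2,r_3$ with $v_1v_2v_3=1$. Let $f_1\in A_{r_1}(\Gamma,v_1)$, $f_2\in S_{r_2}(\Gamma,v_2)$, $f_3\in M_{r_3}(\Gamma,v_3)$. Then $$\mathbf T(f_1,f_2,f_3)=\frac{(-2i)^{r_3}\,\Gamma(r_3)}{\Gamma(2-r_1)\,\Gamma(2-r_2)}\int_{\tau_1=\rho-1}^{\rho} f_1(\tau_1)\int_{\tau_2=i}^{\infty} f_2(\tau_2)\int_{u=0}^1 f_3\bigl(\tau_1+u(\tau_2-\tau_1)\bigr)\,u^{1-r_2}(1-u)^{1-r_1}\,du\,d\tau_2\,d\tau_1$$ $$=\frac{(-2i)^{r_3}\,\Gamma(r_3)}{\Gamma(2-r_1)\,\Gamma(2-r_2)}\int_{\tau_1=\rho-1}^{\rho} f_1(\tau_1)\int_{\tau_2=i}^{\infty} f_2(\tau_2)\int_{z=\tau_1}^{\tau_2} f_3(z)\Bigl(\frac{z-\tau_1}{\tau_2-\tau_1}\Bigr)^{1-r_2}\Bigl(\frac{\tau_2-z}{\tau_2-\tau_1}\Bigr)^{1-r_1}\frac{dz}{\tau_2-\tau_1}\,d\tau_2\,d\tau_1 .$$ (In the prefactors $\Gamma(\cdot)$ is the Gamma function.) The paths of integration for $\tau_1$ and $\tau_2$ are geodesic segments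 in the upper half-plane. In the first formula $u$ runs over the real interval $[0,1]$; in the second formula the path of $z$ is any path in the upper half-plane from $\tau_1$ to $\tau_2$ that does not cross $\ell_{\tau_1,\tau_2}\setminus s_{\tau_1,\tau_2}$, where $s_{\tau_1,\tau_2}$ is the geodesic segment from $\tau_1$ to $\tau_2$ and $\ell_{\tau_1,\tau_2}$ is the geodesic line through $\tau_1$ and $\tau_2$.
   Context: Notation. $\mathfrak H$ and $\mathfrak H^-$ are the upper and lower half-planes, $\mathbb P^1_{\mathbb R}=\mathbb R\cup\{\infty\}\subset\mathbb P^1_{\mathbb C}$, $\Gamma=\mathrm{SL}_2(\mathbb Z)$, $\rho=e^{\pi i/3}$. Complex powers of numbers in $\mathfrak H$ or $\mathfrak H^-$ use the principal argument; $(-2i)^{r_3}=2^{r_3}e^{-\pi i r_3/2}$. The powers of $\frac{z-\tau_1}{\tau_2-\tau_1}$ and $\frac{\tau_2-z}{\tau_2-\tau_1}$ are the branches holomorphic in $z\in\mathfrak H$ away from $\ell_{\tau_1,\tau_2}\setminus s_{\tau_1,\tau_2}$ (and away from $\tau_1$, resp. $\tau_2$) that are positive for $z$ on the Euclidean segment between $\tau_1$ and $\tau_2$. Multiplier systems and modular forms. A multiplier system corresponding to $r\in\mathbb R$ is a function $v=v[p]:\Gamma\to\mathbb C^*$ with $p\in\mathbb R$, $p\equiv r\bmod 2$, where $v[p](\gamma)=\eta^{2p}(\gamma z)\big/\bigl((cz+d)^p\eta^{2p}(z)\bigr)$ for $\gamma=\begin{pmatrix}a&b\\c&d\end{pmatrix}$,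 $\arg(cz+d)\in(-\pi,\pi]$, $\eta$ the Dedekind eta function, $\eta^{2p}=e^{2p\log\eta}$. $A_r(\Gamma,v)$ is the space of all holomorphic $f:\mathfrak H\to\mathbb C$ with $f(\gamma z)=v(\gamma)(cz+d)^rf(z)$ for all $\gamma\in\Gamma$ (no growth condition). $M_r(\Gamma,v)\subset A_r(\Gamma,v)$: those with $f(z)=O(1)$ as $\mathrm{Im}\,z\to\infty$. $S_r(\Gamma,v)\subset M_r(\Gamma,v)$ (cusp forms): those with $f(z)=O((\mathrm{Im}\,z)^{-a})$ for all $a>0$ as $\mathrm{Im}\,z\to\infty$. Function spaces for weight $r$. For $f$ on $\mathfrak H^-$ put $f^-(t)=(i-t)^rf(t)$; for $h$ on $\mathfrak H$ put $h^+(z)=(-i-z)^rh(z)$. ${}^-\mathcal D^{\omega}_r$: holomorphic $f$ on $\mathfrak H^-$ such that $f^-$ extends holomorphically to a neighborhood of $\mathfrak H^-\cup\mathbb P^1_{\mathbb R}$ in $\mathbb P^1_{\mathbb C}$. ${}^-\mathcal D^\infty_r$: holomorphic $f$ on $\mathfrak H^-$ such that $f^-$ extends to a $C^\infty$ function on $\mathfrak H^-\cup\mathbb P^1_{\mathbb R}$, with topology given by the supremum norms on $\mathbb P^1_{\mathbb R}$ of all derivatives of $f^-$ with respect to $\theta\in\mathbb R/\pi\mathbb Z$, $t=-\cot\theta$. ${}^+\mathcal D^{-\infty}_r$: holomorphic $h$ on $\mathfrak H$ with $h^+(z)=O(|\mathrm{Im}\,z|^{-B})+O(|z|^B)$ on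 $\mathfrak H$ for some $B>0$; it contains $M_r(\Gamma,v)$. Bilinear form. Let $r\in\mathbb R\setminus\mathbb Z_{\le0}$ and $w=\frac{z-i}{z+i}$. For $f\in{}^-\mathcal D^\omega_r$ with $f^-=\sum_{m\le0}d_mw^m$ put $\sigma_rf^-=\sum_{m\le 0}\frac{|m|!}{(r)_{|m|}}d_m\,w^{m-1}$ ($(r)_n$ the Pochhammer symbol). For $h$ holomorphic on $\mathfrak H$ put $[h,f]_r=\frac1\pi\int_Ch^+(z)\,\sigma_rf^-(z)\,\frac{dz}{(z+i)^2}$, with $C$ a positively oriented circle $|w|=c<1$ in the domain of $\sigma_r f^-$. For $h\in{}^+\mathcal D^{-\infty}_r$ the linear form $f\mapsto[h,f]_r$ extends continuously to ${}^-\mathcal D^\infty_r$, and $[h,f]_r$ denotes this extension (if $h^+=\sum_{n\ge0}c_nw^n$ and $f^-=\sum_{m\le0}d_mw^m$, then $[h,f]_r=\sum_{n\ge0}\frac{n!}{(r)_n}c_nd_{-n}$). Trilinear form. For $t\in\mathfrak H^-$ let $c_f(z_1,z_2;t)=\int_{z_1}^{z_2}f(\tau)(\tau-t)^{r-2}d\tau$ for $f\in A_r(\Gamma,v)$, $z_1,z_2\in\mathfrak H$ (if $f$ is a cusp form, $z_1,z_2$ may also be cusps). Put $\mathrm{cp}(f_1,f_2)=c_{f_1}(\rho-1,\rho)\cdot c_{f_2}(i,\infty)$ (product of functions of $t$), an element of ${}^-\mathcal D^\infty_{r_3}$ with $r_3=4-r_1-r_2$, and $\mathbf T(f_1,f_2,f_3)=[f_3,\mathrm{cp}(f_1,f_2)]_{r_3}$.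 *)

theory Defs
  imports "HOL-Complex_Analysis.Complex_Analysis" "HOL-Library.Landau_Symbols"
begin

definition upper_half_plane :: "complex set" where
  "upper_half_plane = {z. 0 < Im z}"

definition lower_half_plane :: "complex set" where
  "lower_half_plane = {z. Im z < 0}"

definition SL2Z :: "(int ^ 2 ^ 2) set" where
  "SL2Z = {\<gamma>. det \<gamma> = 1}"

definition cocycle_factor :: "int ^ 2 ^ 2 \<Rightarrow> complex \<Rightarrow> complex" where
  "cocycle_factor \<gamma> z = of_int (\<gamma> $ 2 $ 1) * z + of_int (\<gamma> $ 2 $ 2)"

definition mobius_act :: "int ^ 2 ^ 2 \<Rightarrow> complex \<Rightarrow> complex" where
  "mobius_act \<gamma> z =
     (of_int (\<gamma> $ 1 $ 1) * z + of_int (\<gamma> $ 1 $ 2)) / cocycle_factor \<gamma> z"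

definition dedekind_eta :: "complex \<Rightarrow> complex" where
  "dedekind_eta z = exp (of_real pi * \<i> * z / 12) *
     (\<Prod>n. 1 - exp (2 * of_real pi * \<i> * of_nat (Suc n) * z))"

text \<open>The function \<open>L\<close> is a branch of \<open>log \<eta>\<close> on the upper half-plane. Two branches differ by a
  constant, which cancels in the quotient, so the choice of \<open>L\<close> is immaterial.
  The quotient is constant in \<open>z\<close>.\<close>

definition multiplier_system :: "real \<Rightarrow> (int ^ 2 ^ 2 \<Rightarrow> complex) \<Rightarrow> bool" where
  "multiplier_system r v \<longleftrightarrow>
     (\<exists>p L. (\<exists>k::int. p = r + 2 * of_int k) \<and>
        L holomorphic_on upper_half_plane \<and>
        (\<forall>z\<in>upper_half_plane. exp (L z) = dedekind_eta z) \<and>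
        (\<forall>\<gamma>\<in>SL2Z. \<forall>z\<in>upper_half_plane.
           v \<gamma> = exp (2 * complex_of_real p * L (mobius_act \<gamma> z)) /
             (cocycle_factor \<gamma> z powr complex_of_real p * exp (2 * complex_of_real p * L z))))"

definition automorphic_forms ::
    "real \<Rightarrow> (int ^ 2 ^ 2 \<Rightarrow> complex) \<Rightarrow> (complex \<Rightarrow> complex) set" where
  "automorphic_forms r v =
     {f. f holomorphic_on upper_half_plane \<and>
         (\<forall>\<gamma>\<in>SL2Z. \<forall>z\<in>upper_half_plane.
            f (mobius_act \<gamma> z) = v \<gamma> * cocycle_factor \<gamma> z powr complex_of_real r * f z)}"

definition modular_forms ::
    "real \<Rightarrow> (int ^ 2 ^ 2 \<Rightarrow> complex) \<Rightarrow> (complex \<Rightarrow> complex) set" where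
  "modular_forms r v =
     {f \<in> automorphic_forms r v. f \<in> O[filtercomap Im at_top](\<lambda>_. 1)}"

definition cusp_forms ::
    "real \<Rightarrow> (int ^ 2 ^ 2 \<Rightarrow> complex) \<Rightarrow> (complex \<Rightarrow> complex) set" where
  "cusp_forms r v =
     {f \<in> modular_forms r v.
        \<forall>a>0. f \<in> O[filtercomap Im at_top](\<lambda>z. complex_of_real (Im z powr (- a)))}"

definition minus_twist :: "real \<Rightarrow> (complex \<Rightarrow> complex) \<Rightarrow> complex \<Rightarrow> complex" where
  "minus_twist r f t = (\<i> - t) powr complex_of_real r * f t"

definition plus_twist :: "real \<Rightarrow> (complex \<Rightarrow> complex) \<Rightarrow> complex \<Rightarrow> complex" where
  "plus_twist r h z = (- \<i> - z) powr complex_of_real r * h z"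

definition w_coord :: "complex \<Rightarrow> complex" where
  "w_coord z = (z - \<i>) / (z + \<i>)"

definition w_coord_inv :: "complex \<Rightarrow> complex" where
  "w_coord_inv w = \<i> * (1 + w) / (1 - w)"

text \<open>The coordinate \<open>\<zeta> = 1 / w = (t + \<i>) / (t - \<i>)\<close> is an automorphism of the Riemann sphere that
  maps the lower half-plane onto \<open>ball 0 1\<close> and its closure (with the point at infinity, where
  \<open>\<zeta> = 1\<close>) onto \<open>cball 0 1\<close>. Regularity of \<open>f\<^sup>-\<close> on the closed lower half-plane in the sphere
  is expressed in this coordinate. The inverse is \<open>t = \<i> (\<zeta> + 1) / (\<zeta> - 1)\<close>, and
  \<open>w\<^sup>m = \<zeta>\<^bsup>-m\<^esup>\<close>.\<close>

definition minus_disc :: "real \<Rightarrow> (complex \<Rightarrow> complex) \<Rightarrow> complex \<Rightarrow> complex" where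
  "minus_disc r f \<zeta> = minus_twist r f (\<i> * (\<zeta> + 1) / (\<zeta> - 1))"

definition D_omega :: "real \<Rightarrow> (complex \<Rightarrow> complex) set" where
  "D_omega r = {f. f holomorphic_on lower_half_plane \<and>
     (\<exists>G. G analytic_on cball 0 1 \<and> (\<forall>\<zeta>\<in>ball 0 1. G \<zeta> = minus_disc r f \<zeta>))}"

text \<open>Real differentiability of order \<open>k\<close>, with \<open>fx\<close> and \<open>fy\<close> the partial derivatives. On a
  closed disc the derivatives at boundary points are taken within the disc.\<close>

primrec Ck_on :: "nat \<Rightarrow> complex set \<Rightarrow> (complex \<Rightarrow> complex) \<Rightarrow> bool" where
  "Ck_on 0 S f = continuous_on S f"
| "Ck_on (Suc k) S f =
     (\<exists>fx fy. (\<forall>z\<in>S. (f has_derivative (\<lambda>h. Re h *\<^sub>R fx z + Im h *\<^sub>R fy z)) (at z within S)) \<and>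
        Ck_on k S fx \<and> Ck_on k S fy)"

definition D_infty :: "real \<Rightarrow> (complex \<Rightarrow> complex) set" where
  "D_infty r = {f. f holomorphic_on lower_half_plane \<and>
     (\<exists>G. (\<forall>k. Ck_on k (cball 0 1) G) \<and> (\<forall>\<zeta>\<in>ball 0 1. G \<zeta> = minus_disc r f \<zeta>))}"

text \<open>Boundary value of \<open>f\<^sup>-\<close> at \<open>t = - cot \<theta>\<close>, which has \<open>w = exp (2 \<i> \<theta>)\<close>.\<close>

definition boundary_value :: "real \<Rightarrow> (complex \<Rightarrow> complex) \<Rightarrow> real \<Rightarrow> complex" where
  "boundary_value r f \<theta> = Lim (at (cis (- 2 * \<theta>)) within ball 0 1) (minus_disc r f)"

definition D_seminorm :: "real \<Rightarrow> nat \<Rightarrow> (complex \<Rightarrow> complex) \<Rightarrow> real" where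
  "D_seminorm r k f =
     (SUP \<theta>. norm (((\<lambda>g x. vector_derivative g (at x)) ^^ k) (boundary_value r f) \<theta>))"

definition D_infty_topology :: "real \<Rightarrow> (complex \<Rightarrow> complex) topology" where
  "D_infty_topology r = topology_generated_by
     {{g \<in> D_infty r. D_seminorm r k (\<lambda>t. g t - f t) < \<epsilon>} | f k \<epsilon>. f \<in> D_infty r \<and> 0 < \<epsilon>}"

text \<open>\<open>minus_coeff r f n\<close> is the coefficient \<open>d\<^bsub>-n\<^esub>\<close> of \<open>w\<^bsup>-n\<^esup> = \<zeta>\<^sup>n\<close> in the expansion of \<open>f\<^sup>-\<close>.\<close>

definition minus_coeff :: "real \<Rightarrow> (complex \<Rightarrow> complex) \<Rightarrow> nat \<Rightarrow> complex" where
  "minus_coeff r f n = fps_nth (fps_expansion (minus_disc r f) 0) n"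

definition sigma_coeff :: "real \<Rightarrow> (complex \<Rightarrow> complex) \<Rightarrow> nat \<Rightarrow> complex" where
  "sigma_coeff r f n = fact n / pochhammer (complex_of_real r) n * minus_coeff r f n"

definition sigma :: "real \<Rightarrow> (complex \<Rightarrow> complex) \<Rightarrow> complex \<Rightarrow> complex" where
  "sigma r f z = (\<Sum>n. sigma_coeff r f n * (1 / w_coord z) ^ (n + 1))"

text \<open>The series \<open>sigma\<close> is a power series in \<open>1 / w\<close>, so the circle \<open>\<bar>w\<bar> = c\<close> lies in its domain
  of holomorphy if \<open>1 / c\<close> is smaller than the radius of convergence. The integral does not depend
  on \<open>c\<close>.\<close>

definition pairing_omega :: "real \<Rightarrow> (complex \<Rightarrow> complex) \<Rightarrow> (complex \<Rightarrow> complex) \<Rightarrow> complex" where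
  "pairing_omega r h f =
     (THE y. \<exists>c. 0 < c \<and> c < 1 \<and> ereal (1 / c) < conv_radius (sigma_coeff r f) \<and>
        y = 1 / of_real pi *
          contour_integral (w_coord_inv \<circ> circlepath 0 c)
            (\<lambda>z. plus_twist r h z * sigma r f z / (z + \<i>)\<^sup>2))"

text \<open>The extension by continuity from \<open>D_omega r\<close> to \<open>D_infty r\<close>, in which \<open>D_omega r\<close> is dense.
  It exists whenever \<open>h\<close> has polynomial growth, in particular for modular forms.\<close>

definition pairing :: "real \<Rightarrow> (complex \<Rightarrow> complex) \<Rightarrow> (complex \<Rightarrow> complex) \<Rightarrow> complex" where
  "pairing r h f =
     (THE y. \<exists>\<Lambda>. continuous_map (D_infty_topology r) euclidean \<Lambda> \<and>
        (\<forall>g\<in>D_omega r. \<Lambda> g = pairing_omega r h g) \<and> y = \<Lambda> f)"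

definition geodesic_center :: "complex \<Rightarrow> complex \<Rightarrow> real" where
  "geodesic_center z1 z2 = ((cmod z2)\<^sup>2 - (cmod z1)\<^sup>2) / (2 * (Re z2 - Re z1))"

definition geodesic_path :: "complex \<Rightarrow> complex \<Rightarrow> real \<Rightarrow> complex" where
  "geodesic_path z1 z2 =
     (if Re z1 = Re z2 then linepath z1 z2
      else let x = complex_of_real (geodesic_center z1 z2)
           in part_circlepath x (cmod (z1 - x)) (Arg (z1 - x)) (Arg (z2 - x)))"

definition geodesic_segment :: "complex \<Rightarrow> complex \<Rightarrow> complex set" where
  "geodesic_segment z1 z2 = path_image (geodesic_path z1 z2)"

definition geodesic_line :: "complex \<Rightarrow> complex \<Rightarrow> complex set" where
  "geodesic_line z1 z2 =
     (if Re z1 = Re z2 then {z \<in> upper_half_plane. Re z = Re z1}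
      else let x = complex_of_real (geodesic_center z1 z2)
           in {z \<in> upper_half_plane. cmod (z - x) = cmod (z1 - x)})"

text \<open>Integral along the geodesic (vertical half-line) from \<open>z0\<close> to the cusp at infinity.\<close>

definition integral_to_cusp :: "complex \<Rightarrow> (complex \<Rightarrow> complex) \<Rightarrow> complex" where
  "integral_to_cusp z0 g = integral {Im z0..} (\<lambda>y. \<i> * g (Complex (Re z0) y))"

definition rho :: complex where
  "rho = exp (of_real pi * \<i> / 3)"

definition period_fun ::
    "real \<Rightarrow> (complex \<Rightarrow> complex) \<Rightarrow> complex \<Rightarrow> complex \<Rightarrow> complex \<Rightarrow> complex" where
  "period_fun r f z1 z2 t =
     contour_integral (geodesic_path z1 z2) (\<lambda>\<tau>. f \<tau> * (\<tau> - t) powr complex_of_real (r - 2))"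

definition period_fun_cusp ::
    "real \<Rightarrow> (complex \<Rightarrow> complex) \<Rightarrow> complex \<Rightarrow> complex \<Rightarrow> complex" where
  "period_fun_cusp r f z1 t =
     integral_to_cusp z1 (\<lambda>\<tau>. f \<tau> * (\<tau> - t) powr complex_of_real (r - 2))"

definition cp ::
    "real \<Rightarrow> real \<Rightarrow> (complex \<Rightarrow> complex) \<Rightarrow> (complex \<Rightarrow> complex) \<Rightarrow> complex \<Rightarrow> complex" where
  "cp r1 r2 f1 f2 t = period_fun r1 f1 (rho - 1) rho t * period_fun_cusp r2 f2 \<i> t"

definition trilinear_form ::
    "real \<Rightarrow> real \<Rightarrow> (complex \<Rightarrow> complex) \<Rightarrow> (complex \<Rightarrow> complex) \<Rightarrow> (complex \<Rightarrow> complex) \<Rightarrow> complex"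
  where
  "trilinear_form r1 r2 f1 f2 f3 = pairing (4 - r1 - r2) f3 (cp r1 r2 f1 f2)"

text \<open>The branch of \<open>q\<^sup>a\<close> that is holomorphic on \<open>D\<close> and positive on \<open>S\<close>.\<close>

definition branch_power ::
    "complex set \<Rightarrow> complex set \<Rightarrow> (complex \<Rightarrow> complex) \<Rightarrow> real \<Rightarrow> complex \<Rightarrow> complex" where
  "branch_power D S q a z =
     (THE y. \<exists>L. L holomorphic_on D \<and> (\<forall>x\<in>D. exp (L x) = q x) \<and>
        (\<forall>x\<in>S. \<exists>s::real. 0 < s \<and> exp (complex_of_real a * L x) = complex_of_real s) \<and>
        y = exp (complex_of_real a * L z))"

definition cut_domain :: "complex \<Rightarrow> complex \<Rightarrow> complex set" where
  "cut_domain \<tau>1 \<tau>2 = upper_half_plane - (geodesic_line \<tau>1 \<tau>2 - geodesic_segment \<tau>1 \<tau>2)"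

definition left_power :: "complex \<Rightarrow> complex \<Rightarrow> real \<Rightarrow> complex \<Rightarrow> complex" where
  "left_power \<tau>1 \<tau>2 =
     branch_power (cut_domain \<tau>1 \<tau>2 - {\<tau>1}) (open_segment \<tau>1 \<tau>2) (\<lambda>z. (z - \<tau>1) / (\<tau>2 - \<tau>1))"

definition right_power :: "complex \<Rightarrow> complex \<Rightarrow> real \<Rightarrow> complex \<Rightarrow> complex" where
  "right_power \<tau>1 \<tau>2 =
     branch_power (cut_domain \<tau>1 \<tau>2 - {\<tau>2}) (open_segment \<tau>1 \<tau>2) (\<lambda>z. (\<tau>2 - z) / (\<tau>2 - \<tau>1))"

text \<open>The two powers are undefined at \<open>\<tau>1\<close>, respectively \<open>\<tau>2\<close>, so a path of integration meets these
  points only at its ends.\<close>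

definition admissible_path :: "complex \<Rightarrow> complex \<Rightarrow> (real \<Rightarrow> complex) \<Rightarrow> bool" where
  "admissible_path \<tau>1 \<tau>2 g \<longleftrightarrow>
     valid_path g \<and> pathstart g = \<tau>1 \<and> pathfinish g = \<tau>2 \<and>
     path_image g \<subseteq> cut_domain \<tau>1 \<tau>2 \<and> (\<forall>t\<in>{0<..<1}. g t \<noteq> \<tau>1 \<and> g t \<noteq> \<tau>2)"

end

(*
In the disc coordinate zeta = (t + i)/(t - i) = 1/w of the lower half-plane the kernel
((i - t)/(tau - t))^a is, up to a factor depending on tau alone, a binomial series in zeta.
Hence each factor c_f of cp has as coefficients the integrals over tau of the coefficients of the
kernel, these decay rapidly, and cp has their Cauchy product d_n as coefficients. Continuity of the
pairing on smooth functions and density of polynomials give [h, f]_r = sum c_n n!/(r)_n d_n, where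
the coefficients c_n of f_3 grow polynomially because a modular form grows at most like a power of
1/Im z at the real line. Exchanging sum and integrals reduces the claim to two fixed points tau_1
and tau_2, where it is Feynman's parametrisation, a complex beta integral.

For the second formula, the integrand in z is holomorphic on the half-plane cut along the two ends
of the geodesic line, which is simply connected. It has a primitive there, the primitive has limits
at tau_1 and tau_2, and so every admissible path gives the value of the Euclidean segment.
The geodesic line is vertical only for a single tau_1, which does not affect the outer integral.
*)

theory Submission
  imports Defs
begin

section \<open>Rapidly decaying power series on the closed disc\<close>

text \<open>The pairing is given only as the value of a continuous extension, so the extension has
  to be shown to exist and to be unique. Both become statements on sequences once the seminorms are
  compared with weighted bounds on coefficients. The leg of \<open>f2\<close> runs into the cusp,
  where the coordinate w tends to 1 and geometric decay of the kernel is lost. There the decay of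
  the cusp form in y = Im \<tau> is traded against 1 - w, which is of order 1/y. The weight n!/(r)_n
  is what makes the parametrisation fit: n! stems from the binomial expansion of an n-th power,
  (r)_n from shifted Beta functions. The parametrisation is proved by a series that needs |\<tau>2 -
  \<tau>1| < |\<tau>2 + i|; this holds since \<tau>1 lies on the unit circle and \<tau>2 = i y with
  y \<ge> 1. All powers of the kernel are principal. Products of powers are combined only if the
  arguments differ by less than pi, hence the care for common half-planes. At its ends the integrand
  in z may be unbounded, with exponents above -1. An explicit local primitive, found by a power
  series, shows that the limits exist.\<close>

definition polynomially_bounded :: "(nat \<Rightarrow> complex) \<Rightarrow> bool" where
  "polynomially_bounded c \<longleftrightarrow> (\<exists>C m. \<forall>n. norm (c n) \<le> C * real (n + 1) ^ m)"

text \<open>These are the Taylor coefficients of the functions that are holomorphic in the unit disc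
  and smooth up to its boundary. The shift to n + 1 keeps the weight positive at n = 0.\<close>

definition rapidly_decaying :: "(nat \<Rightarrow> complex) \<Rightarrow> bool" where
  "rapidly_decaying d \<longleftrightarrow> (\<forall>k. \<exists>C. \<forall>n. norm (d n) * real (n + 1) ^ k \<le> C)"

definition disc_series :: "(nat \<Rightarrow> complex) \<Rightarrow> complex \<Rightarrow> complex" where
  "disc_series d z = (\<Sum>n. d n * z ^ n)"

lemma rapidly_decaying_mult:
  assumes "polynomially_bounded p" "rapidly_decaying d"
  shows "rapidly_decaying (\<lambda>n. p n * d n)"
  unfolding rapidly_decaying_def
proof
  fix k
  obtain C m where C: "\<And>n. norm (p n) \<le> C * real (n + 1) ^ m"
    using assms(1) unfolding polynomially_bounded_def by blast
  have C0: "C \<ge> 0" using C[of 0] norm_ge_zero[of "p 0"] by (simp del: norm_ge_zero)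
  obtain D where D: "\<And>n. norm (d n) * real (n + 1) ^ (m + k) \<le> D"
    using assms(2) unfolding rapidly_decaying_def by blast
  show "\<exists>C. \<forall>n. norm (p n * d n) * real (n + 1) ^ k \<le> C"
  proof (intro exI allI)
    fix n
    have "norm (p n * d n) * real (n + 1) ^ k \<le> (C * real (n + 1) ^ m) * norm (d n) * real (n + 1) ^ k"
      unfolding norm_mult by (intro mult_right_mono C) auto
    also have "\<dots> = C * (norm (d n) * real (n + 1) ^ (m + k))"
      by (simp add: power_add algebra_simps)
    also have "\<dots> \<le> C * D" by (intro mult_left_mono D C0)
    finally show "norm (p n * d n) * real (n + 1) ^ k \<le> C * D" .
  qed
qed

lemma polynomially_bounded_power: "polynomially_bounded (\<lambda>n. (c * of_nat n) ^ k)"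
  unfolding polynomially_bounded_def
proof (intro exI allI)
  fix n
  have "norm ((c * of_nat n) ^ k) = norm c ^ k * real n ^ k"
    by (simp add: norm_power norm_mult power_mult_distrib)
  also have "\<dots> \<le> norm c ^ k * real (n + 1) ^ k" by (intro mult_left_mono power_mono) auto
  finally show "norm ((c * of_nat n) ^ k) \<le> norm c ^ k * real (n + 1) ^ k" .
qed

lemma summable_inverse_squares: "summable (\<lambda>n. C / real (n + 1) ^ 2)"
proof -
  have "summable (\<lambda>n. inverse (real (Suc n) ^ 2))"
    by (subst summable_Suc_iff) (rule inverse_power_summable, simp)
  then have "summable (\<lambda>n. C * inverse (real (Suc n) ^ 2))" by (rule summable_mult)
  then show ?thesis by (simp add: field_simps)
qed

lemma rapidly_decaying_summable:
  assumes "rapidly_decaying d"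
  shows "summable (\<lambda>n. norm (d n))"
proof -
  obtain C where C: "\<And>n. norm (d n) * real (n + 1) ^ 2 \<le> C"
    using assms unfolding rapidly_decaying_def by blast
  have "norm (d n) \<le> C / real (n + 1) ^ 2" for n
    using C[of n] by (subst pos_le_divide_eq) auto
  then show ?thesis
    by (intro summable_comparison_test'[OF summable_inverse_squares[of C]]) auto
qed

lemma rapidly_decaying_diffs:
  assumes "rapidly_decaying d"
  shows "rapidly_decaying (diffs d)"
  unfolding rapidly_decaying_def
proof
  fix k
  obtain C where C: "\<And>n. norm (d n) * real (n + 1) ^ (k + 1) \<le> C"
    using assms unfolding rapidly_decaying_def by blast
  show "\<exists>C. \<forall>n. norm (diffs d n) * real (n + 1) ^ k \<le> C"
  proof (intro exI allI)
    fix n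
    have "norm (diffs d n) * real (n + 1) ^ k = norm (d (Suc n)) * real (Suc n) ^ (k + 1)"
      by (simp add: diffs_def norm_mult del: of_nat_Suc)
    also have "\<dots> \<le> norm (d (Suc n)) * real (Suc n + 1) ^ (k + 1)"
      by (intro mult_left_mono power_mono) auto
    also have "\<dots> \<le> C" by (rule C)
    finally show "norm (diffs d n) * real (n + 1) ^ k \<le> C" .
  qed
qed

lemma norm_disc_term_le:
  fixes z :: complex
  shows "norm z \<le> 1 \<Longrightarrow> norm (d n * z ^ n) \<le> norm (d n)"
  by (auto simp: norm_mult norm_power intro!: mult_left_le power_le_one)

lemma disc_series_sums:
  assumes "rapidly_decaying d" "norm z \<le> 1"
  shows "(\<lambda>n. d n * z ^ n) sums disc_series d z"
  unfolding disc_series_def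
  by (intro summable_sums summable_comparison_test'[OF rapidly_decaying_summable[OF assms(1)]]
      norm_disc_term_le assms)

lemma norm_disc_series_le:
  assumes "rapidly_decaying d" "norm z \<le> 1"
  shows "norm (disc_series d z) \<le> (\<Sum>n. norm (d n))"
proof -
  have s: "summable (\<lambda>n. norm (d n * z ^ n))"
    by (intro summable_comparison_test'[OF rapidly_decaying_summable[OF assms(1)]])
       (use norm_disc_term_le assms in auto)
  then have "norm (disc_series d z) \<le> (\<Sum>n. norm (d n * z ^ n))"
    unfolding disc_series_def by (rule summable_norm)
  also have "\<dots> \<le> (\<Sum>n. norm (d n))"
    by (intro suminf_le s rapidly_decaying_summable norm_disc_term_le assms)
  finally show ?thesis .
qed

text \<open>Termwise differentiation is needed up to the boundary circle, where the theorem on the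
  open disc of convergence says nothing. The derived series is dominated by n |d n| uniformly on the
  closed disc, and the closed disc is convex, which suffices.\<close>

lemma disc_series_has_field_derivative:
  assumes d: "rapidly_decaying d" and z: "z \<in> cball 0 1"
  shows "(disc_series d has_field_derivative disc_series (diffs d) z) (at z within cball 0 1)"
proof -
  let ?f = "\<lambda>n z. d n * z ^ n" and ?f' = "\<lambda>n z. d n * (of_nat n * z ^ (n - 1))"
  let ?M = "\<lambda>n. norm (of_nat n * d n)"
  have rap: "rapidly_decaying (\<lambda>n. of_nat n * d n)"
    using rapidly_decaying_mult[OF polynomially_bounded_power[of 1 1] d] by simp
  have bnd: "norm (?f' n x) \<le> ?M n" if "x \<in> cball 0 1" for n x
  proof -
    have "norm (?f' n x) = ?M n * norm x ^ (n - 1)"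
      by (simp add: norm_mult norm_power)
    also have "\<dots> \<le> ?M n" using that by (intro mult_left_le power_le_one) auto
    finally show ?thesis .
  qed
  have "uniform_limit (cball 0 1) (\<lambda>n x. \<Sum>i<n. ?f' i x) (\<lambda>x. \<Sum>i. ?f' i x) sequentially"
    using bnd rapidly_decaying_summable[OF rap] by (rule Weierstrass_m_test)
  from has_field_derivative_series[OF convex_cball _ this, of ?f 0]
  obtain g where g: "\<And>x. x \<in> cball 0 1 \<Longrightarrow> (\<lambda>n. ?f n x) sums g x \<and>
      (g has_field_derivative (\<Sum>i. ?f' i x)) (at x within cball 0 1)"
    using sums_summable[OF disc_series_sums[OF d, of 0]]
    by (force intro!: derivative_eq_intros)
  have geq: "g x = disc_series d x" if "x \<in> cball 0 1" for x
    using sums_unique2[OF conjunct1[OF g[OF that]] disc_series_sums[OF d]] that by simp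
  have "summable (\<lambda>n. ?f' n z)"
    by (rule summable_comparison_test'[OF rapidly_decaying_summable[OF rap]]) (use bnd z in blast)
  \<comment> \<open>The truncated exponent 0 - 1 does no harm: the term i = 0 has the factor
    0.\<close>
  then have "(\<Sum>i. ?f' i z) = (\<Sum>i. ?f' (Suc i) z)"
    by (subst suminf_split_head) auto
  also have "\<dots> = disc_series (diffs d) z"
    unfolding disc_series_def diffs_def by (simp add: mult_ac del: of_nat_Suc)
  finally have eq: "(\<Sum>i. ?f' i z) = disc_series (diffs d) z" .
  show ?thesis
    by (rule has_field_derivative_transform_within[of g _ _ _ 1]) (use g[OF z] eq geq z in auto)
qed

lemma continuous_on_disc_series:
  assumes "rapidly_decaying d"
  shows "continuous_on (cball 0 1) (disc_series d)"
  using disc_series_has_field_derivative[OF assms] DERIV_continuous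
  unfolding continuous_on_eq_continuous_within by blast

lemma holomorphic_on_disc_series:
  assumes "rapidly_decaying d"
  shows "disc_series d holomorphic_on ball 0 1"
  using disc_series_has_field_derivative[OF assms] ball_subset_cball
  unfolding holomorphic_on_def field_differentiable_def
  by (meson DERIV_subset in_mono)

text \<open>The two partial derivatives are f' and i f' (Cauchy-Riemann), and both are again rapidly
  decaying series. So the induction on the order stays in this class.\<close>

lemma Ck_on_disc_series:
  assumes "rapidly_decaying d"
  shows "Ck_on k (cball 0 1) (disc_series d)"
  using assms
proof (induction k arbitrary: d)
  case 0
  then show ?case by (simp add: continuous_on_disc_series)
next
  case (Suc k)
  have r: "rapidly_decaying (\<lambda>n. \<i> * diffs d n)"
    using rapidly_decaying_mult[OF polynomially_bounded_power[of 0 0] rapidly_decaying_diffs[OF Suc.prems]]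
    by (simp add: rapidly_decaying_def norm_mult)
  have eq: "disc_series (\<lambda>n. \<i> * diffs d n) z = \<i> * disc_series (diffs d) z" if "z \<in> cball 0 1" for z
  proof -
    have "(\<lambda>n. (\<i> * diffs d n) * z ^ n) sums (\<i> * disc_series (diffs d) z)"
      using sums_mult[OF disc_series_sums[OF rapidly_decaying_diffs[OF Suc.prems]], of z \<i>] that
      by (simp add: mult_ac)
    then show ?thesis using sums_unique2[OF disc_series_sums[OF r]] that by simp
  qed
  have h: "Re h *\<^sub>R D + Im h *\<^sub>R (\<i> * D) = D * h" for h D :: complex
    by (simp add: complex_eq_iff algebra_simps)
  show ?case
    unfolding Ck_on.simps
  proof (intro exI conjI ballI)
    show "Ck_on k (cball 0 1) (disc_series (diffs d))"
      by (rule Suc.IH[OF rapidly_decaying_diffs[OF Suc.prems]])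
    show "Ck_on k (cball 0 1) (disc_series (\<lambda>n. \<i> * diffs d n))"
      by (rule Suc.IH[OF r])
    fix z :: complex assume z: "z \<in> cball 0 1"
    have "((disc_series d) has_derivative (\<lambda>h. disc_series (diffs d) z * h)) (at z within cball 0 1)"
      using disc_series_has_field_derivative[OF Suc.prems z] by (simp add: has_field_derivative_def)
    then show "(disc_series d has_derivative (\<lambda>h. Re h *\<^sub>R disc_series (diffs d) z +
         Im h *\<^sub>R disc_series (\<lambda>n. \<i> * diffs d n) z)) (at z within cball 0 1)"
      by (simp only: eq[OF z] h)
  qed
qed

section \<open>Decay of the coefficients of a function smooth up to the boundary\<close>

lemma compact_norm_bound:
  fixes f :: "'a::topological_space \<Rightarrow> 'b::real_normed_vector"
  assumes "compact K" "continuous_on K f"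
  obtains M where "\<And>x. x \<in> K \<Longrightarrow> norm (f x) \<le> M"
proof -
  have "bounded (f ` K)" by (intro compact_imp_bounded compact_continuous_image assms)
  then obtain M where "\<forall>y\<in>f ` K. norm y \<le> M" unfolding bounded_iff by (elim exE) (rule that)
  then show ?thesis using that by blast
qed

text \<open>Inside the disc the x-derivative supplied by smoothness is the complex derivative. It is
  continuous on the compact closed disc, and this bounds it.\<close>

lemma Ck_on_deriv_bounded:
  assumes "Ck_on k (cball 0 1) G" "G holomorphic_on ball 0 1"
  shows "\<exists>M. \<forall>z\<in>ball 0 1. norm ((deriv ^^ k) G z) \<le> M"
  using assms
proof (induction k arbitrary: G)
  case 0
  then have "continuous_on (cball 0 1) G" by simp
  then obtain M where "norm (G z) \<le> M" if "z \<in> cball 0 1" for z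
    using compact_norm_bound[OF compact_cball] by blast
  then have "\<forall>z\<in>ball 0 1. norm ((deriv ^^ 0) G z) \<le> M" by auto
  then show ?case by blast
next
  case (Suc k)
  obtain fx fy where
    fxy: "(\<forall>z\<in>cball 0 1. (G has_derivative (\<lambda>h. Re h *\<^sub>R fx z + Im h *\<^sub>R fy z)) (at z within cball 0 1)) \<and>
       Ck_on k (cball 0 1) fx \<and> Ck_on k (cball 0 1) fy"
    using Suc.prems(1) unfolding Ck_on.simps by (elim exE) (rule that)
  note fx = bspec[OF conjunct1[OF fxy]] conjunct1[OF conjunct2[OF fxy]]
  have eq: "fx z = deriv G z" if z: "z \<in> ball 0 1" for z
  proof -
    have "(G has_derivative (\<lambda>h. Re h *\<^sub>R fx z + Im h *\<^sub>R fy z)) (at z within ball 0 1)"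
      by (rule has_derivative_subset[OF fx(1) ball_subset_cball]) (use z in simp)
    then have 1: "(G has_derivative (\<lambda>h. Re h *\<^sub>R fx z + Im h *\<^sub>R fy z)) (at z)"
      by (simp only: at_within_open[OF z open_ball])
    have 2: "(G has_derivative (\<lambda>h. deriv G z * h)) (at z)"
      using holomorphic_derivI[OF Suc.prems(2) open_ball z] by (simp add: has_field_derivative_def)
    \<comment> \<open>Both derivatives are evaluated in the direction h = 1.\<close>
    from has_derivative_unique[OF 1 2] have "Re 1 *\<^sub>R fx z + Im 1 *\<^sub>R fy z = deriv G z * 1"
      by (rule fun_cong)
    then show ?thesis by (simp only: complex.sel one_complex.sel scaleR_one scaleR_zero_left add_0_right mult_1_right)
  qed
  have hol: "fx holomorphic_on ball 0 1"
    by (rule holomorphic_transform[OF holomorphic_deriv[OF Suc.prems(2) open_ball]]) (simp only: eq)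
  have eqk: "(deriv ^^ k) fx z = (deriv ^^ Suc k) G z" if z: "z \<in> ball 0 1" for z
  proof -
    have "eventually (\<lambda>x. fx x = deriv G x) (nhds z)"
      using eventually_nhds_in_open[OF open_ball z] by eventually_elim (rule eq)
    then have "(deriv ^^ k) fx z = (deriv ^^ k) (deriv G) z"
      by (rule higher_deriv_cong_ev) simp
    then show ?thesis by (simp add: funpow_swap1)
  qed
  obtain M where "\<forall>z\<in>ball 0 1. norm ((deriv ^^ k) fx z) \<le> M"
    using Suc.IH[OF fx(2) hol] by (elim exE) (rule that)
  then have "\<forall>z\<in>ball 0 1. norm ((deriv ^^ Suc k) G z) \<le> M"
    by (intro ballI, subst eqk[symmetric]) (assumption, erule (1) bspec)
  then show ?case by (rule exI)
qed

definition disc_coeff :: "(complex \<Rightarrow> complex) \<Rightarrow> nat \<Rightarrow> complex" where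
  "disc_coeff F n = fps_nth (fps_expansion F 0) n"

lemma disc_coeff_sums:
  assumes "F holomorphic_on ball 0 r" "norm z < r"
  shows "(\<lambda>n. disc_coeff F n * z ^ n) sums F z"
  using holomorphic_power_series[OF assms(1), of z] assms(2)
  by (simp add: disc_coeff_def fps_expansion_def)

lemma disc_coeff_unique:
  assumes "\<And>z. norm z < r \<Longrightarrow> (\<lambda>n. d n * z ^ n) sums F z" "r > 0"
  shows "disc_coeff F n = d n"
proof -
  have s: "summable (\<lambda>n. d n * of_real (r / 2) ^ n)"
    using assms(1)[of "of_real (r / 2)"] assms(2) by (simp add: sums_iff)
  have "conv_radius d \<ge> norm (of_real (r / 2) :: complex)"
    by (rule conv_radius_geI) (use s in simp)
  then have cr: "conv_radius d > 0" using assms(2)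
    by (metis ereal_less(2) half_gt_zero norm_of_real abs_of_pos order_less_le_trans)
  have "F has_fps_expansion Abs_fps d"
    unfolding has_fps_expansion_def
  proof
    show "0 < fps_conv_radius (Abs_fps d)" using cr by (simp add: fps_conv_radius_def Abs_fps_inverse)
    have "eventually (\<lambda>z::complex. z \<in> ball 0 r) (nhds 0)"
      using assms(2) by (intro eventually_nhds_in_open) auto
    then show "\<forall>\<^sub>F z in nhds 0. eval_fps (Abs_fps d) z = F z"
      by eventually_elim (use assms(1) in \<open>auto simp: eval_fps_def sums_iff\<close>)
  qed
  then show ?thesis by (simp add: disc_coeff_def fps_expansion_eqI)
qed

lemma disc_coeff_disc_series:
  assumes "rapidly_decaying d"
  shows "disc_coeff (disc_series d) n = d n"
  by (rule disc_coeff_unique[of 1]) (use disc_series_sums[OF assms] in auto)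

lemma norm_disc_coeff_le:
  assumes "F holomorphic_on ball 0 1" "0 < r" "r < 1" "\<And>z. norm z = r \<Longrightarrow> norm (F z) \<le> B"
  shows "norm (disc_coeff F n) \<le> B / r ^ n"
proof -
  have "norm ((deriv ^^ n) F 0) \<le> fact n * B / r ^ n"
  proof (rule Cauchy_inequality)
    show "F holomorphic_on ball 0 r" by (rule holomorphic_on_subset[OF assms(1)]) (use assms in auto)
    show "continuous_on (cball 0 r) F"
      by (rule holomorphic_on_imp_continuous_on[OF holomorphic_on_subset[OF assms(1)]]) (use assms in auto)
  qed (use assms in auto)
  then show ?thesis
    by (simp add: disc_coeff_def fps_expansion_def norm_divide pos_divide_le_eq mult_ac)
qed

text \<open>Cauchy's estimate needs a circle inside the open disc, so the radius tends to 1 from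
  below; no boundary values enter.\<close>

lemma norm_disc_coeff_le_bounded:
  assumes "F holomorphic_on ball 0 1" "\<And>z. norm z < 1 \<Longrightarrow> norm (F z) \<le> B"
  shows "norm (disc_coeff F n) \<le> B"
proof (rule tendsto_lowerbound)
  show "((\<lambda>r. B / r ^ n) \<longlongrightarrow> B) (at_left 1)"
    by (auto intro!: tendsto_eq_intros)
  show "\<forall>\<^sub>F r in at_left 1. norm (disc_coeff F n) \<le> B / r ^ n"
    using eventually_at_left_real[of 0 "1::real", OF zero_less_one]
    by eventually_elim (auto intro!: norm_disc_coeff_le assms)
qed auto

text \<open>The k-th derivative is bounded, and its n-th coefficient is (n + k)!/n! times the
  coefficient with index n + k. That quotient is at least (n + 1)^k.\<close>

lemma rapidly_decaying_disc_coeff: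
  assumes Ck: "\<And>k. Ck_on k (cball 0 1) G" and hol: "G holomorphic_on ball 0 1"
  shows "rapidly_decaying (disc_coeff G)"
  unfolding rapidly_decaying_def
proof
  fix k
  obtain M where M: "\<And>z. z \<in> ball 0 1 \<Longrightarrow> norm ((deriv ^^ k) G z) \<le> M"
    using Ck_on_deriv_bounded[OF Ck hol] by blast
  have M0: "M \<ge> 0" using M[of 0] norm_ge_zero by (meson centre_in_ball order_trans zero_less_one)
  have holk: "(deriv ^^ k) G holomorphic_on ball 0 1"
    by (rule holomorphic_higher_deriv[OF hol]) auto
  have bd: "norm (disc_coeff G (n + k)) * real (n + 1) ^ k \<le> M" for n
  proof -
    have "disc_coeff ((deriv ^^ k) G) n = (fact (n + k) / fact n) * disc_coeff G (n + k)"
      by (simp add: disc_coeff_def fps_expansion_def funpow_add[symmetric, THEN fun_cong, simplified])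
    then have "norm (fact (n + k) / fact n * disc_coeff G (n + k)) \<le> M"
      using norm_disc_coeff_le_bounded[OF holk, of M n] M by simp
    moreover have "real (n + 1) ^ k \<le> fact (n + k) / fact n"
    proof (induction k)
      case (Suc k)
      have "real (n + 1) ^ Suc k \<le> (real (n + k + 1)) * (fact (n + k) / fact n)"
        unfolding power_Suc by (intro mult_mono Suc) auto
      also have "\<dots> = fact (n + Suc k) / fact n" by simp
      finally show ?case .
    qed auto
    then have "real (n + 1) ^ k * norm (disc_coeff G (n + k)) \<le> fact (n + k) / fact n * norm (disc_coeff G (n + k))"
      by (rule mult_right_mono) auto
    ultimately show ?thesis by (simp add: norm_mult norm_divide mult.commute)
  qed
  \<comment> \<open>The finite sum covers the first k coefficients, which the k-th derivative does
    not see. The factor (k + 1)^k comes from j + k + 1 \<le> (j + 1)(k + 1) for n = j + k.\<close>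
  define C where "C = M * real (k + 1) ^ k + (\<Sum>n<k. norm (disc_coeff G n) * real (n + 1) ^ k)"
  have "norm (disc_coeff G n) * real (n + 1) ^ k \<le> C" for n
  proof (cases "n < k")
    case True
    then have "norm (disc_coeff G n) * real (n + 1) ^ k \<le> (\<Sum>n<k. norm (disc_coeff G n) * real (n + 1) ^ k)"
      by (intro member_le_sum[of n "{..<k}" "\<lambda>n. norm (disc_coeff G n) * real (n + 1) ^ k"]) auto
    also have "\<dots> \<le> C" using M0 by (simp add: C_def)
    finally show ?thesis .
  next
    case False
    then obtain j where n: "n = j + k" by (metis add.commute le_Suc_ex not_less)
    have "real (n + 1) \<le> real (j + 1) * real (k + 1)" unfolding n
      by (simp add: algebra_simps)
    then have "real (n + 1) ^ k \<le> (real (j + 1) * real (k + 1)) ^ k"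
      by (intro power_mono) auto
    then have "norm (disc_coeff G n) * real (n + 1) ^ k \<le> norm (disc_coeff G n) * (real (j + 1) * real (k + 1)) ^ k"
      by (intro mult_left_mono) auto
    also have "\<dots> = (norm (disc_coeff G (j + k)) * real (j + 1) ^ k) * real (k + 1) ^ k"
      by (simp add: n power_mult_distrib)
    also have "\<dots> \<le> M * real (k + 1) ^ k" by (intro mult_right_mono bd) auto
    also have "\<dots> \<le> C" by (simp add: C_def sum_nonneg)
    finally show ?thesis .
  qed
  then show "\<exists>C. \<forall>n. norm (disc_coeff G n) * real (n + 1) ^ k \<le> C" by blast
qed


section \<open>Smooth functions of weight \<open>r\<close> and their coefficients\<close>

lemma Im_lower_half_plane_param:
  assumes "norm \<zeta> < 1"
  shows "Im (\<i> * (\<zeta> + 1) / (\<zeta> - 1)) < 0"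
proof -
  have "\<zeta> \<noteq> 1" using assms by auto
  then have pos: "(Re \<zeta> - 1)\<^sup>2 + (Im \<zeta>)\<^sup>2 > 0"
    by (auto simp: complex_eq_iff sum_power2_gt_zero_iff)
  have "(Re \<zeta>)\<^sup>2 + (Im \<zeta>)\<^sup>2 < 1"
    using assms by (simp add: cmod_def real_sqrt_less_iff[of _ 1, simplified])
  then have "(Re \<zeta> + 1) * (Re \<zeta> - 1) + Im \<zeta> * Im \<zeta> < 0"
    by (simp add: power2_eq_square algebra_simps)
  moreover have "Im (\<i> * (\<zeta> + 1) / (\<zeta> - 1)) =
      ((Re \<zeta> + 1) * (Re \<zeta> - 1) + Im \<zeta> * Im \<zeta>) / ((Re \<zeta> - 1)\<^sup>2 + (Im \<zeta>)\<^sup>2)"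
    by (simp add: Im_divide algebra_simps)
  ultimately show ?thesis using pos by (simp add: divide_neg_pos)
qed

lemma minus_disc_holomorphic:
  assumes "f holomorphic_on lower_half_plane"
  shows "minus_disc r f holomorphic_on ball 0 1"
proof -
  let ?t = "\<lambda>\<zeta>. \<i> * (\<zeta> + 1) / (\<zeta> - 1)"
  have t: "?t holomorphic_on ball 0 1"
    by (intro holomorphic_intros) auto
  have im: "?t ` ball 0 1 \<subseteq> lower_half_plane"
    using Im_lower_half_plane_param by (auto simp: lower_half_plane_def)
  have "(\<lambda>t. (\<i> - t) powr complex_of_real r * f t) holomorphic_on lower_half_plane"
    by (intro holomorphic_intros assms) (auto simp: lower_half_plane_def complex_nonpos_Reals_iff)
  from holomorphic_on_compose_gen[OF t this im] show ?thesis
    unfolding minus_disc_def[abs_def] minus_twist_def o_def .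
qed

definition minus_expansion :: "real \<Rightarrow> (complex \<Rightarrow> complex) \<Rightarrow> (nat \<Rightarrow> complex) \<Rightarrow> bool" where
  "minus_expansion r f d \<longleftrightarrow> rapidly_decaying d \<and> (\<forall>\<zeta>\<in>ball 0 1. minus_disc r f \<zeta> = disc_series d \<zeta>)"

lemma minus_expansion_coeff:
  assumes "minus_expansion r f d"
  shows "minus_coeff r f = d"
proof
  fix n
  have "disc_coeff (minus_disc r f) n = d n"
    by (rule disc_coeff_unique[of 1])
       (use assms disc_series_sums[of d] in \<open>auto simp: minus_expansion_def\<close>)
  then show "minus_coeff r f n = d n" by (simp add: minus_coeff_def disc_coeff_def)
qed

text \<open>From left to right by bounds on the derivatives, back by termwise differentiation up to
  the boundary. From here on a smooth vector is treated as its sequence of coefficients.\<close>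

lemma D_infty_iff:
  "f \<in> D_infty r \<longleftrightarrow> f holomorphic_on lower_half_plane \<and> minus_expansion r f (minus_coeff r f)"
proof
  assume f: "f \<in> D_infty r"
  then obtain G where G: "f holomorphic_on lower_half_plane" "\<And>k. Ck_on k (cball 0 1) G"
      "\<And>\<zeta>. \<zeta> \<in> ball 0 1 \<Longrightarrow> G \<zeta> = minus_disc r f \<zeta>"
    unfolding D_infty_def by blast
  have hol: "minus_disc r f holomorphic_on ball 0 1" by (rule minus_disc_holomorphic[OF G(1)])
  then have holG: "G holomorphic_on ball 0 1" by (rule holomorphic_transform) (simp only: G(3))
  note rap = rapidly_decaying_disc_coeff[OF G(2) holG]
  have "minus_disc r f \<zeta> = disc_series (disc_coeff G) \<zeta>" if "\<zeta> \<in> ball 0 1" for \<zeta>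
    using sums_unique2[OF disc_coeff_sums[OF holG] disc_series_sums[OF rap], of \<zeta>] G(3)[OF that] that
    by simp
  then have "minus_expansion r f (disc_coeff G)" using rap by (simp add: minus_expansion_def)
  with minus_expansion_coeff[OF this] G(1)
  show "f holomorphic_on lower_half_plane \<and> minus_expansion r f (minus_coeff r f)" by simp
next
  assume "f holomorphic_on lower_half_plane \<and> minus_expansion r f (minus_coeff r f)"
  then show "f \<in> D_infty r"
    unfolding D_infty_def minus_expansion_def
    by (auto intro!: exI[of _ "disc_series (minus_coeff r f)"] Ck_on_disc_series)
qed

lemma minus_expansion_diff:
  assumes "minus_expansion r f d" "minus_expansion r g e"
  shows "minus_expansion r (\<lambda>t. f t - g t) (\<lambda>n. d n - e n)"
  unfolding minus_expansion_def
proof (intro conjI ballI)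
  show rap: "rapidly_decaying (\<lambda>n. d n - e n)"
    unfolding rapidly_decaying_def
  proof
    fix k
    obtain C D where CD: "\<And>n. norm (d n) * real (n + 1) ^ k \<le> C" "\<And>n. norm (e n) * real (n + 1) ^ k \<le> D"
      using assms unfolding minus_expansion_def rapidly_decaying_def by metis
    have "norm (d n - e n) * real (n + 1) ^ k \<le> C + D" for n
    proof -
      have "norm (d n - e n) * real (n + 1) ^ k \<le> (norm (d n) + norm (e n)) * real (n + 1) ^ k"
        by (intro mult_right_mono norm_triangle_ineq4) auto
      also have "\<dots> \<le> C + D" unfolding distrib_right by (intro add_mono CD)
      finally show ?thesis .
    qed
    then show "\<exists>C. \<forall>n. norm (d n - e n) * real (n + 1) ^ k \<le> C" by blast
  qed
  fix \<zeta> :: complex assume z: "\<zeta> \<in> ball 0 1"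
  have "(\<lambda>n. (d n - e n) * \<zeta> ^ n) sums (disc_series d \<zeta> - disc_series e \<zeta>)"
    using sums_diff[OF disc_series_sums disc_series_sums, of d \<zeta> e] assms z
    by (simp add: minus_expansion_def algebra_simps)
  then have "disc_series (\<lambda>n. d n - e n) \<zeta> = disc_series d \<zeta> - disc_series e \<zeta>"
    using sums_unique2[OF disc_series_sums[OF rap]] z by simp
  moreover have "minus_disc r (\<lambda>t. f t - g t) \<zeta> = minus_disc r f \<zeta> - minus_disc r g \<zeta>"
    by (simp add: minus_disc_def minus_twist_def right_diff_distrib)
  ultimately show "minus_disc r (\<lambda>t. f t - g t) \<zeta> = disc_series (\<lambda>n. d n - e n) \<zeta>"
    using assms z by (simp only: minus_expansion_def)
qed

section \<open>The seminorms in terms of coefficients\<close>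

lemma boundary_value_eq:
  assumes "minus_expansion r f d"
  shows "boundary_value r f \<theta> = disc_series d (cis (- 2 * \<theta>))"
  unfolding boundary_value_def
proof (rule tendsto_Lim)
  let ?z = "cis (- 2 * \<theta>)"
  have z: "?z \<in> cball 0 1" by simp
  have "?z islimpt ball 0 1" using z by (subst islimpt_ball) auto
  then show "at ?z within ball 0 1 \<noteq> bot" by (simp add: trivial_limit_within)
  have "(disc_series d \<longlongrightarrow> disc_series d ?z) (at ?z within cball 0 1)"
    using continuous_on_disc_series[of d] assms z
    unfolding minus_expansion_def continuous_on_def by blast
  then have "(disc_series d \<longlongrightarrow> disc_series d ?z) (at ?z within ball 0 1)"
    by (rule tendsto_within_subset) auto
  then show "(minus_disc r f \<longlongrightarrow> disc_series d ?z) (at ?z within ball 0 1)"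
    by (rule Lim_transform_eventually)
       (use assms in \<open>auto simp: minus_expansion_def eventually_at_filter\<close>)
qed

text \<open>The boundary point with t = - cot \<theta> has \<zeta> = exp(-2 i \<theta>), so
  d/d\<theta> multiplies the coefficient of \<zeta>^n by -2 i n. This is the effect of k
  derivatives.\<close>

definition boundary_deriv_coeff :: "nat \<Rightarrow> (nat \<Rightarrow> complex) \<Rightarrow> nat \<Rightarrow> complex" where
  "boundary_deriv_coeff k d n = ((- 2 * \<i>) * of_nat n) ^ k * d n"

lemma rapidly_decaying_boundary_deriv_coeff:
  "rapidly_decaying d \<Longrightarrow> rapidly_decaying (boundary_deriv_coeff k d)"
  unfolding boundary_deriv_coeff_def
  by (rule rapidly_decaying_mult[OF polynomially_bounded_power])

lemma disc_series_circle_has_vector_derivative: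
  assumes "rapidly_decaying d"
  shows "((\<lambda>\<theta>. disc_series d (cis (- 2 * \<theta>))) has_vector_derivative
    disc_series (boundary_deriv_coeff 1 d) (cis (- 2 * \<theta>))) (at \<theta>)"
proof -
  let ?z = "cis (- 2 * \<theta>)"
  have 1: "((\<lambda>\<theta>. cis (- 2 * \<theta>)) has_vector_derivative (- 2) *\<^sub>R (\<i> * ?z)) (at \<theta>)"
  proof -
    have "((\<lambda>z. exp (- 2 * \<i> * z)) has_field_derivative (- 2 * \<i>) * exp (- 2 * \<i> * of_real \<theta>)) (at (of_real \<theta>))"
      by (auto intro!: derivative_eq_intros)
    from has_vector_derivative_real_field[OF this] show ?thesis
      by (simp add: cis_conv_exp scaleR_conv_of_real mult_ac)
  qed
  have 2: "(disc_series d has_field_derivative disc_series (diffs d) ?z) (at ?z within (\<lambda>\<theta>. cis (- 2 * \<theta>)) ` UNIV)"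
    by (rule DERIV_subset[OF disc_series_has_field_derivative[OF assms]]) auto
  have "(\<lambda>n. diffs d n * ?z ^ n) sums disc_series (diffs d) ?z"
    by (rule disc_series_sums[OF rapidly_decaying_diffs[OF assms]]) simp
  then have "(\<lambda>n. (- 2 * \<i> * ?z) * (diffs d n * ?z ^ n)) sums ((- 2 * \<i> * ?z) * disc_series (diffs d) ?z)"
    by (rule sums_mult)
  then have "(\<lambda>n. boundary_deriv_coeff 1 d (Suc n) * ?z ^ Suc n) sums ((- 2 * \<i> * ?z) * disc_series (diffs d) ?z)"
    by (simp add: boundary_deriv_coeff_def diffs_def mult_ac del: of_nat_Suc)
  then have "(\<lambda>n. boundary_deriv_coeff 1 d n * ?z ^ n) sums ((- 2 * \<i> * ?z) * disc_series (diffs d) ?z)"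
    by (subst (asm) sums_Suc_iff) (simp add: boundary_deriv_coeff_def)
  then have "disc_series (boundary_deriv_coeff 1 d) ?z = (- 2 * \<i> * ?z) * disc_series (diffs d) ?z"
    by (simp add: disc_series_def sums_iff)
  moreover have "((\<lambda>\<theta>. disc_series d (cis (- 2 * \<theta>))) has_vector_derivative
      ((- 2) *\<^sub>R (\<i> * ?z)) * disc_series (diffs d) ?z) (at \<theta>)"
    using field_vector_diff_chain_within[OF 1 2] unfolding o_def .
  moreover have "((- 2) *\<^sub>R (\<i> * ?z)) * disc_series (diffs d) ?z = (- 2 * \<i> * ?z) * disc_series (diffs d) ?z"
    by (simp only: scaleR_conv_of_real) simp
  ultimately show ?thesis by (simp only:)
qed

lemma higher_boundary_derivative:
  assumes "minus_expansion r f d"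
  shows "((\<lambda>g x. vector_derivative g (at x)) ^^ k) (boundary_value r f) =
    (\<lambda>\<theta>. disc_series (boundary_deriv_coeff k d) (cis (- 2 * \<theta>)))"
proof (induction k)
  case 0
  then show ?case using boundary_value_eq[OF assms]
    by (simp add: fun_eq_iff boundary_deriv_coeff_def[abs_def])
next
  case (Suc k)
  have rap: "rapidly_decaying (boundary_deriv_coeff k d)"
    using assms by (auto simp: minus_expansion_def intro: rapidly_decaying_boundary_deriv_coeff)
  have eq: "boundary_deriv_coeff 1 (boundary_deriv_coeff k d) = boundary_deriv_coeff (Suc k) d"
    by (simp add: fun_eq_iff boundary_deriv_coeff_def)
  show ?case
    using vector_derivative_at[OF disc_series_circle_has_vector_derivative[OF rap]]
    by (simp only: funpow.simps o_apply Suc.IH fun_eq_iff eq) simp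
qed

lemma D_seminorm_eq:
  assumes "minus_expansion r f d"
  shows "D_seminorm r k f = (SUP \<theta>. norm (disc_series (boundary_deriv_coeff k d) (cis (- 2 * \<theta>))))"
  unfolding D_seminorm_def higher_boundary_derivative[OF assms] ..

text \<open>Together with the reverse estimate \<open>norm_coeff_le_D_seminorm\<close> this compares
  the seminorms with weighted norms of sequences. This half yields the convergence of partial sums,
  the other the continuity of coefficient functionals.\<close>

lemma D_seminorm_le:
  assumes "minus_expansion r f d"
  shows "D_seminorm r k f \<le> (\<Sum>n. norm (boundary_deriv_coeff k d n))"
  unfolding D_seminorm_eq[OF assms]
  by (rule cSUP_least)
     (use assms in \<open>auto simp: minus_expansion_def intro!: norm_disc_series_le rapidly_decaying_boundary_deriv_coeff\<close>)

lemma bdd_above_disc_series_circle: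
  assumes "rapidly_decaying d"
  shows "bdd_above (range (\<lambda>\<theta>. norm (disc_series d (cis (- 2 * \<theta>)))))"
  by (rule bdd_aboveI2) (auto intro!: norm_disc_series_le[OF assms])

text \<open>Cauchy's estimate is applied on the unit circle itself, which is allowed because the
  series is continuous on the closed disc. For k > 0 it carries no information at n = 0.\<close>

lemma norm_coeff_le_D_seminorm:
  assumes "minus_expansion r f d"
  shows "norm (d n) * (2 * real n) ^ k \<le> D_seminorm r k f"
proof -
  let ?e = "boundary_deriv_coeff k d"
  have rap: "rapidly_decaying ?e"
    using assms by (auto simp: minus_expansion_def intro: rapidly_decaying_boundary_deriv_coeff)
  have "norm ((deriv ^^ n) (disc_series ?e) 0) \<le> fact n * D_seminorm r k f / 1 ^ n"
  proof (rule Cauchy_inequality)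
    fix z :: complex assume "norm (0 - z) = 1"
    \<comment> \<open>The angle of a boundary point is minus half its argument.\<close>
    then have z: "z = cis (- 2 * (- Arg z / 2))" by (cases "z = 0") (auto simp: cis_Arg sgn_eq)
    show "norm (disc_series ?e z) \<le> D_seminorm r k f"
      unfolding D_seminorm_eq[OF assms]
      by (subst z, rule cSUP_upper[OF UNIV_I bdd_above_disc_series_circle[OF rap]])
  qed (auto intro: continuous_on_disc_series holomorphic_on_disc_series rap)
  then have "norm (disc_coeff (disc_series ?e) n) \<le> D_seminorm r k f"
    by (simp add: disc_coeff_def fps_expansion_def norm_divide pos_divide_le_eq mult_ac)
  then show ?thesis
    by (simp add: disc_coeff_disc_series[OF rap] boundary_deriv_coeff_def norm_mult norm_power
        power_mult_distrib mult_ac)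
qed

lemma minus_expansion_zero: "minus_expansion r (\<lambda>t. 0) (\<lambda>n. 0)"
  by (auto simp: minus_expansion_def rapidly_decaying_def disc_series_def minus_disc_def minus_twist_def
        intro: exI[of _ 0])

text \<open>The basic open sets are balls about arbitrary centres. This inequality allows
  convergence to f to be tested in balls that contain f but are centred elsewhere.\<close>

lemma D_seminorm_triangle:
  assumes "minus_expansion r (\<lambda>t. f t - g t) d" "minus_expansion r (\<lambda>t. g t - h t) e"
  shows "D_seminorm r k (\<lambda>t. f t - h t) \<le> D_seminorm r k (\<lambda>t. f t - g t) + D_seminorm r k (\<lambda>t. g t - h t)"
proof -
  let ?D = "boundary_deriv_coeff k"
  have eq: "(\<lambda>t. (f t - g t) - (h t - g t)) = (\<lambda>t. f t - h t)" by (simp add: fun_eq_iff)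
  have rd: "rapidly_decaying d" "rapidly_decaying e" using assms by (auto simp: minus_expansion_def)
  have m: "minus_expansion r (\<lambda>t. h t - g t) (\<lambda>n. - e n)"
    using minus_expansion_diff[OF minus_expansion_zero assms(2)] by simp
  have fh: "minus_expansion r (\<lambda>t. f t - h t) (\<lambda>n. d n + e n)"
    using minus_expansion_diff[OF assms(1) m] by (simp add: eq)
  have rap: "rapidly_decaying (\<lambda>n. d n + e n)" using fh by (simp add: minus_expansion_def)
  note R = rapidly_decaying_boundary_deriv_coeff
  show ?thesis
    unfolding D_seminorm_eq[OF fh] D_seminorm_eq[OF assms(1)] D_seminorm_eq[OF assms(2)]
  proof (rule cSUP_least)
    fix \<theta> :: real
    let ?z = "cis (- 2 * \<theta>)"
    have "(\<lambda>n. ?D (\<lambda>n. d n + e n) n * ?z ^ n) sums (disc_series (?D d) ?z + disc_series (?D e) ?z)"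
      using sums_add[OF disc_series_sums[OF R[OF rd(1)], of ?z] disc_series_sums[OF R[OF rd(2)], of ?z]]
      by (simp add: boundary_deriv_coeff_def algebra_simps)
    then have "disc_series (?D (\<lambda>n. d n + e n)) ?z = disc_series (?D d) ?z + disc_series (?D e) ?z"
      using sums_unique2[OF disc_series_sums[OF R[OF rap], of ?z]] by simp
    then have "norm (disc_series (?D (\<lambda>n. d n + e n)) ?z) \<le> norm (disc_series (?D d) ?z) + norm (disc_series (?D e) ?z)"
      by (simp add: norm_triangle_ineq)
    also have "\<dots> \<le> (SUP \<theta>. norm (disc_series (?D d) (cis (- 2 * \<theta>)))) + (SUP \<theta>. norm (disc_series (?D e) (cis (- 2 * \<theta>))))"
      by (intro add_mono cSUP_upper UNIV_I bdd_above_disc_series_circle R rd)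
    finally show "norm (disc_series (?D (\<lambda>n. d n + e n)) ?z) \<le> \<dots>" .
  qed auto
qed


section \<open>The bilinear form as a series of coefficients\<close>

text \<open>Since (r)_n \<ge> r (n - 1)! for n \<ge> 1, the quotient is then at most n/r. The
  summand 1 takes care of n = 0, where the quotient equals 1.\<close>

lemma norm_fact_over_pochhammer_le:
  assumes "r > 0"
  shows "norm (fact n / pochhammer (complex_of_real r) n) \<le> (1 + 1 / r) * real (n + 1)"
proof (cases n)
  case (Suc m)
  have le: "r * fact m \<le> pochhammer r (Suc m)"
  proof (induction m)
    case (Suc m)
    have "r * fact (Suc m) = (r * fact m) * real (Suc m)" by simp
    also have "\<dots> \<le> pochhammer r (Suc m) * (r + real (Suc m))"
      using assms by (intro mult_mono Suc) (auto intro: pochhammer_pos less_imp_le)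
    finally show ?case by (simp add: pochhammer_Suc)
  qed (simp add: pochhammer_rec)
  have "norm (fact n / pochhammer (complex_of_real r) n) = fact n / pochhammer r n"
    using pochhammer_pos[OF assms, of n]
    by (simp add: pochhammer_of_real norm_divide)
  also have "\<dots> \<le> fact n / (r * fact m)"
    using assms le pochhammer_pos[OF assms, of "Suc m"] unfolding Suc
    by (intro divide_left_mono mult_pos_pos) auto
  also have "\<dots> = real n / r" unfolding Suc fact_Suc by (simp del: of_nat_Suc)
  also have "\<dots> \<le> (1 + 1 / r) * real (n + 1)" using assms by (simp add: field_simps)
  finally show ?thesis .
qed (use assms in auto)

definition plus_coeff :: "real \<Rightarrow> (complex \<Rightarrow> complex) \<Rightarrow> nat \<Rightarrow> complex" where
  "plus_coeff r h = disc_coeff (\<lambda>w. plus_twist r h (w_coord_inv w))"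

definition pairing_weight :: "real \<Rightarrow> (complex \<Rightarrow> complex) \<Rightarrow> nat \<Rightarrow> complex" where
  "pairing_weight r h n = plus_coeff r h n * (fact n / pochhammer (complex_of_real r) n)"

lemma Im_w_coord_inv:
  assumes "norm w < 1"
  shows "Im (w_coord_inv w) = (1 - (norm w)\<^sup>2) / (norm (1 - w))\<^sup>2"
  unfolding w_coord_inv_def cmod_power2
  by (simp add: Im_divide power2_eq_square algebra_simps)

lemma Im_w_coord_inv_pos:
  assumes "norm w < 1"
  shows "Im (w_coord_inv w) > 0"
proof -
  have "1 - w \<noteq> 0" using assms by auto
  moreover have "(norm w)\<^sup>2 < 1" using assms by (simp add: power_less_one_iff abs_square_less_1)
  ultimately show ?thesis unfolding Im_w_coord_inv[OF assms] by simp
qed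

lemma w_coord_inv_add_i:
  assumes "w \<noteq> 1"
  shows "w_coord_inv w + \<i> = 2 * \<i> / (1 - w)"
  using assms by (simp add: w_coord_inv_def field_simps)

lemma w_coord_inv_w_coord:
  assumes "z \<noteq> - \<i>"
  shows "w_coord_inv (w_coord z) = z"
proof -
  have "z + \<i> \<noteq> 0" using assms by (metis eq_neg_iff_add_eq_0)
  then have "1 - w_coord z = 2 * \<i> / (z + \<i>)" "1 + w_coord z = 2 * z / (z + \<i>)"
    by (auto simp: w_coord_def field_simps)
  then show ?thesis using \<open>z + \<i> \<noteq> 0\<close> by (simp add: w_coord_inv_def)
qed

lemma w_coord_w_coord_inv:
  assumes "w \<noteq> 1"
  shows "w_coord (w_coord_inv w) = w"
  using assms by (simp add: w_coord_def w_coord_inv_def field_simps)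

lemma plus_twist_holomorphic:
  assumes "h holomorphic_on upper_half_plane"
  shows "(\<lambda>w. plus_twist r h (w_coord_inv w)) holomorphic_on ball 0 1"
proof -
  have t: "w_coord_inv holomorphic_on ball 0 1"
    unfolding w_coord_inv_def[abs_def] by (intro holomorphic_intros) auto
  have im: "w_coord_inv ` ball 0 1 \<subseteq> upper_half_plane"
    using Im_w_coord_inv_pos by (auto simp: upper_half_plane_def)
  have "(\<lambda>z. (- \<i> - z) powr complex_of_real r * h z) holomorphic_on upper_half_plane"
    by (intro holomorphic_intros assms) (auto simp: upper_half_plane_def complex_nonpos_Reals_iff)
  from holomorphic_on_compose_gen[OF t this im] show ?thesis
    unfolding plus_twist_def o_def .
qed

text \<open>A function analytic on the closed disc is holomorphic on a larger concentric disc, by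
  compactness. The radius of convergence strictly above 1 leaves room for the circle of
  integration.\<close>

lemma conv_radius_minus_coeff:
  assumes "g \<in> D_omega r"
  shows "conv_radius (minus_coeff r g) > 1"
proof -
  obtain G where G: "G analytic_on cball 0 1" "\<And>\<zeta>. \<zeta> \<in> ball 0 1 \<Longrightarrow> G \<zeta> = minus_disc r g \<zeta>"
    using assms by (auto simp: D_omega_def)
  obtain S where S: "open S" "cball 0 1 \<subseteq> S" "G holomorphic_on S"
    using G(1) analytic_on_holomorphic by blast
  obtain e where e: "e > 0" "(\<Union>x\<in>cball 0 1. ball x e) \<subseteq> S"
    using compact_subset_open_imp_ball_epsilon_subset[OF compact_cball S(1,2)] by blast
  have "ball (0::complex) (1 + e) \<subseteq> (\<Union>x\<in>cball 0 1. ball x e)"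
  proof
    fix z :: complex assume z: "z \<in> ball 0 (1 + e)"
    show "z \<in> (\<Union>x\<in>cball 0 1. ball x e)"
    proof (cases "norm z \<le> 1")
      case True
      then show ?thesis using e(1) by (intro UN_I[of z]) auto
    next
      case False
      have z0: "z \<noteq> 0" using False by auto
      have "dist (z / of_real (norm z)) z = norm (z / of_real (norm z) * of_real (1 - norm z))"
        unfolding dist_norm using False
        by (intro arg_cong[of _ _ norm]) (cases "z = 0", auto simp: divide_simps right_diff_distrib)
      also have "\<dots> = \<bar>1 - norm z\<bar>" using z0 by (simp add: norm_mult norm_divide del: of_real_diff)
      \<comment> \<open>A point outside the unit disc lies within e of its radial projection to the
        circle.\<close>
      finally show ?thesis using False z
        by (intro UN_I[of "z / of_real (norm z)"]) (auto simp: norm_divide)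
    qed
  qed
  with e S(3) have hol: "G holomorphic_on ball 0 (1 + e)" by (meson holomorphic_on_subset order_trans)
  have "disc_coeff (minus_disc r g) n = disc_coeff G n" for n
    by (rule disc_coeff_unique[of 1])
       (use disc_coeff_sums[OF hol] G(2)[symmetric] e(1) in \<open>auto simp del: G(2)\<close>)
  then have eq: "minus_coeff r g = disc_coeff G" by (simp add: fun_eq_iff minus_coeff_def disc_coeff_def)
  have "conv_radius (disc_coeff G) \<ge> norm (of_real (1 + e / 2) :: complex)"
    by (rule conv_radius_geI, rule sums_summable[OF disc_coeff_sums[OF hol]]) (use e(1) in \<open>simp del: of_real_add\<close>)
  moreover have "1 < ereal (norm (of_real (1 + e / 2) :: complex))"
    using e(1) by (simp del: of_real_add)
  ultimately show ?thesis unfolding eq by (rule less_le_trans[rotated])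
qed

text \<open>The factor n!/(r)_n grows at most linearly, so it costs only an arbitrarily small part
  of the radius: (n + 1) (\<rho>'/\<rho>)^n is bounded for \<rho>' < \<rho>.\<close>

lemma conv_radius_sigma_coeff:
  assumes "r > 0" "g \<in> D_omega r"
  shows "conv_radius (sigma_coeff r g) > 1"
proof -
  obtain \<rho> where \<rho>: "1 < ereal \<rho>" "ereal \<rho> < conv_radius (minus_coeff r g)"
    using ereal_dense2[OF conv_radius_minus_coeff[OF assms(2)]] by blast
  then have \<rho>1: "\<rho> > 1" by (simp add: one_ereal_def)
  define \<rho>' where "\<rho>' = (1 + \<rho>) / 2"
  have \<rho>': "1 < \<rho>'" "\<rho>' < \<rho>" using \<rho>1 by (auto simp: \<rho>'_def)
  have s1: "summable (\<lambda>n. norm (minus_coeff r g n * of_real \<rho> ^ n))"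
    by (rule abs_summable_in_conv_radius) (use \<rho> \<rho>1 in simp)
  \<comment> \<open>The derivative of the geometric series converges, so its terms tend to 0 and are
    bounded.\<close>
  have "summable (\<lambda>n. of_nat (Suc n) * (\<rho>' / \<rho>) ^ n)"
    using \<rho>' by (intro sums_summable[OF geometric_deriv_sums]) simp
  then have "(\<lambda>n. of_nat (Suc n) * (\<rho>' / \<rho>) ^ n) \<longlonglongrightarrow> 0" by (rule summable_LIMSEQ_zero)
  then have "Bseq (\<lambda>n. of_nat (Suc n) * (\<rho>' / \<rho>) ^ n)" by (rule convergent_imp_Bseq[OF convergentI])
  then obtain K where K: "\<And>n. norm (of_nat (Suc n) * (\<rho>' / \<rho>) ^ n) \<le> K"
    by (auto simp: Bseq_def)
  have "summable (\<lambda>n. sigma_coeff r g n * of_real \<rho>' ^ n)"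
  proof (rule summable_comparison_test'[where N = 0])
    show "summable (\<lambda>n. ((1 + 1 / r) * K) * norm (minus_coeff r g n * of_real \<rho> ^ n))"
      by (rule summable_mult[OF s1])
    fix n
    have "norm (sigma_coeff r g n * of_real \<rho>' ^ n) =
        norm (fact n / pochhammer (complex_of_real r) n) * (norm (minus_coeff r g n) * \<rho>' ^ n)"
      using \<rho>' by (simp add: sigma_coeff_def norm_mult norm_power norm_divide)
    also have "\<dots> \<le> ((1 + 1 / r) * real (n + 1)) * (norm (minus_coeff r g n) * \<rho>' ^ n)"
      using \<rho>' by (intro mult_right_mono norm_fact_over_pochhammer_le assms) auto
    also have "\<dots> = (1 + 1 / r) * (real (n + 1) * (\<rho>' / \<rho>) ^ n) * norm (minus_coeff r g n * of_real \<rho> ^ n)"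
      using \<rho>1 by (simp add: norm_mult norm_power power_divide)
    also have "\<dots> \<le> (1 + 1 / r) * K * norm (minus_coeff r g n * of_real \<rho> ^ n)"
      using K[of n] assms(1) \<rho>' by (intro mult_right_mono mult_left_mono) (auto simp: norm_mult)
    finally show "norm (sigma_coeff r g n * of_real \<rho>' ^ n) \<le> ((1 + 1 / r) * K) * norm (minus_coeff r g n * of_real \<rho> ^ n)"
      by simp
  qed
  then have "conv_radius (sigma_coeff r g) \<ge> norm (of_real \<rho>' :: complex)" by (rule conv_radius_geI)
  moreover have "1 < ereal (norm (of_real \<rho>' :: complex))" using \<rho>' by simp
  ultimately show ?thesis by (rule less_le_trans[rotated])
qed

text \<open>In the coordinate w one has dz/(z + i)^2 = dw/(2 i), so the prefactor 1/pi becomes the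
  1/(2 pi i) of Cauchy's formula. The n-th term of \<open>sigma\<close> then picks out the n-th
  Taylor coefficient of the twisted h.\<close>

lemma pairing_integral_sums:
  assumes h: "h holomorphic_on upper_half_plane"
    and c: "0 < c" "c < 1" "ereal (1 / c) < conv_radius (sigma_coeff r g)"
  shows "(\<lambda>n. plus_coeff r h n * sigma_coeff r g n) sums
    (1 / of_real pi * contour_integral (w_coord_inv \<circ> circlepath 0 c)
       (\<lambda>z. plus_twist r h z * sigma r g z / (z + \<i>)\<^sup>2))"
proof -
  define C where "C = (\<lambda>w. plus_twist r h (w_coord_inv w))"
  let ?s = "sigma_coeff r g"
  have holC: "C holomorphic_on ball 0 1" unfolding C_def by (rule plus_twist_holomorphic[OF h])
  define F where "F = (\<lambda>n w. C w * (?s n * (1 / w) ^ (n + 1)))"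
  let ?I = "contour_integral (circlepath 0 c) (\<lambda>w. \<Sum>i. F i w)"
  have contC: "continuous_on (cball 0 c) C"
    by (rule holomorphic_on_imp_continuous_on[OF holomorphic_on_subset[OF holC]]) (use c in auto)
  have holC': "C holomorphic_on ball 0 c"
    by (rule holomorphic_on_subset[OF holC]) (use c in auto)
  obtain M where M: "\<And>w. w \<in> cball 0 c \<Longrightarrow> norm (C w) \<le> M"
    using compact_norm_bound[OF compact_cball contC] by blast
  have ci: "(F n has_contour_integral (2 * of_real pi * \<i>) * (plus_coeff r h n * ?s n)) (circlepath 0 c)" for n
  proof -
    have "((\<lambda>u. C u / (u - 0) ^ Suc n) has_contour_integral (2 * of_real pi * \<i> / fact n) * (deriv ^^ n) C 0) (circlepath 0 c)"
      using Cauchy_has_contour_integral_higher_derivative_circlepath[OF contC holC' centre_in_ball[THEN iffD2, OF c(1)], of n]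
      by (simp only: of_real_mult of_real_numeral)
    from has_contour_integral_lmul[OF this, of "?s n"] show ?thesis
      unfolding F_def plus_coeff_def disc_coeff_def fps_expansion_def C_def[symmetric]
      by (simp add: power_one_over divide_inverse mult_ac power_inverse)
  qed
  have unif: "uniform_limit (sphere 0 c) (\<lambda>n w. \<Sum>i<n. F i w) (\<lambda>w. \<Sum>i. F i w) sequentially"
  proof (rule Weierstrass_m_test)
    show "summable (\<lambda>n. (M * (1 / c)) * norm (?s n * of_real (1 / c) ^ n))"
      by (rule summable_mult, rule abs_summable_in_conv_radius) (use c in \<open>simp add: norm_divide\<close>)
    fix n :: nat and w :: complex assume w: "w \<in> sphere 0 c"
    have "norm (F n w) = norm (C w) * ((1 / c) * norm (?s n * of_real (1 / c) ^ n))"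
    proof -
      have nw: "norm w = c" using w by simp
      have "norm (F n w) = norm (C w) * (norm (?s n) * (1 / c) ^ (n + 1))"
        by (simp only: F_def norm_mult norm_power norm_divide nw norm_one)
      moreover have "norm (?s n * of_real (1 / c) ^ n) = norm (?s n) * (1 / c) ^ n"
        using c by (simp add: norm_mult norm_power norm_divide)
      ultimately show ?thesis by simp
    qed
    also have "\<dots> \<le> M * ((1 / c) * norm (?s n * of_real (1 / c) ^ n))"
      using w c by (intro mult_right_mono M) auto
    finally show "norm (F n w) \<le> (M * (1 / c)) * norm (?s n * of_real (1 / c) ^ n)" by simp
  qed
  have ev: "\<forall>\<^sub>F n in sequentially. (\<lambda>w. \<Sum>i<n. F i w) contour_integrable_on circlepath 0 c"
    by (intro always_eventually allI contour_integrable_sum)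
       (use ci in \<open>auto simp: contour_integrable_on_def\<close>)
  note UL = contour_integral_uniform_limit_circlepath[OF ev unif trivial_limit_sequentially c(1)]
  note UL(2)
  moreover have "contour_integral (circlepath 0 c) (\<lambda>w. \<Sum>i<n. F i w) =
      (\<Sum>i<n. (2 * of_real pi * \<i>) * (plus_coeff r h i * ?s i))" for n
    by (rule contour_integral_unique, rule has_contour_integral_sum) (use ci in auto)
  ultimately have "(\<lambda>n. (2 * of_real pi * \<i>) * (plus_coeff r h n * ?s n)) sums
      ?I"
    by (simp add: sums_def)
  then have "(\<lambda>n. (1 / (2 * of_real pi * \<i>)) * ((2 * of_real pi * \<i>) * (plus_coeff r h n * ?s n))) sums
      ((1 / (2 * of_real pi * \<i>)) * ?I)"
    by (rule sums_mult)
  then have S: "(\<lambda>n. plus_coeff r h n * ?s n) sums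
      ((1 / (2 * of_real pi * \<i>)) * ?I)"
    by simp
  have "w_coord_inv analytic_on ball 0 1"
    unfolding w_coord_inv_def[abs_def] by (intro analytic_intros) auto
  then have "contour_integral (w_coord_inv \<circ> circlepath 0 c) (\<lambda>z. plus_twist r h z * sigma r g z / (z + \<i>)\<^sup>2) =
      contour_integral (circlepath 0 c) (\<lambda>w. deriv w_coord_inv w *
        (plus_twist r h (w_coord_inv w) * sigma r g (w_coord_inv w) / (w_coord_inv w + \<i>)\<^sup>2))"
    by (rule contour_integral_comp_analyticW) (use c in auto)
  also have "\<dots> = contour_integral (circlepath 0 c) (\<lambda>w. (1 / (2 * \<i>)) * (\<Sum>i. F i w))"
  proof (rule contour_integral_cong[OF refl])
    fix w assume "w \<in> path_image (circlepath 0 c)"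
    then have w: "norm w = c" "w \<noteq> 1" using c by auto
    have "(w_coord_inv has_field_derivative 2 * \<i> / (1 - w)\<^sup>2) (at w)"
      unfolding w_coord_inv_def[abs_def] using w
      by (auto intro!: derivative_eq_intros simp: field_simps power2_eq_square)
    then have d: "deriv w_coord_inv w = 2 * \<i> / (1 - w)\<^sup>2" by (rule DERIV_imp_deriv)
    have "summable (\<lambda>n. ?s n * (1 / w) ^ n)"
      by (rule summable_in_conv_radius) (use w c in \<open>simp add: norm_divide\<close>)
    then have "summable (\<lambda>n. (1 / w) * (?s n * (1 / w) ^ n))" by (rule summable_mult)
    then have "summable (\<lambda>n. ?s n * (1 / w) ^ (n + 1))" by (simp add: mult_ac)
    then have "(\<Sum>i. F i w) = C w * sigma r g (w_coord_inv w)"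
      unfolding F_def sigma_def w_coord_w_coord_inv[OF w(2)] by (rule suminf_mult)
    then show "deriv w_coord_inv w * (plus_twist r h (w_coord_inv w) * sigma r g (w_coord_inv w) / (w_coord_inv w + \<i>)\<^sup>2) =
        (1 / (2 * \<i>)) * (\<Sum>i. F i w)"
    proof -
      define v where "v = 1 - w"
      have "v \<noteq> 0" using w(2) by (simp add: v_def)
      moreover have "\<i> * (\<i> * x) = - x" for x :: complex by (simp flip: mult.assoc)
      ultimately show ?thesis
        unfolding d w_coord_inv_add_i[OF w(2)] \<open>(\<Sum>i. F i w) = C w * sigma r g (w_coord_inv w)\<close>
          C_def v_def[symmetric]
        by (simp add: divide_simps power2_eq_square)
    qed
  qed
  also have "\<dots> = (1 / (2 * \<i>)) * ?I"
    by (rule contour_integral_lmul[OF UL(1)])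
  finally have eq: "contour_integral (w_coord_inv \<circ> circlepath 0 c) (\<lambda>z. plus_twist r h z * sigma r g z / (z + \<i>)\<^sup>2) =
      1 / (2 * \<i>) * ?I" .
  have "1 / of_real pi * (1 / (2 * \<i>) * ?I) =
      (1 / (2 * of_real pi * \<i>)) * ?I"
  proof -
    have "1 / a * (1 / (2 * b) * J) = 1 / (2 * a * b) * J" for a b J :: complex by simp
    then show ?thesis .
  qed
  with S show ?thesis unfolding eq by (simp only:)
qed

text \<open>The sum does not involve the radius c, so all permitted circles give one value and the
  description in \<open>pairing_omega\<close> denotes it. A circle exists because the radius of
  convergence exceeds 1.\<close>

lemma pairing_omega_eq:
  assumes h: "h holomorphic_on upper_half_plane" and r: "r > 0" and g: "g \<in> D_omega r"
  shows "(\<lambda>n. pairing_weight r h n * minus_coeff r g n) sums pairing_omega r h g"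
proof -
  let ?V = "\<lambda>c. 1 / of_real pi * contour_integral (w_coord_inv \<circ> circlepath 0 c)
       (\<lambda>z. plus_twist r h z * sigma r g z / (z + \<i>)\<^sup>2)"
  let ?P = "\<lambda>c. 0 < c \<and> c < 1 \<and> ereal (1 / c) < conv_radius (sigma_coeff r g)"
  obtain \<rho> where \<rho>: "1 < ereal \<rho>" "ereal \<rho> < conv_radius (sigma_coeff r g)"
    using ereal_dense2[OF conv_radius_sigma_coeff[OF r g]] by blast
  then have \<rho>1: "\<rho> > 1" by (simp add: one_ereal_def)
  have P: "?P (1 / \<rho>)" using \<rho> \<rho>1 by auto
  have eq: "(\<lambda>n. pairing_weight r h n * minus_coeff r g n) = (\<lambda>n. plus_coeff r h n * sigma_coeff r g n)"
    by (simp add: fun_eq_iff pairing_weight_def sigma_coeff_def)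
  have s: "(\<lambda>n. pairing_weight r h n * minus_coeff r g n) sums ?V c" if "?P c" for c
    unfolding eq using that by (elim conjE) (rule pairing_integral_sums[OF h])
  have "pairing_omega r h g = ?V (1 / \<rho>)"
    unfolding pairing_omega_def
  proof (rule the_equality)
    show "\<exists>c>0. c < 1 \<and> ereal (1 / c) < conv_radius (sigma_coeff r g) \<and> ?V (1 / \<rho>) = ?V c"
      using P by (intro exI[of _ "1 / \<rho>"]) (simp only: conj_assoc simp_thms)
    fix y assume "\<exists>c>0. c < 1 \<and> ereal (1 / c) < conv_radius (sigma_coeff r g) \<and> y = ?V c"
    then obtain c where c: "?P c" "y = ?V c" by (elim exE conjE) (rule that, simp)
    show "y = ?V (1 / \<rho>)" unfolding c(2) by (rule sums_unique2[OF s[OF c(1)] s[OF P]])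
  qed
  then show ?thesis using s[OF P] by simp
qed


section \<open>Continuity of coefficient functionals on smooth functions\<close>

lemma polynomially_bounded_mult:
  assumes "polynomially_bounded p" "polynomially_bounded q"
  shows "polynomially_bounded (\<lambda>n. p n * q n)"
proof -
  obtain C k D l where *: "\<And>n. norm (p n) \<le> C * real (n + 1) ^ k" "\<And>n. norm (q n) \<le> D * real (n + 1) ^ l"
    using assms unfolding polynomially_bounded_def by blast
  have "norm (p n * q n) \<le> (C * D) * real (n + 1) ^ (k + l)" for n
  proof -
    have "norm (p n * q n) \<le> (C * real (n + 1) ^ k) * (D * real (n + 1) ^ l)"
      unfolding norm_mult by (intro mult_mono * norm_ge_zero order_trans[OF norm_ge_zero *(1)])
    then show ?thesis by (simp add: power_add algebra_simps)
  qed
  then show ?thesis unfolding polynomially_bounded_def by blast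
qed

lemma polynomially_bounded_pairing_weight:
  assumes "r > 0" "polynomially_bounded (plus_coeff r h)"
  shows "polynomially_bounded (pairing_weight r h)"
proof -
  have "polynomially_bounded (\<lambda>n. fact n / pochhammer (complex_of_real r) n)"
    unfolding polynomially_bounded_def
    using norm_fact_over_pochhammer_le[OF assms(1)] power_one_right by metis
  from polynomially_bounded_mult[OF assms(2) this] show ?thesis
    by (simp add: pairing_weight_def[abs_def])
qed

lemma D_seminorm_zero_le: "D_seminorm r k (\<lambda>t. f t - f t) \<le> 0"
  using D_seminorm_le[OF minus_expansion_zero, of r k] by (simp add: boundary_deriv_coeff_def)

definition D_ball :: "real \<Rightarrow> (complex \<Rightarrow> complex) \<Rightarrow> nat \<Rightarrow> real \<Rightarrow> (complex \<Rightarrow> complex) set" where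
  "D_ball r f k \<epsilon> = {g \<in> D_infty r. D_seminorm r k (\<lambda>t. g t - f t) < \<epsilon>}"

lemma openin_D_ball:
  "f \<in> D_infty r \<Longrightarrow> \<epsilon> > 0 \<Longrightarrow> openin (D_infty_topology r) (D_ball r f k \<epsilon>)"
  unfolding D_infty_topology_def openin_topology_generated_by_iff D_ball_def
  by (rule generate_topology_on.Basis) blast

lemma centre_in_D_ball: "f \<in> D_infty r \<Longrightarrow> \<epsilon> > 0 \<Longrightarrow> f \<in> D_ball r f k \<epsilon>"
  using D_seminorm_zero_le[of r k f] by (auto simp: D_ball_def)

lemma topspace_D_infty_topology: "topspace (D_infty_topology r) = D_infty r"
proof
  show "topspace (D_infty_topology r) \<subseteq> D_infty r"
    unfolding D_infty_topology_def topology_generated_by_topspace by auto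
  show "D_infty r \<subseteq> topspace (D_infty_topology r)"
    using openin_subset[OF openin_D_ball[OF _ zero_less_one]] centre_in_D_ball[OF _ zero_less_one] by blast
qed

text \<open>If p grows like n^m, a bound on the seminorm of order m + 2 makes the differences of the
  terms smaller than a multiple of 1/(n + 1)^2, which is summable.\<close>

lemma continuous_map_coeff_series:
  assumes p: "polynomially_bounded p"
  shows "continuous_map (D_infty_topology r) euclidean (\<lambda>f. \<Sum>n. p n * minus_coeff r f n)"
  unfolding continuous_map_def topspace_D_infty_topology
proof (intro conjI allI impI)
  let ?L = "\<lambda>f. \<Sum>n. p n * minus_coeff r f n"
  show "?L \<in> D_infty r \<rightarrow> topspace euclidean" by simp
  obtain C m where C: "\<And>n. norm (p n) \<le> C * real (n + 1) ^ m"
    using p unfolding polynomially_bounded_def by blast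
  have C0: "C \<ge> 0" using C[of 0] order_trans[OF norm_ge_zero] by fastforce
  define S where "S = (\<Sum>n. C / real (n + 1) ^ 2)"
  have S0: "S \<ge> 0" unfolding S_def by (rule suminf_nonneg[OF summable_inverse_squares]) (use C0 in simp)
  fix U :: "complex set" assume "openin euclidean U"
  then have U: "open U" by simp
  show "openin (D_infty_topology r) {f \<in> D_infty r. ?L f \<in> U}"
  proof (subst openin_subopen, intro ballI)
    fix f assume "f \<in> {f \<in> D_infty r. ?L f \<in> U}"
    then have f: "f \<in> D_infty r" "?L f \<in> U" by auto
    obtain \<epsilon> where \<epsilon>: "\<epsilon> > 0" "ball (?L f) \<epsilon> \<subseteq> U" using U f(2) open_contains_ball by blast
    \<comment> \<open>S can be 0, hence the denominator S + 1.\<close>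
    define \<delta> where "\<delta> = \<epsilon> / (S + 1)"
    have \<delta>: "\<delta> > 0" "\<delta> * S < \<epsilon>" using \<epsilon> S0 by (auto simp: \<delta>_def field_simps)
    \<comment> \<open>Two balls are needed: the seminorm of order m + 2 controls only n > 0, because
      the weight (2 n)^(m + 2) vanishes at n = 0. The seminorm of order 0 controls the constant
      term.\<close>
    let ?T = "D_ball r f 0 \<delta> \<inter> D_ball r f (m + 2) \<delta>"
    have "?T \<subseteq> {f \<in> D_infty r. ?L f \<in> U}"
    proof
      fix g assume g: "g \<in> ?T"
      then have gD: "g \<in> D_infty r" by (simp add: D_ball_def)
      let ?d = "\<lambda>n. minus_coeff r g n - minus_coeff r f n"
      have e: "minus_expansion r (\<lambda>t. g t - f t) ?d"
        by (rule minus_expansion_diff) (use gD f in \<open>auto simp: D_infty_iff\<close>)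
      have bnd: "norm (p n * ?d n) \<le> \<delta> * (C / real (n + 1) ^ 2)" for n
      proof -
        have "norm (?d n) * real (n + 1) ^ (m + 2) \<le> \<delta>"
        proof (cases n)
          case 0
          then show ?thesis using norm_coeff_le_D_seminorm[OF e, of 0 0] g by (simp add: D_ball_def)
        next
          case (Suc j)
          \<comment> \<open>For n \<ge> 1 one has n + 1 \<le> 2 n.\<close>
          have "norm (?d n) * real (n + 1) ^ (m + 2) \<le> norm (?d n) * (2 * real n) ^ (m + 2)"
            unfolding Suc by (intro mult_left_mono power_mono) auto
          also have "\<dots> \<le> D_seminorm r (m + 2) (\<lambda>t. g t - f t)" by (rule norm_coeff_le_D_seminorm[OF e])
          also have "\<dots> \<le> \<delta>" using g by (simp add: D_ball_def)
          finally show ?thesis .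
        qed
        moreover have "norm (p n * ?d n) \<le> C * real (n + 1) ^ m * norm (?d n)"
          unfolding norm_mult by (intro mult_right_mono C) auto
        moreover have "N \<le> \<delta> * (C / a ^ 2)" if "X * a ^ (m + 2) \<le> \<delta>" "N \<le> C * a ^ m * X" "a > 0"
          for N X a :: real
        proof -
          have "N * a ^ 2 \<le> (C * a ^ m * X) * a ^ 2" by (intro mult_right_mono that) simp
          also have "\<dots> = C * (X * a ^ (m + 2))" by (simp add: power_add power2_eq_square)
          also have "\<dots> \<le> C * \<delta>" by (intro mult_left_mono that C0)
          finally show ?thesis using that(3) by (simp add: field_simps)
        qed
        ultimately show ?thesis by simp
      qed
      have sf: "summable (\<lambda>n. p n * minus_coeff r f n)" and sg: "summable (\<lambda>n. p n * minus_coeff r g n)"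
        using f gD p rapidly_decaying_mult rapidly_decaying_summable summable_norm_cancel
        by (force simp: D_infty_iff minus_expansion_def)+
      have sb: "summable (\<lambda>n. \<delta> * (C / real (n + 1) ^ 2))" by (intro summable_mult summable_inverse_squares)
      have sn: "summable (\<lambda>n. norm (p n * ?d n))"
        by (rule summable_comparison_test'[OF sb]) (use bnd in simp)
      have "?L g - ?L f = (\<Sum>n. p n * ?d n)"
        using suminf_diff[OF sg sf] by (simp add: algebra_simps)
      then have "norm (?L g - ?L f) \<le> (\<Sum>n. norm (p n * ?d n))" using summable_norm[OF sn] by simp
      also have "\<dots> \<le> (\<Sum>n. \<delta> * (C / real (n + 1) ^ 2))" by (rule suminf_le[OF bnd sn sb])
      also have "\<dots> = \<delta> * S" unfolding S_def by (rule suminf_mult[OF summable_inverse_squares])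
      finally have "?L g \<in> ball (?L f) \<epsilon>" using \<delta> by (simp add: dist_norm norm_minus_commute)
      then show "g \<in> {f \<in> D_infty r. ?L f \<in> U}" using gD \<epsilon> by blast
    qed
    moreover have "openin (D_infty_topology r) ?T" by (intro openin_Int openin_D_ball f \<delta>)
    moreover have "f \<in> ?T" using centre_in_D_ball f \<delta> by blast
    ultimately show "\<exists>T. openin (D_infty_topology r) T \<and> f \<in> T \<and> T \<subseteq> {f \<in> D_infty r. ?L f \<in> U}"
      by blast
  qed
qed

section \<open>Density of polynomials and the extended pairing\<close>

definition partial_expansion :: "real \<Rightarrow> (nat \<Rightarrow> complex) \<Rightarrow> nat \<Rightarrow> complex \<Rightarrow> complex" where
  "partial_expansion r d N t =
     (\<i> - t) powr complex_of_real (- r) * (\<Sum>n<N. d n * ((t + \<i>) / (t - \<i>)) ^ n)"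

text \<open>The factor (i - t)^(-r) in the definition undoes the twist, and (t + i)/(t - i) is
  \<zeta>. So the function corresponds to a polynomial, which extends analytically beyond the
  disc.\<close>

lemma minus_disc_partial_expansion:
  assumes "norm \<zeta> < 1"
  shows "minus_disc r (partial_expansion r d N) \<zeta> = (\<Sum>n<N. d n * \<zeta> ^ n)"
proof -
  let ?t = "\<i> * (\<zeta> + 1) / (\<zeta> - 1)"
  have ne: "\<zeta> - 1 \<noteq> 0" using assms by auto
  have "?t + \<i> = 2 * \<i> * \<zeta> / (\<zeta> - 1)" "?t - \<i> = 2 * \<i> / (\<zeta> - 1)"
    using ne by (auto simp: field_simps)
  then have q: "(?t + \<i>) / (?t - \<i>) = \<zeta>" using ne by simp
  have "?t \<noteq> \<i>" using Im_lower_half_plane_param[OF assms] by auto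
  then have "(\<i> - ?t) powr complex_of_real r * (\<i> - ?t) powr complex_of_real (- r) = 1"
    by (simp add: powr_minus)
  then show ?thesis
    unfolding minus_disc_def minus_twist_def partial_expansion_def q mult.assoc[symmetric] by simp
qed

lemma partial_expansion_holomorphic: "partial_expansion r d N holomorphic_on lower_half_plane"
  unfolding partial_expansion_def[abs_def]
  by (intro holomorphic_intros) (auto simp: lower_half_plane_def complex_nonpos_Reals_iff)

lemma partial_expansion_in_D_omega: "partial_expansion r d N \<in> D_omega r"
  unfolding D_omega_def
proof (safe intro!: partial_expansion_holomorphic exI[of _ "\<lambda>\<zeta>. \<Sum>n<N. d n * \<zeta> ^ n"])
  show "(\<lambda>\<zeta>. \<Sum>n<N. d n * \<zeta> ^ n) analytic_on cball 0 1" by (intro analytic_intros)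
qed (simp add: minus_disc_partial_expansion)

lemma minus_expansion_partial_expansion:
  "minus_expansion r (partial_expansion r d N) (\<lambda>n. if n < N then d n else 0)"
  unfolding minus_expansion_def
proof (intro conjI ballI)
  show "rapidly_decaying (\<lambda>n. if n < N then d n else 0)"
    unfolding rapidly_decaying_def
  proof (intro allI exI)
    fix k n
    show "norm (if n < N then d n else 0) * real (n + 1) ^ k \<le> (\<Sum>n<N. norm (d n) * real (n + 1) ^ k)"
      by (auto intro!: member_le_sum sum_nonneg)
  qed
  fix \<zeta> :: complex assume "\<zeta> \<in> ball 0 1"
  then show "minus_disc r (partial_expansion r d N) \<zeta> = disc_series (\<lambda>n. if n < N then d n else 0) \<zeta>"
    unfolding disc_series_def
    by (subst suminf_finite[of "{..<N}"]) (auto simp: minus_disc_partial_expansion)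
qed

text \<open>The error has, up to sign, the coefficients of f from N on, and its seminorms are
  bounded by tails of convergent series. Since the topology is given by generators, neighbourhoods
  of f are handled by induction on how they are generated.\<close>

lemma limitin_partial_expansion:
  assumes f: "f \<in> D_infty r"
  shows "limitin (D_infty_topology r) (partial_expansion r (minus_coeff r f)) f sequentially"
proof -
  let ?F = "partial_expansion r (minus_coeff r f)" and ?d = "minus_coeff r f"
  have exp: "minus_expansion r f ?d" and rap: "rapidly_decaying ?d"
    using f by (auto simp: D_infty_iff minus_expansion_def)
  have FD: "?F N \<in> D_infty r" for N
    unfolding D_infty_iff using minus_expansion_partial_expansion partial_expansion_holomorphic
      minus_expansion_coeff by metis
  have diff: "minus_expansion r (\<lambda>t. ?F N t - f t) (\<lambda>n. if n < N then 0 else - ?d n)" for N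
  proof -
    have "(\<lambda>n. (if n < N then ?d n else 0) - ?d n) = (\<lambda>n. if n < N then 0 else - ?d n)" by auto
    then show ?thesis
      using minus_expansion_diff[OF minus_expansion_partial_expansion[of r ?d N] exp] by simp
  qed
  have lim: "(\<lambda>N. D_seminorm r k (\<lambda>t. ?F N t - f t)) \<longlonglongrightarrow> 0" for k
  proof -
    let ?e = "\<lambda>n. norm (boundary_deriv_coeff k ?d n)"
    have se: "summable ?e" by (rule rapidly_decaying_summable[OF rapidly_decaying_boundary_deriv_coeff[OF rap]])
    have "(\<lambda>N. suminf ?e - (\<Sum>n<N. ?e n)) \<longlonglongrightarrow> suminf ?e - suminf ?e"
      by (intro tendsto_intros summable_LIMSEQ se)
    then have up0: "(\<lambda>N. suminf ?e - (\<Sum>n<N. ?e n)) \<longlonglongrightarrow> 0" by simp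
    have up: "\<forall>\<^sub>F N in sequentially. D_seminorm r k (\<lambda>t. ?F N t - f t) \<le> suminf ?e - (\<Sum>n<N. ?e n)"
    proof (intro always_eventually allI)
      fix N
      let ?g = "\<lambda>n. norm (boundary_deriv_coeff k (\<lambda>n. if n < N then 0 else - ?d n) n)"
      have g: "?g n = ?e n - (if n \<in> {..<N} then ?e n else 0)" for n
        by (simp add: boundary_deriv_coeff_def norm_mult)
      have "(\<lambda>n. ?e n - (if n \<in> {..<N} then ?e n else 0)) sums (suminf ?e - (\<Sum>n<N. ?e n))"
        by (intro sums_diff summable_sums se sums_If_finite_set) simp
      then have "suminf ?g = suminf ?e - (\<Sum>n<N. ?e n)" unfolding g by (rule sums_unique[symmetric])
      then show "D_seminorm r k (\<lambda>t. ?F N t - f t) \<le> suminf ?e - (\<Sum>n<N. ?e n)"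
        using D_seminorm_le[OF diff[of N], of k] by simp
    qed
    have lo: "\<forall>\<^sub>F N in sequentially. 0 \<le> D_seminorm r k (\<lambda>t. ?F N t - f t)"
    proof (intro always_eventually allI)
      fix N
      \<comment> \<open>Read off from the coefficient estimate at n = 0, whose left side is
        nonnegative.\<close>
      show "0 \<le> D_seminorm r k (\<lambda>t. ?F N t - f t)"
        by (rule order_trans[OF _ norm_coeff_le_D_seminorm[OF diff[of N], of 0 k]]) simp
    qed
    show ?thesis by (rule tendsto_sandwich[OF lo up tendsto_const up0])
  qed
  have "eventually (\<lambda>N. ?F N \<in> U) sequentially" if "generate_topology_on
       {{g \<in> D_infty r. D_seminorm r k (\<lambda>t. g t - f t) < \<epsilon>} | f k \<epsilon>. f \<in> D_infty r \<and> 0 < \<epsilon>} U" "f \<in> U" for U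
    using that
  proof induction
    case (Int a b)
    then show ?case by (auto intro: eventually_conj)
  next
    case (UN K)
    then obtain k where k: "k \<in> K" "f \<in> k" by blast
    from UN.IH[OF this] show ?case by eventually_elim (use k in blast)
  next
    case (Basis s)
    then obtain f' k \<epsilon> where s: "s = {g \<in> D_infty r. D_seminorm r k (\<lambda>t. g t - f' t) < \<epsilon>}" "f' \<in> D_infty r" "0 < \<epsilon>"
      by blast
    have exp': "minus_expansion r (\<lambda>t. f t - f' t) (\<lambda>n. ?d n - minus_coeff r f' n)"
      by (rule minus_expansion_diff[OF exp]) (use s in \<open>simp add: D_infty_iff\<close>)
    \<comment> \<open>f lies strictly inside the ball about f', so a positive margin is left for the
      distance from the partial sums to f.\<close>
    have "eventually (\<lambda>N. D_seminorm r k (\<lambda>t. ?F N t - f t) < \<epsilon> - D_seminorm r k (\<lambda>t. f t - f' t)) sequentially"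
      using Basis(2) by (intro order_tendstoD(2)[OF lim]) (simp add: s)
    then show ?case
    proof eventually_elim
      case (elim N)
      then show ?case using FD[of N] D_seminorm_triangle[OF diff[of N] exp', of k] by (simp add: s)
    qed
  qed simp
  then show ?thesis
    unfolding limitin_def topspace_D_infty_topology
    using f by (auto simp: D_infty_topology_def openin_topology_generated_by_iff)
qed

text \<open>The coefficient functional is one continuous extension. Any other agrees with it on the
  partial sums, which lie in \<open>D_omega\<close>, and hence at their limit f; so the description
  in \<open>pairing\<close> denotes its value.\<close>

theorem pairing_sums:
  assumes h: "h holomorphic_on upper_half_plane" and r: "r > 0"
    and c: "polynomially_bounded (plus_coeff r h)" and f: "f \<in> D_infty r"
  shows "(\<lambda>n. pairing_weight r h n * minus_coeff r f n) sums pairing r h f"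
proof -
  let ?L = "\<lambda>f. \<Sum>n. pairing_weight r h n * minus_coeff r f n"
  have cont: "continuous_map (D_infty_topology r) euclidean ?L"
    by (rule continuous_map_coeff_series[OF polynomially_bounded_pairing_weight[OF r c]])
  have agree: "?L g = pairing_omega r h g" if "g \<in> D_omega r" for g
    using pairing_omega_eq[OF h r that] by (simp add: sums_iff)
  have "pairing r h f = ?L f"
    unfolding pairing_def
  proof (rule the_equality)
    show "\<exists>\<Lambda>. continuous_map (D_infty_topology r) euclidean \<Lambda> \<and> (\<forall>g\<in>D_omega r. \<Lambda> g = pairing_omega r h g) \<and> ?L f = \<Lambda> f"
      using cont agree by blast
    fix y assume "\<exists>\<Lambda>. continuous_map (D_infty_topology r) euclidean \<Lambda> \<and> (\<forall>g\<in>D_omega r. \<Lambda> g = pairing_omega r h g) \<and> y = \<Lambda> f"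
    then obtain \<Lambda> where \<Lambda>: "continuous_map (D_infty_topology r) euclidean \<Lambda>"
      "\<And>g. g \<in> D_omega r \<Longrightarrow> \<Lambda> g = pairing_omega r h g" "y = \<Lambda> f" by blast
    let ?F = "partial_expansion r (minus_coeff r f)"
    have "(\<lambda>N. \<Lambda> (?F N)) \<longlonglongrightarrow> \<Lambda> f" "(\<lambda>N. ?L (?F N)) \<longlonglongrightarrow> ?L f"
      using continuous_map_limit[OF \<Lambda>(1) limitin_partial_expansion[OF f]]
        continuous_map_limit[OF cont limitin_partial_expansion[OF f]] by (auto simp: o_def)
    moreover have "\<Lambda> (?F N) = ?L (?F N)" for N
      by (simp add: \<Lambda>(2) agree partial_expansion_in_D_omega)
    ultimately show "y = ?L f" using LIMSEQ_unique \<Lambda>(3) by simp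
  qed
  moreover have "rapidly_decaying (\<lambda>n. pairing_weight r h n * minus_coeff r f n)"
    by (rule rapidly_decaying_mult[OF polynomially_bounded_pairing_weight[OF r c]])
       (use f in \<open>simp add: D_infty_iff minus_expansion_def\<close>)
  ultimately show ?thesis
    using summable_norm_cancel[OF rapidly_decaying_summable] summable_sums by metis
qed


section \<open>Growth of modular forms\<close>

text \<open>Growth concerns absolute values only, so the value of the multiplier enters as an
  unnamed constant, here and for the translation.\<close>

lemma automorphic_inversion:
  assumes "f \<in> automorphic_forms r v"
  obtains c where "\<And>z. Im z > 0 \<Longrightarrow> f (- 1 / z) = c * z powr complex_of_real r * f z"
proof -
  define \<gamma> :: "int ^ 2 ^ 2" where "\<gamma> = vector [vector [0, - 1], vector [1, 0]]"
  have "\<gamma> \<in> SL2Z" by (simp add: SL2Z_def \<gamma>_def det_2 vector_2)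
  moreover have "mobius_act \<gamma> z = - 1 / z" "cocycle_factor \<gamma> z = z" for z
    by (simp_all add: mobius_act_def cocycle_factor_def \<gamma>_def vector_2)
  ultimately have "f (- 1 / z) = v \<gamma> * z powr complex_of_real r * f z" if "Im z > 0" for z
    using assms that unfolding automorphic_forms_def upper_half_plane_def by fastforce
  then show ?thesis by (rule that)
qed

lemma automorphic_translation:
  assumes "f \<in> automorphic_forms r v"
  obtains c where "\<And>z. Im z > 0 \<Longrightarrow> f (z + 1) = c * f z"
proof -
  define \<gamma> :: "int ^ 2 ^ 2" where "\<gamma> = vector [vector [1, 1], vector [0, 1]]"
  have "\<gamma> \<in> SL2Z" by (simp add: SL2Z_def \<gamma>_def det_2 vector_2)
  moreover have "mobius_act \<gamma> z = z + 1" "cocycle_factor \<gamma> z = 1" for z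
    by (simp_all add: mobius_act_def cocycle_factor_def \<gamma>_def vector_2)
  ultimately have "f (z + 1) = v \<gamma> * f z" if "Im z > 0" for z
    using assms that unfolding automorphic_forms_def upper_half_plane_def by fastforce
  then show ?thesis by (rule that)
qed

lemma norm_powr_of_real: "norm (z powr complex_of_real r) = norm z powr r"
  by (simp add: norm_powr_real_powr')

lemma Im_minus_inverse: "Im (- 1 / z) = Im z / (norm z)\<^sup>2"
  by (simp add: Im_divide cmod_power2)

text \<open>The relations of the generators of the modular group force the constants in
  the two transformation laws to have absolute value 1.\<close>

lemma norm_automorphic:
  assumes f: "f \<in> automorphic_forms r v" and z: "Im z > 0"
  shows norm_automorphic_inversion: "norm (f (- 1 / z)) = norm z powr r * norm (f z)"
    and norm_automorphic_translation: "norm (f (z + 1)) = norm (f z)"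
proof -
  obtain c where c: "\<And>z. Im z > 0 \<Longrightarrow> f (- 1 / z) = c * z powr complex_of_real r * f z"
    by (rule automorphic_inversion[OF f]) blast
  obtain d where d: "\<And>z. Im z > 0 \<Longrightarrow> f (z + 1) = d * f z"
    by (rule automorphic_translation[OF f]) blast
  define g where "g z = norm (f z)" for z
  have S: "g (- 1 / z) = norm c * norm z powr r * g z" if "Im z > 0" for z
    unfolding g_def c[OF that] by (simp add: norm_mult norm_powr_of_real)
  have T: "g (z + 1) = norm d * g z" if "Im z > 0" for z
    by (simp add: g_def d[OF that] norm_mult)
  have inv: "Im (- 1 / z) > 0" if "Im z > 0" for z
  proof -
    have "z \<noteq> 0" using that by auto
    then show ?thesis using that unfolding Im_minus_inverse by simp
  qed
  have "g (- 1 / z) = norm z powr r * g z \<and> g (z + 1) = g z"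
  proof (cases "\<exists>z0. Im z0 > 0 \<and> g z0 \<noteq> 0")
    case False
    moreover have "Im (z + 1) > 0" using z by simp
    ultimately show ?thesis using inv[OF z] z by auto
  next
    case True
    then obtain a where a: "Im a > 0" "g a \<noteq> 0" by blast
    have nz: "a \<noteq> 0" "a + 1 \<noteq> 0" using a by (auto simp: complex_eq_iff)
    have np: "norm a > 0" "norm (a + 1) > 0" using nz by auto
    \<comment> \<open>The inversion is an involution, which gives |c|^2 = 1.\<close>
    have "g a = g (- 1 / (- 1 / a))" by simp
    also have "\<dots> = norm c * norm (- 1 / a) powr r * (norm c * norm a powr r * g a)"
      by (simp only: S[OF inv[OF a(1)]] S[OF a(1)])
    also have "\<dots> = (norm c)\<^sup>2 * ((norm (- 1 / a) * norm a) powr r) * g a"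
      by (simp add: powr_mult power2_eq_square)
    also have "\<dots> = (norm c)\<^sup>2 * g a" using nz by (simp add: norm_divide)
    finally have "norm c = 1" using a by (simp add: power2_eq_1_iff) (smt (verit) norm_ge_zero)
    \<comment> \<open>The relation (S T)^3 = 1 on points, as a chain from a: a + 1, then b, b + 1,
      then - 1/(b + 1) + 1 = - 1/a, then a again. It uses three translations, and the moduli in its
      three inversions multiply to 1, so |d|^3 = 1.\<close>
    define b where "b = - 1 / (a + 1)"
    have b: "Im b > 0" unfolding b_def by (rule inv) (use a in simp)
    have b1: "Im (b + 1) > 0" using b by simp
    have e1: "- 1 / (b + 1) + 1 = - 1 / a" and e2: "b + 1 = a / (a + 1)"
      using nz by (simp_all add: b_def field_simps)
    have "g a = g (- 1 / (- 1 / a))" by simp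
    also have "\<dots> = norm (- 1 / a) powr r * g (- 1 / (b + 1) + 1)"
      by (simp only: S[OF inv[OF a(1)]] e1 \<open>norm c = 1\<close> mult_1)
    also have "g (- 1 / (b + 1) + 1) = norm d * (norm (b + 1) powr r * (norm d * g b))"
      by (simp only: T[OF inv[OF b1]] S[OF b1] T[OF b] \<open>norm c = 1\<close> mult_1)
    also have "g b = norm (a + 1) powr r * (norm d * g a)"
      unfolding b_def using a by (subst S) (auto simp: T \<open>norm c = 1\<close>)
    also have "norm (- 1 / a) powr r * (norm d * (norm (b + 1) powr r * (norm d * (norm (a + 1) powr r * (norm d * g a))))) =
        norm d ^ 3 * ((norm (- 1 / a) * norm (b + 1) * norm (a + 1)) powr r) * g a"
      by (simp add: powr_mult power3_eq_cube)
    also have "norm (- 1 / a) * norm (b + 1) * norm (a + 1) = 1"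
      unfolding e2 using np by (simp add: norm_divide)
    finally have "norm d ^ 3 = 1" using a by simp
    then have "norm d = 1" by (metis norm_ge_zero power_eq_1_iff zero_neq_numeral abs_of_nonneg real_norm_def)
    with \<open>norm c = 1\<close> show ?thesis using S[OF z] T[OF z] by simp
  qed
  then show "norm (f (- 1 / z)) = norm z powr r * norm (f z)" "norm (f (z + 1)) = norm (f z)"
    by (simp_all add: g_def)
qed

lemma norm_automorphic_translation_nat:
  assumes "f \<in> automorphic_forms r v" "Im z > 0"
  shows "norm (f (z + of_nat n)) = norm (f z)"
proof (induction n)
  case (Suc n)
  have "norm (f ((z + of_nat n) + 1)) = norm (f (z + of_nat n))"
    by (rule norm_automorphic_translation[OF assms(1)]) (use assms in simp)
  with Suc show ?case by (simp add: add_ac)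
qed simp

lemma norm_automorphic_translation_int:
  assumes "f \<in> automorphic_forms r v" "Im z > 0"
  shows "norm (f (z + of_int n)) = norm (f z)"
proof (cases "n \<ge> 0")
  case True
  then show ?thesis using norm_automorphic_translation_nat[OF assms, of "nat n"] by simp
next
  case False
  then show ?thesis
    using norm_automorphic_translation_nat[OF assms(1), of "z + of_int n" "nat (- n)"] assms(2) by simp
qed

lemma reduce_real_part:
  assumes f: "f \<in> automorphic_forms r v" "Im z > 0"
  obtains w where "\<bar>Re w\<bar> \<le> 1 / 2" "Im w = Im z" "norm (f w) = norm (f z)"
proof
  let ?w = "z + of_int (- round (Re z))"
  show "\<bar>Re ?w\<bar> \<le> 1 / 2" using of_int_round_abs_le[of "Re z"] by (simp add: abs_minus_commute)
  show "Im ?w = Im z" by simp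
  show "norm (f ?w) = norm (f z)" by (rule norm_automorphic_translation_int[OF f])
qed

text \<open>Above some height Y the growth condition applies. Translations preserve |f|, so the
  strip below Y reduces to a compact box of width 1.\<close>

lemma modular_form_bounded:
  assumes f: "f \<in> modular_forms r v" and y: "y > 0"
  shows "\<exists>C. \<forall>z. Im z \<ge> y \<longrightarrow> norm (f z) \<le> C"
proof -
  have fa: "f \<in> automorphic_forms r v" and O: "f \<in> O[filtercomap Im at_top](\<lambda>_. 1)"
    using f by (auto simp: modular_forms_def)
  obtain c where "\<forall>\<^sub>F z in filtercomap Im at_top. norm (f z) \<le> c * norm (1::complex)"
    using landau_o.bigE[OF O] by blast
  then obtain Y where Y: "\<And>z. Im z \<ge> Y \<Longrightarrow> norm (f z) \<le> c"
    by (auto simp: eventually_filtercomap_at_top_linorder)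
  let ?K = "cbox (Complex (- 1 / 2) y) (Complex (1 / 2) Y)"
  have "continuous_on ?K f"
    by (rule continuous_on_subset[OF holomorphic_on_imp_continuous_on])
       (use fa y in \<open>auto simp: automorphic_forms_def upper_half_plane_def in_cbox_complex_iff\<close>)
  then obtain B where B: "\<And>z. z \<in> ?K \<Longrightarrow> norm (f z) \<le> B"
    using compact_norm_bound[OF compact_cbox] by blast
  have "norm (f z) \<le> max B c" if z: "Im z \<ge> y" for z
  proof -
    obtain w where w: "\<bar>Re w\<bar> \<le> 1 / 2" "Im w = Im z" "norm (f w) = norm (f z)"
      using reduce_real_part[OF fa] z y by (metis less_le_trans)
    show ?thesis
    proof (cases "Im z \<ge> Y")
      case False
      then have "w \<in> ?K" using w z by (auto simp: in_cbox_complex_iff)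
      then show ?thesis using B w(3) by (metis max.coboundedI1)
    qed (use Y in \<open>auto intro: max.coboundedI2\<close>)
  qed
  then show ?thesis by blast
qed

text \<open>A point below height 1/2 is moved by a translation and the inversion to a point at least
  twice as high; the stated bound is invariant under this step.\<close>

lemma modular_form_growth:
  assumes f: "f \<in> modular_forms r v" and r: "r > 0"
  obtains C where "C \<ge> 0" "\<And>z. Im z > 0 \<Longrightarrow> norm (f z) \<le> C * max 1 (Im z powr (- r))"
proof -
  have fa: "f \<in> automorphic_forms r v" using f by (simp add: modular_forms_def)
  obtain C where C: "\<And>z. Im z \<ge> 1 / 2 \<Longrightarrow> norm (f z) \<le> C"
    using modular_form_bounded[OF f, of "1/2"] by auto
  have C0: "C \<ge> 0" using C[of \<i>] norm_ge_zero[of "f \<i>"] by (simp del: norm_ge_zero)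
  \<comment> \<open>The half-planes Im z \<ge> 2^(-k-1) exhaust the upper half-plane; each step of
    the induction halves the height.\<close>
  have step: "norm (f z) \<le> C * max 1 (Im z powr (- r))" if "Im z \<ge> (1 / 2) ^ (k + 1)" for k z
    using that
  proof (induction k arbitrary: z)
    case 0
    have "norm (f z) \<le> C * 1" using C[of z] 0 by simp
    also have "\<dots> \<le> C * max 1 (Im z powr (- r))" by (intro mult_left_mono C0) simp
    finally show ?case .
  next
    case (Suc k)
    show ?case
    proof (cases "Im z \<ge> 1 / 2")
      case True
      have "norm (f z) \<le> C * 1" using C[OF True] by simp
      also have "\<dots> \<le> C * max 1 (Im z powr (- r))" by (intro mult_left_mono C0) simp
      finally show ?thesis .
    next
      case False
      have y: "Im z > 0" by (rule less_le_trans[OF _ Suc.prems]) simp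
      obtain w where w: "\<bar>Re w\<bar> \<le> 1 / 2" "Im w = Im z" "norm (f w) = norm (f z)"
        using reduce_real_part[OF fa y] by blast
      have wpos: "Im w > 0" using w y by simp
      then have nw: "norm w > 0" by auto
      \<comment> \<open>For |Re w| \<le> 1/2 below height 1/2 one has |w|^2 < 1/2, so inversion at
        least doubles the imaginary part.\<close>
      have "(Re w)\<^sup>2 \<le> (1 / 2)\<^sup>2" "(Im w)\<^sup>2 < (1 / 2)\<^sup>2"
        using power_mono[OF w(1), of 2] power_strict_mono[of "Im w" "1/2" 2] wpos False w(2) by auto
      then have n2: "(norm w)\<^sup>2 < 1 / 2" unfolding cmod_power2 by (simp add: power2_eq_square)
      then have n1: "norm w < 1" using power2_less_imp_less[of "norm w" 1] by simp
      have Imle: "Im w \<le> norm w" using abs_Im_le_cmod[of w] by simp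
      define u where "u = - 1 / w"
      have Imu: "Im u = Im w / (norm w)\<^sup>2" unfolding u_def by (rule Im_minus_inverse)
      have "Im w * (norm w)\<^sup>2 \<le> Im w * (1 / 2)" using n2 wpos by (intro mult_left_mono) auto
      then have "Im u \<ge> 2 * Im w" unfolding Imu using nw by (simp add: field_simps)
      then have "Im u \<ge> (1 / 2) ^ (k + 1)" using Suc.prems w(2) by simp
      from Suc.IH[OF this] have IH: "norm (f u) \<le> C * max 1 (Im u powr (- r))" .
      have "norm (f u) = norm w powr r * norm (f w)"
        unfolding u_def by (rule norm_automorphic_inversion[OF fa wpos])
      then have "norm (f w) = norm w powr (- r) * norm (f u)"
        using nw by (simp add: powr_minus)
      also have "\<dots> \<le> norm w powr (- r) * (C * max 1 (Im u powr (- r)))"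
        by (intro mult_left_mono IH) simp
      also have "\<dots> = C * max (norm w powr (- r)) ((norm w * Im u) powr (- r))"
      proof -
        have "norm w powr (- r) * max 1 (Im u powr (- r)) = max (norm w powr (- r)) ((norm w * Im u) powr (- r))"
        proof -
          have "(norm w * Im u) powr (- r) = norm w powr (- r) * Im u powr (- r)"
            by (rule powr_mult)
          then show ?thesis by (simp add: max_mult_distrib_left)
        qed
        then show ?thesis by (simp only: mult.left_commute[of _ C])
      qed
      \<comment> \<open>Both entries of the maximum are at most (Im w)^(-r): the first since Im w
        \<le> |w|, the second since |w| Im u = Im w/|w| and |w| < 1.\<close>
      also have "\<dots> \<le> C * max 1 (Im z powr (- r))"
      proof (intro mult_left_mono C0)
        have "norm w powr (- r) \<le> Im w powr (- r)"
          using r wpos Imle by (intro powr_mono2') auto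
        moreover have "norm w * Im u = Im w / norm w" using nw by (simp add: Imu power2_eq_square)
        moreover have "(Im w / norm w) powr (- r) \<le> Im w powr (- r)"
          using r wpos nw n1 by (intro powr_mono2') (auto simp: field_simps)
        ultimately show "max (norm w powr (- r)) ((norm w * Im u) powr (- r)) \<le> max 1 (Im z powr (- r))"
          using w(2) by (simp add: le_max_iff_disj)
      qed
      finally show ?thesis using w(3) by simp
    qed
  qed
  show ?thesis
  proof (rule that[OF C0])
    fix z :: complex assume "Im z > 0"
    then obtain k where "(1 / 2) ^ k < Im z" using real_arch_pow_inv[of "Im z" "1/2"] by auto
    then have "Im z \<ge> (1 / 2) ^ (k + 1)" by (auto simp: field_simps)
    then show "norm (f z) \<le> C * max 1 (Im z powr (- r))" by (rule step)
  qed
qed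

text \<open>Cauchy's estimate on the circle of radius \<rho> = 1 - 1/(n + 2): there 1/(1 - \<rho>)
  is n + 2, while \<rho>^(-n) stays below e.\<close>

lemma polynomially_bounded_disc_coeff:
  assumes F: "F holomorphic_on ball 0 1" and C: "C \<ge> 0"
    and bnd: "\<And>w. norm w < 1 \<Longrightarrow> norm (F w) \<le> C * (4 / (1 - norm w)) ^ m"
  shows "polynomially_bounded (disc_coeff F)"
  unfolding polynomially_bounded_def
proof (intro exI allI)
  fix n
  \<comment> \<open>With n + 2 in place of n + 1 the radius is positive also for n = 0.\<close>
  define \<rho> where "\<rho> = 1 - 1 / real (n + 2)"
  have \<rho>: "0 < \<rho>" "\<rho> < 1" "\<rho> = real (n + 1) / real (n + 2)" by (auto simp: \<rho>_def field_simps)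
  have "norm (disc_coeff F n) \<le> C * (4 / (1 - \<rho>)) ^ m / \<rho> ^ n"
    using bnd \<rho>(1,2) by (intro norm_disc_coeff_le[OF F]) auto
  also have "\<dots> = C * (4 * real (n + 2)) ^ m * (1 / \<rho>) ^ n" by (simp add: \<rho>_def power_one_over)
  also have "\<dots> \<le> C * (8 * real (n + 1)) ^ m * exp 1"
  proof (rule mult_mono)
    show "C * (4 * real (n + 2)) ^ m \<le> C * (8 * real (n + 1)) ^ m"
      by (rule mult_left_mono[OF power_mono C]) auto
    have "1 / \<rho> = 1 + 1 / real (n + 1)" unfolding \<rho>(3) by (simp add: field_simps)
    also have "\<dots> \<le> exp (1 / real (n + 1))" by (rule exp_ge_add_one_self)
    finally have "(1 / \<rho>) ^ n \<le> exp (1 / real (n + 1)) ^ n" using \<rho> by (intro power_mono) auto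
    also have "\<dots> = exp (real n / real (n + 1))" by (simp add: exp_of_nat_mult[symmetric])
    also have "\<dots> \<le> exp 1" by simp
    finally show "(1 / \<rho>) ^ n \<le> exp 1" .
  qed (use C \<rho> in auto)
  also have "\<dots> = (C * 8 ^ m * exp 1) * real (n + 1) ^ m" by (simp only: power_mult_distrib mult_ac)
  finally show "norm (disc_coeff F n) \<le> (C * 8 ^ m * exp 1) * real (n + 1) ^ m" .
qed

text \<open>The twist, with |z + i| = 2/|1 - w|, and the growth of f, with 1/Im z, are both bounded
  by A^r for A = 4/(1 - |w|). The 4 comes from |1 - w|^2 \<le> 4 in the formula for Im z.\<close>

lemma polynomially_bounded_plus_coeff:
  assumes f: "f \<in> modular_forms r v" and r: "r > 0"
  shows "polynomially_bounded (plus_coeff r f)"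
proof -
  obtain C where C: "C \<ge> 0" "\<And>z. Im z > 0 \<Longrightarrow> norm (f z) \<le> C * max 1 (Im z powr (- r))"
    using modular_form_growth[OF f r] by blast
  \<comment> \<open>A^r occurs twice, and the exponent 2 r is rounded up to a natural
    number.\<close>
  define m where "m = nat \<lceil>2 * r\<rceil>"
  have m: "2 * r \<le> real m" unfolding m_def by linarith
  have hol: "f holomorphic_on upper_half_plane"
    using f by (simp add: modular_forms_def automorphic_forms_def)
  show ?thesis
    unfolding plus_coeff_def
  proof (rule polynomially_bounded_disc_coeff[OF plus_twist_holomorphic[OF hol] C(1), where m = m])
    fix w :: complex assume w: "norm w < 1"
    define z where "z = w_coord_inv w"
    define A where "A = 4 / (1 - norm w)"
    have w1: "w \<noteq> 1" using w by auto
    have A: "A \<ge> 1" using w by (simp add: A_def field_simps)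
    have d: "1 - norm w \<le> norm (1 - w)" "norm (1 - w) \<le> 2" "norm (1 - w) > 0"
      using norm_triangle_ineq2[of 1 w] norm_triangle_ineq4[of 1 w] w w1 by auto
    have y: "Im z > 0" unfolding z_def by (rule Im_w_coord_inv_pos[OF w])
    have "norm (- \<i> - z) = norm (z + \<i>)" by (metis minus_add_distrib norm_minus_cancel uminus_add_conv_diff add.commute)
    also have "\<dots> = 2 / norm (1 - w)" unfolding z_def w_coord_inv_add_i[OF w1] by (simp add: norm_divide norm_mult)
    also have "\<dots> \<le> A" unfolding A_def using d w by (intro frac_le) auto
    finally have 1: "norm (- \<i> - z) powr r \<le> A powr r" using r by (intro powr_mono2) auto
    have "(norm (1 - w))\<^sup>2 \<le> 2\<^sup>2" using d by (intro power_mono) auto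
    moreover have "1 - norm w \<le> 1 - (norm w)\<^sup>2" using w by (simp add: power2_eq_square mult_left_le)
    ultimately have "(1 - norm w) / 4 \<le> (1 - (norm w)\<^sup>2) / (norm (1 - w))\<^sup>2"
      using w d by (intro frac_le) auto
    then have "1 / A \<le> Im z" unfolding z_def Im_w_coord_inv[OF w] by (simp add: A_def)
    then have "Im z powr (- r) \<le> (1 / A) powr (- r)" using r A by (intro powr_mono2') auto
    also have "\<dots> = A powr r" using A by (simp add: powr_minus_divide powr_divide)
    finally have 2: "max 1 (Im z powr (- r)) \<le> A powr r" using A r by (simp add: ge_one_powr_ge_zero)
    have "norm (plus_twist r f z) = norm (- \<i> - z) powr r * norm (f z)"
      by (simp add: plus_twist_def norm_mult norm_powr_of_real)
    also have "\<dots> \<le> A powr r * (C * max 1 (Im z powr (- r)))"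
      by (intro mult_mono 1 C(2) y) auto
    also have "\<dots> \<le> A powr r * (C * A powr r)" by (intro mult_left_mono 2 C) auto
    also have "\<dots> = C * A powr (2 * r)" by (simp add: powr_add[symmetric])
    also have "\<dots> \<le> C * A powr (real m)" using A m C by (intro mult_left_mono powr_mono) auto
    also have "\<dots> = C * A ^ m" using A by (simp add: powr_realpow)
    finally show "norm (plus_twist r f (w_coord_inv w)) \<le> C * (4 / (1 - norm w)) ^ m"
      by (simp add: z_def A_def)
  qed
qed


section \<open>Expansion of the kernel\<close>

text \<open>The Taylor coefficients of (1 - x)^(-a). The Pochhammer form is the one that matches the
  weight of the pairing.\<close>

definition binomial_coeff :: "real \<Rightarrow> nat \<Rightarrow> complex" where
  "binomial_coeff a n = pochhammer (complex_of_real a) n / fact n"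

lemma binomial_coeff_sums:
  assumes "norm x < 1"
  shows "(\<lambda>n. binomial_coeff a n * x ^ n) sums (1 - x) powr (- complex_of_real a)"
proof -
  have "(\<lambda>n. (- complex_of_real a gchoose n) * (- x) ^ n) sums (1 + - x) powr (- complex_of_real a)"
    by (rule gen_binomial_complex) (use assms in simp)
  moreover have "(- complex_of_real a gchoose n) * (- x) ^ n = binomial_coeff a n * x ^ n" for n
    by (simp add: gbinomial_pochhammer binomial_coeff_def power_mult_distrib[symmetric])
  ultimately show ?thesis by simp
qed

text \<open>Read off from the growth of (1 - x)^(-a) at the unit circle by Cauchy's estimate,
  without asymptotics of the Gamma function.\<close>

lemma polynomially_bounded_binomial_coeff:
  assumes "a > 0"
  shows "polynomially_bounded (binomial_coeff a)"
proof -
  let ?F = "\<lambda>x. (1 - x) powr (- complex_of_real a)"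
  have "polynomially_bounded (disc_coeff ?F)"
  proof (rule polynomially_bounded_disc_coeff[where C = 1 and m = "nat \<lceil>a\<rceil>"])
    have "1 - x \<notin> \<real>\<^sub>\<le>\<^sub>0" if "norm x < 1" for x :: complex
      using that complex_Re_le_cmod[of x] by (auto simp: complex_nonpos_Reals_iff)
    then show "?F holomorphic_on ball 0 1" by (intro holomorphic_intros) auto
    fix x :: complex assume x: "norm x < 1"
    have d: "1 - norm x \<le> norm (1 - x)" using norm_triangle_ineq2[of 1 x] by simp
    have "norm (?F x) = norm (1 - x) powr (- a)"
      using norm_powr_of_real[of "1 - x" "- a"] by simp
    also have "\<dots> \<le> (1 - norm x) powr (- a)" using d x assms by (intro powr_mono2') auto
    also have "\<dots> = (1 / (1 - norm x)) powr a" using x by (simp add: powr_minus_divide powr_divide)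
    also have "\<dots> \<le> (4 / (1 - norm x)) powr a" using x assms by (intro powr_mono2 divide_right_mono) auto
    also have "\<dots> \<le> (4 / (1 - norm x)) powr real (nat \<lceil>a\<rceil>)"
    proof (rule powr_mono)
      show "a \<le> real (nat \<lceil>a\<rceil>)" by linarith
      show "1 \<le> 4 / (1 - norm x)" using x by (simp add: field_simps)
    qed
    also have "\<dots> = 1 * (4 / (1 - norm x)) ^ nat \<lceil>a\<rceil>" using x by (subst powr_realpow) auto
    finally show "norm (?F x) \<le> 1 * (4 / (1 - norm x)) ^ nat \<lceil>a\<rceil>" .
  qed simp
  moreover have "disc_coeff ?F = binomial_coeff a"
    by (rule ext, rule disc_coeff_unique[of 1]) (auto intro: binomial_coeff_sums)
  ultimately show ?thesis by simp
qed

text \<open>The bound on the arguments excludes a jump of the principal branch.\<close>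

lemma powr_quotient:
  assumes "x \<noteq> 0" "y \<noteq> 0" "\<bar>Im (Ln x) - Im (Ln y)\<bar> < pi"
  shows "x powr a * y powr (- a) = (x / y) powr a"
proof -
  have "Ln (x / y) = Ln x - Ln y"
    by (rule Ln_unique) (use assms in \<open>auto simp: exp_diff\<close>)
  then show ?thesis using assms by (simp add: powr_def exp_add[symmetric] right_diff_distrib)
qed

lemma powr_quotient_upper:
  assumes "Im x > 0" "Im y > 0"
  shows "x powr a * y powr (- a) = (x / y) powr a"
proof (rule powr_quotient)
  show "x \<noteq> 0" "y \<noteq> 0" using assms by auto
  then show "\<bar>Im (Ln x) - Im (Ln y)\<bar> < pi"
    using Im_Ln_pos_lt[of x] Im_Ln_pos_lt[of y] assms by auto
qed

lemma powr_quotient_right: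
  assumes "Re x > 0" "Re y > 0"
  shows "x powr a * y powr (- a) = (x / y) powr a"
proof (rule powr_quotient)
  show "x \<noteq> 0" "y \<noteq> 0" using assms by auto
  show "\<bar>Im (Ln x) - Im (Ln y)\<bar> < pi"
    using Re_Ln_pos_lt_imp[OF assms(1)] Re_Ln_pos_lt_imp[OF assms(2)] by linarith
qed

text \<open>The coefficients in \<zeta> of ((i - t)/(\<tau> - t))^a. They come from (i - t)/(\<tau>
  - t) = (2 i/(\<tau> + i))/(1 - w \<zeta>) with w the coordinate of \<tau>.\<close>

definition kernel_coeff :: "real \<Rightarrow> complex \<Rightarrow> nat \<Rightarrow> complex" where
  "kernel_coeff a \<tau> n = (2 * \<i> / (\<tau> + \<i>)) powr complex_of_real a * (binomial_coeff a n * w_coord \<tau> ^ n)"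

lemma norm_w_coord:
  assumes "Im z > 0"
  shows "norm (w_coord z) < 1"
proof -
  have "z + \<i> \<noteq> 0" using assms by (auto simp: complex_eq_iff)
  moreover have "norm (z - \<i>) < norm (z + \<i>)"
    using assms by (simp add: cmod_def power2_eq_square algebra_simps)
  ultimately show ?thesis by (simp add: w_coord_def norm_divide)
qed

text \<open>The quotient of i - t and \<tau> - t, two points of the upper half-plane, equals the
  quotient of 2 i/(\<tau> + i) and 1 - w \<zeta>, two points of the right half-plane. Principal
  powers respect both quotients, so the branches on the two sides agree.\<close>

lemma kernel_sums:
  assumes \<tau>: "Im \<tau> > 0" and \<zeta>: "norm \<zeta> < 1"
  defines "t \<equiv> \<i> * (\<zeta> + 1) / (\<zeta> - 1)"
  shows "(\<lambda>n. kernel_coeff a \<tau> n * \<zeta> ^ n) sums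
    ((\<i> - t) powr complex_of_real a * (\<tau> - t) powr (- complex_of_real a))"
proof -
  let ?w = "w_coord \<tau>"
  have w: "norm (?w * \<zeta>) < 1"
    using norm_w_coord[OF \<tau>] \<zeta> mult_strict_mono'[of "norm ?w" 1 "norm \<zeta>" 1] by (simp add: norm_mult)
  have t: "Im t < 0" unfolding t_def by (rule Im_lower_half_plane_param[OF \<zeta>])
  have ne: "\<zeta> - 1 \<noteq> 0" "1 - \<zeta> \<noteq> 0" using \<zeta> by auto
  have nz: "\<tau> + \<i> \<noteq> 0" using \<tau> by (auto simp: complex_eq_iff)
  have 1: "\<i> - t = 2 * \<i> / (1 - \<zeta>)" unfolding t_def using ne by (simp add: divide_simps) (simp add: algebra_simps)
  have 2: "\<tau> - t = (\<tau> + \<i>) * (1 - ?w * \<zeta>) / (1 - \<zeta>)"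
    unfolding t_def w_coord_def using ne nz by (simp add: divide_simps) (simp add: algebra_simps)
  have q: "(\<i> - t) / (\<tau> - t) = (2 * \<i> / (\<tau> + \<i>)) / (1 - ?w * \<zeta>)"
    unfolding 1 2 using ne by simp
  have "Re (2 * \<i> / (\<tau> + \<i>)) > 0"
    using \<tau> nz by (auto simp: Re_divide complex_eq_iff intro!: divide_pos_pos sum_power2_gt_zero_iff[THEN iffD2])
  moreover have "Re (1 - ?w * \<zeta>) > 0" using w complex_Re_le_cmod[of "?w * \<zeta>"] by simp
  ultimately have "(\<i> - t) powr complex_of_real a * (\<tau> - t) powr (- complex_of_real a) =
      (2 * \<i> / (\<tau> + \<i>)) powr complex_of_real a * (1 - ?w * \<zeta>) powr (- complex_of_real a)"
    using powr_quotient_upper[of "\<i> - t" "\<tau> - t" "complex_of_real a"] t \<tau> q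
      powr_quotient_right[of "2 * \<i> / (\<tau> + \<i>)" "1 - ?w * \<zeta>" "complex_of_real a"] by simp
  moreover have "(\<lambda>n. kernel_coeff a \<tau> n * \<zeta> ^ n) sums
      ((2 * \<i> / (\<tau> + \<i>)) powr complex_of_real a * (1 - ?w * \<zeta>) powr (- complex_of_real a))"
    using sums_mult[OF binomial_coeff_sums[OF w, of a], of "(2 * \<i> / (\<tau> + \<i>)) powr complex_of_real a"]
    by (simp add: kernel_coeff_def power_mult_distrib mult_ac)
  ultimately show ?thesis by simp
qed

section \<open>Exchange of sum and integral\<close>

text \<open>The majorant is a product B n * g x, so the series of norms converges at each point and
  the integrals of the norms are summable as well. The proof goes through the Lebesgue integral; the
  conclusion is on the gauge integral, in which contour integrals are expressed.\<close>

lemma integral_sums_swap: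
  fixes f :: "nat \<Rightarrow> real \<Rightarrow> complex"
  assumes S: "S \<in> sets lebesgue" and meas: "\<And>n. f n \<in> borel_measurable (lebesgue_on S)"
    and bnd: "\<And>n x. x \<in> S \<Longrightarrow> norm (f n x) \<le> B n * g x"
    and g: "integrable (lebesgue_on S) g" and B: "summable B"
    and F: "\<And>x. x \<in> S \<Longrightarrow> (\<lambda>n. f n x) sums F x"
  shows "(\<lambda>n. integral S (f n)) sums integral S F" "integrable (lebesgue_on S) F"
proof -
  have sp: "space (lebesgue_on S) = S" by simp
  have int: "integrable (lebesgue_on S) (f n)" for n
    by (rule Bochner_Integration.integrable_bound[OF integrable_mult_right[OF g, of "B n"] meas])
       (use bnd in \<open>auto simp: sp intro!: AE_I2 order_trans[OF bnd abs_ge_self]\<close>)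
  have AEs: "AE x in lebesgue_on S. summable (\<lambda>n. norm (f n x))"
    by (rule AE_I2, rule summable_comparison_test'[OF summable_mult2[OF B]]) (use bnd in \<open>auto simp: sp\<close>)
  have ns: "summable (\<lambda>n. \<integral>x. norm (f n x) \<partial>(lebesgue_on S))"
  proof (rule summable_comparison_test'[OF summable_mult2[OF B, of "\<integral>x. g x \<partial>(lebesgue_on S)"]])
    fix n
    have "(\<integral>x. norm (f n x) \<partial>(lebesgue_on S)) \<le> (\<integral>x. B n * g x \<partial>(lebesgue_on S))"
      by (intro integral_mono integrable_norm int integrable_mult_right g) (use bnd in \<open>auto simp: sp\<close>)
    also have "\<dots> = B n * (\<integral>x. g x \<partial>(lebesgue_on S))" by simp
    finally show "norm (\<integral>x. norm (f n x) \<partial>(lebesgue_on S)) \<le> B n * (\<integral>x. g x \<partial>(lebesgue_on S))"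
      by simp
  qed
  have Feq: "(\<Sum>n. f n x) = F x" if "x \<in> space (lebesgue_on S)" for x
    using F[of x] that by (simp add: sums_iff)
  have intF: "integrable (lebesgue_on S) F"
    using integrable_suminf[OF int AEs ns] by (subst Bochner_Integration.integrable_cong[OF refl Feq[symmetric]])
  then show "integrable (lebesgue_on S) F" .
  have "(\<lambda>n. integral\<^sup>L (lebesgue_on S) (f n)) sums (\<integral>x. (\<Sum>n. f n x) \<partial>(lebesgue_on S))"
    by (rule sums_integral[OF int AEs ns])
  also have "(\<integral>x. (\<Sum>n. f n x) \<partial>(lebesgue_on S)) = integral\<^sup>L (lebesgue_on S) F"
    by (rule Bochner_Integration.integral_cong[OF refl Feq])
  finally show "(\<lambda>n. integral S (f n)) sums integral S F"
    by (simp add: lebesgue_integral_eq_integral[OF int S] lebesgue_integral_eq_integral[OF intF S])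
qed

lemma borel_measurable_powr_lebesgue_on:
  "(\<lambda>u. complex_of_real (u powr c * (1 - u) powr d)) \<in> borel_measurable (lebesgue_on S)"
  by (intro measurable_restrict_space1 measurable_completion) measurable

lemma integrable_Beta_density:
  assumes "a > 0" "b > 0"
  shows "integrable (lebesgue_on {0..1}) (\<lambda>u::real. u powr (b - 1) * (1 - u) powr (a - 1))"
  by (rule absolutely_integrable_imp_integrable[OF nonnegative_absolutely_integrable_1])
     (use has_integral_Beta_real[OF assms(2,1)] in \<open>auto simp: integrable_on_def\<close>)

section \<open>A complex beta integral\<close>

text \<open>The recursion B(a + 1, b) (a + b) = a B(a, b), iterated in each argument and kept free
  of division.\<close>

lemma Beta_add_nat:
  assumes "a > 0" "b > (0::real)"
  shows "Beta (a + real j) (b + real k) * pochhammer (a + b) (j + k) = Beta a b * pochhammer a j * pochhammer b k"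
proof -
  have np: "x \<notin> \<int>\<^sub>\<le>\<^sub>0" if "x > 0" for x :: real using that by (auto elim!: nonpos_Ints_cases)
  have 1: "Beta (a + real j) b * pochhammer (a + b) j = Beta a b * pochhammer a j" for j
  proof (induction j)
    case (Suc j)
    have "Beta (a + real (Suc j)) b * (a + b + real j) = (a + real j) * Beta (a + real j) b"
      using Beta_plus1_left[OF np, of "a + real j" b] assms by (simp add: algebra_simps)
    then have "Beta (a + real (Suc j)) b * pochhammer (a + b) (Suc j) = (a + real j) * (Beta (a + real j) b * pochhammer (a + b) j)"
      unfolding pochhammer_Suc by (metis mult.assoc mult.commute)
    then show ?case unfolding Suc.IH by (simp add: pochhammer_Suc mult_ac)
  qed simp
  show ?thesis
  proof (induction k)
    case 0
    then show ?case using 1 by simp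
  next
    case (Suc k)
    have "Beta (a + real j) (b + real (Suc k)) * (a + b + real (j + k)) = (b + real k) * Beta (a + real j) (b + real k)"
      using Beta_plus1_left[OF np, of "b + real k" "a + real j"] assms
      by (simp add: algebra_simps Beta_commute[of "a + real j"])
    then have "Beta (a + real j) (b + real (Suc k)) * pochhammer (a + b) (j + Suc k) =
        (b + real k) * (Beta (a + real j) (b + real k) * pochhammer (a + b) (j + k))"
      unfolding add_Suc_right pochhammer_Suc by (metis mult.assoc mult.commute)
    then show ?case unfolding Suc.IH by (simp add: pochhammer_Suc mult_ac)
  qed
qed

lemma Im_segment_pos:
  assumes "Im P > 0" "Im Q > 0" "u \<in> {0..1}"
  shows "Im (of_real (1 - u) * P + of_real u * Q) > 0"
proof (cases "u = 0")
  case False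
  then have "u * Im Q > 0" "(1 - u) * Im P \<ge> 0" using assms by auto
  then show ?thesis by simp
qed (use assms in simp)

text \<open>Feynman's parametrisation. The denominator is expanded around \<open>Q\<close>, which is the reason for
  the last assumption.\<close>

lemma Feynman_parametrisation:
  fixes P Q :: complex
  assumes ab: "a > 0" "b > 0" and P: "Im P > 0" and Q: "Im Q > 0" and PQ: "norm (1 - P / Q) < 1"
  shows "((\<lambda>u::real. (of_real (1 - u) * P + of_real u * Q) powr (- complex_of_real (a + b)) *
      of_real (u powr (b - 1) * (1 - u) powr (a - 1))) has_integral
    of_real (Beta a b) * P powr (- complex_of_real a) * Q powr (- complex_of_real b)) {0..1}"
    (is "(?F has_integral ?R) _")
proof -
  \<comment> \<open>The denominator is Q (1 - (1 - u) x), to be expanded in x.\<close>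
  define x where "x = 1 - P / Q"
  have Q0: "Q \<noteq> 0" using Q by auto
  have x: "norm x < 1" using PQ by (simp add: x_def)
  let ?s = "a + b"
  let ?d = "\<lambda>u. u powr (b - 1) * (1 - u) powr (a - 1) :: real"
  let ?h = "\<lambda>m u. (Q powr (- complex_of_real ?s) * (binomial_coeff ?s m * (of_real (1 - u) * x) ^ m)) * complex_of_real (?d u)"
  have exp: "(\<lambda>m. ?h m u) sums ?F u" if u: "u \<in> {0..1}" for u
  proof -
    let ?y = "of_real (1 - u) * x"
    have y: "norm ?y < 1"
      using u x mult_le_one[of "norm x" "1 - u"] mult_left_le_one_le[of "norm x" "1 - u"]
      by (simp add: norm_mult del: of_real_diff)
    have Dq: "(of_real (1 - u) * P + of_real u * Q) = Q * (1 - ?y)"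
      unfolding x_def using Q0 by (simp add: field_simps)
    note ImD = Im_segment_pos[OF P Q u]
    have "(Q * (1 - ?y)) powr (- complex_of_real ?s) * Q powr (- (- complex_of_real ?s)) =
        (Q * (1 - ?y) / Q) powr (- complex_of_real ?s)"
      by (rule powr_quotient_upper) (use ImD Q in \<open>simp_all only: Dq\<close>)
    then have e1: "(Q * (1 - ?y)) powr (- complex_of_real ?s) * Q powr (complex_of_real ?s) = (1 - ?y) powr (- complex_of_real ?s)"
      by (simp only: minus_minus nonzero_mult_div_cancel_left[OF Q0])
    have e2: "Q powr (complex_of_real ?s) * Q powr (- complex_of_real ?s) = 1"
      by (subst powr_add[symmetric]) (use Q0 in simp)
    have "X = Si * Y" if "X * S = Y" "S * Si = 1" for X S Y Si :: complex
    proof -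
      have "X = X * (S * Si)" using that by simp
      also have "\<dots> = Si * (X * S)" by (simp only: mult_ac)
      finally show ?thesis using that by simp
    qed
    note this[OF e1 e2]
    then show ?thesis unfolding Dq
      by (simp only:) (intro sums_mult2 sums_mult binomial_coeff_sums y)
  qed
  \<comment> \<open>Integration turns the m-th term into a Beta function with a + m. The recursion
    replaces (a + b)_m by (a)_m, so that the integrated series is the binomial series of (1 -
    x)^(-a) = (P/Q)^(-a).\<close>
  have intm: "integral {0..1} (?h m) = (Q powr (- complex_of_real ?s) * of_real (Beta a b)) * (binomial_coeff a m * x ^ m)" for m
  proof -
    have "((\<lambda>u::real. u powr (b - 1) * (1 - u) powr (a + real m - 1)) has_integral Beta b (a + real m)) {0..1}"
      by (rule has_integral_Beta_real) (use ab in auto)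
    then have "((\<lambda>u::real. complex_of_real (u powr (b - 1) * (1 - u) powr (a + real m - 1))) has_integral of_real (Beta b (a + real m))) {0..1}"
      by (rule has_integral_of_real)
    then have "((\<lambda>u::real. (Q powr (- complex_of_real ?s) * binomial_coeff ?s m * x ^ m) *
        complex_of_real (u powr (b - 1) * (1 - u) powr (a + real m - 1))) has_integral
        (Q powr (- complex_of_real ?s) * binomial_coeff ?s m * x ^ m) * of_real (Beta b (a + real m))) {0..1}"
      by (rule has_integral_mult_right)
    then have "((?h m) has_integral
        (Q powr (- complex_of_real ?s) * binomial_coeff ?s m * x ^ m) * of_real (Beta b (a + real m))) {0..1}"
    proof (rule has_integral_spike_finite[of "{1}", rotated 2])
      fix u :: real assume u: "u \<in> {0..1} - {1}"
      have "(1 - u) powr (a + real m - 1) = (1 - u) ^ m * (1 - u) powr (a - 1)"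
        using u powr_add[of "1 - u" "real m" "a - 1"] by (simp add: powr_realpow algebra_simps)
      then show "?h m u = (Q powr (- complex_of_real ?s) * binomial_coeff ?s m * x ^ m) *
        complex_of_real (u powr (b - 1) * (1 - u) powr (a + real m - 1))"
        by (simp add: power_mult_distrib)
    qed simp
    then have E1: "integral {0..1} (?h m) = (Q powr (- complex_of_real ?s) * binomial_coeff ?s m * x ^ m) * of_real (Beta b (a + real m))"
      by (rule integral_unique)
    have E2: "binomial_coeff ?s m * of_real (Beta b (a + real m)) = of_real (Beta a b) * binomial_coeff a m"
    proof -
      have "Beta b (a + real m) * pochhammer ?s m = Beta a b * pochhammer a m"
        using Beta_add_nat[OF ab, of m 0] by (simp add: Beta_commute)
      then have "complex_of_real (Beta b (a + real m)) * of_real (pochhammer ?s m) = of_real (Beta a b) * of_real (pochhammer a m)"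
        by (metis of_real_mult)
      then show ?thesis unfolding binomial_coeff_def pochhammer_of_real by (simp add: mult.commute)
    qed
    have "(q * B * X) * be = (q * Bt) * (A * X)" if "B * be = Bt * A" for q B X be Bt A :: complex
    proof -
      have "(q * B * X) * be = q * X * (B * be)" by (simp only: mult_ac)
      then show ?thesis unfolding that by (simp only: mult_ac)
    qed
    from this[OF E2] show ?thesis unfolding E1 .
  qed
  have B: "summable (\<lambda>m. norm (Q powr (- complex_of_real ?s)) * norm (binomial_coeff ?s m * x ^ m))"
  proof -
    have "1 \<le> conv_radius (binomial_coeff ?s)"
    proof (rule conv_radius_geI_ex)
      fix \<rho> :: real assume \<rho>: "0 < \<rho>" "ereal \<rho> < 1"
      then have "norm (of_real \<rho> :: complex) < 1" by (simp add: one_ereal_def)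
      from sums_summable[OF binomial_coeff_sums[OF this]]
      show "\<exists>z. norm z = \<rho> \<and> summable (\<lambda>n. binomial_coeff ?s n * z ^ n)"
        using \<rho> by (intro exI[of _ "of_real \<rho>"]) auto
    qed
    then have "ereal (norm x) < conv_radius (binomial_coeff ?s)"
      by (rule less_le_trans[rotated]) (use x in simp)
    then show ?thesis
      by (rule summable_mult[OF abs_summable_in_conv_radius])
  qed
    have meas: "?h m \<in> borel_measurable (lebesgue_on {0..1})" for m
      by (intro borel_measurable_times borel_measurable_powr_lebesgue_on
          continuous_imp_measurable_on_sets_lebesgue continuous_intros) auto
    have bnd: "norm (?h m u) \<le> norm (Q powr (- complex_of_real ?s)) * norm (binomial_coeff ?s m * x ^ m) * ?d u"
      if "u \<in> {0..1}" for m u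
    proof -
      have "norm ((of_real (1 - u) * x) ^ m) \<le> norm (x ^ m)"
        using that by (auto simp: norm_power norm_mult intro!: power_mono mult_left_le_one_le simp del: of_real_diff)
      then have "norm (binomial_coeff ?s m * (of_real (1 - u) * x) ^ m) \<le> norm (binomial_coeff ?s m * x ^ m)"
        unfolding norm_mult by (intro mult_left_mono) auto
      moreover have "norm (complex_of_real (?d u)) = ?d u" by (simp only: norm_of_real) simp
      ultimately show ?thesis
        unfolding norm_mult[of "_ * _" "complex_of_real _"] norm_mult[of "_ powr _"]
        by (intro mult_mono mult_left_mono) auto
    qed
  have S: "{0..1::real} \<in> sets lebesgue" by simp
  note swap = integral_sums_swap[OF S meas bnd integrable_Beta_density[OF ab] B exp]
  note swap(1)
  moreover have "(\<lambda>m. integral {0..1} (?h m)) sums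
      ((Q powr (- complex_of_real ?s) * of_real (Beta a b)) * (1 - x) powr (- complex_of_real a))"
    unfolding intm by (intro sums_mult binomial_coeff_sums x)
  ultimately have "integral {0..1} ?F = (Q powr (- complex_of_real ?s) * of_real (Beta a b)) * (1 - x) powr (- complex_of_real a)"
    by (rule sums_unique2)
  also have "(1 - x) powr (- complex_of_real a) = P powr (- complex_of_real a) * Q powr (complex_of_real a)"
    using powr_quotient_upper[OF P Q, of "- complex_of_real a"] by (simp add: x_def)
  also have "(Q powr (- complex_of_real ?s) * of_real (Beta a b)) * (P powr (- complex_of_real a) * Q powr (complex_of_real a)) =
      of_real (Beta a b) * P powr (- complex_of_real a) * (Q powr (- complex_of_real ?s) * Q powr (complex_of_real a))"
    by (simp only: mult_ac)
  also have "Q powr (- complex_of_real ?s) * Q powr (complex_of_real a) = Q powr (- complex_of_real b)"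
    by (simp add: powr_add[symmetric])
  finally have "integral {0..1} ?F = ?R" .
  moreover have "?F integrable_on {0..1}" by (rule integrable_on_lebesgue_on[OF swap(2) S])
  ultimately show ?thesis by (simp only: has_integral_integral)
qed


section \<open>Convolutions of coefficients\<close>

definition convolution :: "(nat \<Rightarrow> complex) \<Rightarrow> (nat \<Rightarrow> complex) \<Rightarrow> nat \<Rightarrow> complex" where
  "convolution d e n = (\<Sum>j\<le>n. d j * e (n - j))"

lemma norm_convolution_le:
  assumes "\<And>j. norm (d j) \<le> D j" "\<And>k. norm (e k) \<le> E k"
  shows "norm (convolution d e n) \<le> (\<Sum>j\<le>n. D j * E (n - j))"
  unfolding convolution_def
  by (intro order_trans[OF norm_sum] sum_mono)
     (auto simp: norm_mult intro!: mult_mono assms order_trans[OF norm_ge_zero assms(1)])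

text \<open>The weight splits by n + 1 \<le> (j + 1)(n - j + 1); the weighted d is summable and the
  weighted e is bounded.\<close>

lemma rapidly_decaying_convolution:
  assumes "rapidly_decaying d" "rapidly_decaying e"
  shows "rapidly_decaying (convolution d e)"
  unfolding rapidly_decaying_def
proof
  fix k
  obtain E where E: "\<And>n. norm (e n) * real (n + 1) ^ k \<le> E"
    using assms(2) unfolding rapidly_decaying_def by blast
  have E0: "E \<ge> 0" using order_trans[OF _ E[of 0]] by simp
  let ?D = "\<lambda>j. norm (d j) * real (j + 1) ^ k"
  have "rapidly_decaying (\<lambda>n. (1 * of_nat (n + 1)) ^ k * d n)"
  proof (rule rapidly_decaying_mult[OF _ assms(1)])
    show "polynomially_bounded (\<lambda>n. (1 * of_nat (n + 1)) ^ k)"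
      unfolding polynomially_bounded_def by (intro exI[of _ 1] exI[of _ k]) (simp add: norm_power del: of_nat_Suc of_nat_add)
  qed
  from rapidly_decaying_summable[OF this] have sD: "summable ?D"
    by (simp add: norm_mult norm_power mult.commute del: of_nat_Suc of_nat_add)
  have "norm (convolution d e n) * real (n + 1) ^ k \<le> suminf ?D * E" for n
  proof -
    have "norm (convolution d e n) * real (n + 1) ^ k \<le> (\<Sum>j\<le>n. norm (d j) * norm (e (n - j))) * real (n + 1) ^ k"
      by (intro mult_right_mono norm_convolution_le) auto
    also have "\<dots> = (\<Sum>j\<le>n. norm (d j) * norm (e (n - j)) * real (n + 1) ^ k)"
      by (rule sum_distrib_right)
    also have "\<dots> \<le> (\<Sum>j\<le>n. ?D j * E)"
    proof (rule sum_mono)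
      fix j assume "j \<in> {..n}"
      then have jn: "j \<le> n" by simp
      obtain i where "n = j + i" using jn le_Suc_ex by blast
      then have "real (n + 1) \<le> real (j + 1) * real (n - j + 1)" by (simp add: algebra_simps)
      then have "real (n + 1) ^ k \<le> (real (j + 1) * real (n - j + 1)) ^ k" by (intro power_mono) auto
      then have "norm (d j) * norm (e (n - j)) * real (n + 1) ^ k \<le>
          norm (d j) * norm (e (n - j)) * (real (j + 1) * real (n - j + 1)) ^ k"
        by (intro mult_left_mono) auto
      also have "\<dots> = ?D j * (norm (e (n - j)) * real (n - j + 1) ^ k)"
        by (simp only: power_mult_distrib mult_ac)
      also have "\<dots> \<le> ?D j * E" by (intro mult_left_mono E) auto
      finally show "norm (d j) * norm (e (n - j)) * real (n + 1) ^ k \<le> ?D j * E" .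
    qed
    also have "\<dots> = (\<Sum>j\<le>n. ?D j) * E" by (rule sum_distrib_right[symmetric])
    also have "\<dots> \<le> suminf ?D * E" by (intro mult_right_mono sum_le_suminf sD E0) auto
    finally show ?thesis .
  qed
  then show "\<exists>C. \<forall>n. norm (convolution d e n) * real (n + 1) ^ k \<le> C" by blast
qed

lemma disc_series_convolution:
  assumes "rapidly_decaying d" "rapidly_decaying e" "norm z \<le> 1"
  shows "disc_series (convolution d e) z = disc_series d z * disc_series e z"
proof -
  have s: "summable (\<lambda>n. norm (c n * z ^ n))" if "rapidly_decaying c" for c
    by (rule summable_comparison_test'[OF rapidly_decaying_summable[OF that]])
       (use norm_disc_term_le[OF assms(3)] in simp)
  have "(\<lambda>n. \<Sum>j\<le>n. (d j * z ^ j) * (e (n - j) * z ^ (n - j))) sums (disc_series d z * disc_series e z)"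
    unfolding disc_series_def by (rule Cauchy_product_sums[OF s[OF assms(1)] s[OF assms(2)]])
  moreover have "(\<Sum>j\<le>n. (d j * z ^ j) * (e (n - j) * z ^ (n - j))) = convolution d e n * z ^ n" for n
    unfolding convolution_def sum_distrib_right
  proof (rule sum.cong)
    fix j assume "j \<in> {..n}"
    then have "z ^ n = z ^ j * z ^ (n - j)" by (simp add: power_add[symmetric])
    then show "(d j * z ^ j) * (e (n - j) * z ^ (n - j)) = d j * e (n - j) * z ^ n" by simp
  qed simp
  ultimately show ?thesis by (simp add: disc_series_def sums_iff)
qed

text \<open>Holomorphy of f is recovered from its expansion in \<zeta>. Thus \<open>cp\<close> need
  not be differentiated under its integrals.\<close>

lemma in_D_infty_of_disc_series:
  assumes rap: "rapidly_decaying d" and eq: "\<And>\<zeta>. norm \<zeta> < 1 \<Longrightarrow> minus_disc r f \<zeta> = disc_series d \<zeta>"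
  shows "f \<in> D_infty r" "minus_coeff r f = d"
proof -
  have e: "minus_expansion r f d" using assms by (simp add: minus_expansion_def)
  show c: "minus_coeff r f = d" by (rule minus_expansion_coeff[OF e])
  let ?z = "\<lambda>t. (t + \<i>) / (t - \<i>)"
  have z: "norm (?z t) < 1" "t \<noteq> \<i>" if "t \<in> lower_half_plane" for t
  proof -
    have t: "Im t < 0" using that by (simp add: lower_half_plane_def)
    then show "t \<noteq> \<i>" by auto
    have "norm (t + \<i>) < norm (t - \<i>)"
      using t by (simp add: cmod_def power2_eq_square algebra_simps)
    then show "norm (?z t) < 1" using \<open>t \<noteq> \<i>\<close> by (simp add: norm_divide)
  qed
  have f: "f t = (\<i> - t) powr (- complex_of_real r) * disc_series d (?z t)" if t: "t \<in> lower_half_plane" for t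
  proof -
    have "\<i> * (?z t + 1) / (?z t - 1) = t"
    proof -
      have "t - \<i> \<noteq> 0" using z[OF t] by simp
      then have "?z t + 1 = 2 * t / (t - \<i>)" "?z t - 1 = 2 * \<i> / (t - \<i>)" by (auto simp: field_simps)
      then show ?thesis using \<open>t - \<i> \<noteq> 0\<close> by simp
    qed
    then have "disc_series d (?z t) = (\<i> - t) powr complex_of_real r * f t"
      using eq[OF z(1)[OF t]] by (simp add: minus_disc_def minus_twist_def)
    moreover have "(\<i> - t) powr (- complex_of_real r) * (\<i> - t) powr complex_of_real r = 1"
      using z(2)[OF t] by (simp add: powr_minus)
    ultimately show ?thesis by (simp add: mult.assoc[symmetric])
  qed
  have "(\<lambda>t. (\<i> - t) powr (- complex_of_real r) * (disc_series d \<circ> ?z) t) holomorphic_on lower_half_plane"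
  proof (intro holomorphic_on_mult holomorphic_on_compose_gen[OF _ holomorphic_on_disc_series[OF rap]])
    show "(\<lambda>t. (\<i> - t) powr (- complex_of_real r)) holomorphic_on lower_half_plane"
      by (intro holomorphic_intros) (auto simp: lower_half_plane_def complex_nonpos_Reals_iff)
    show "?z holomorphic_on lower_half_plane"
      by (intro holomorphic_intros) (use z(2) in auto)
    show "?z ` lower_half_plane \<subseteq> ball 0 1" using z(1) by auto
  qed
  then have "f holomorphic_on lower_half_plane"
    by (rule holomorphic_transform) (simp add: f)
  then show "f \<in> D_infty r" unfolding D_infty_iff c using e by simp
qed

section \<open>The pairing of a modular form with the kernel\<close>

text \<open>At u = 0 both sides are 0 because \<open>0 powr c\<close> is 0, also for k = 0. So the
  ends of the Beta integrals are no special case.\<close>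

lemma power_times_powr:
  assumes "u \<ge> (0::real)"
  shows "u ^ k * u powr c = u powr (c + real k)"
proof (cases "u = 0 \<or> k = 0")
  case False
  then show ?thesis using assms by (simp add: powr_add powr_realpow)
qed auto

lemma powr_minus_add_nat:
  assumes "x \<noteq> 0"
  shows "x powr (- complex_of_real (c + real i)) = x powr (- complex_of_real c) / x ^ i"
proof -
  have "x powr (- complex_of_real (c + real i)) = x powr (- complex_of_real c - of_nat i)" by simp
  also have "\<dots> = x powr (- complex_of_real c) / x powr (of_nat i)" by (rule powr_diff)
  also have "x powr (of_nat i) = x ^ i" using assms by (intro powr_nat') auto
  finally show ?thesis .
qed

text \<open>The numerator is expanded by the binomial theorem, and the term with index j is
  Feynman's formula for a + j and b + n - j. By the recursion of the Beta function its value carries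
  (a)_j (b)_(n-j)/(a + b)_n, and n! comes from the binomial coefficient; this produces the weight of
  the pairing.\<close>

lemma Feynman_power_integral:
  assumes ab: "a > 0" "b > 0" and P: "Im P > 0" and Q: "Im Q > 0" and PQ: "norm (1 - P / Q) < 1"
    and s: "s = a + b"
  shows "integral {0..1} (\<lambda>u::real. (of_real (1 - u) * P + of_real u * Q) powr (- complex_of_real s) *
      ((of_real (1 - u) * M + of_real u * N) / (of_real (1 - u) * P + of_real u * Q)) ^ n *
      of_real (u powr (b - 1) * (1 - u) powr (a - 1))) =
    of_real (Beta a b) * (fact n / pochhammer (of_real s) n) *
      (P powr (- complex_of_real a) * Q powr (- complex_of_real b) *
       convolution (\<lambda>j. binomial_coeff a j * (M / P) ^ j) (\<lambda>k. binomial_coeff b k * (N / Q) ^ k) n)"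
    (is "_ = ?rhs")
proof -
  let ?D = "\<lambda>u::real. of_real (1 - u) * P + of_real u * Q"
  let ?d = "\<lambda>u::real. u powr (b - 1) * (1 - u) powr (a - 1)"
  let ?t = "\<lambda>j u. of_nat (n choose j) * M ^ j * N ^ (n - j) *
        (?D u powr (- complex_of_real ((a + real j) + (b + real (n - j)))) *
         of_real (u powr ((b + real (n - j)) - 1) * (1 - u) powr ((a + real j) - 1)))"
  let ?r = "\<lambda>j. of_nat (n choose j) * M ^ j * N ^ (n - j) * (of_real (Beta (a + real j) (b + real (n - j))) *
        P powr (- complex_of_real (a + real j)) * Q powr (- complex_of_real (b + real (n - j))))"
  have P0: "P \<noteq> 0" and Q0: "Q \<noteq> 0" using P Q by auto
  have summand: "((\<lambda>u::real. ?t j u) has_integral ?r j) {0..1}" for j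
    by (intro has_integral_mult_right Feynman_parametrisation) (use assms in auto)
  have "((\<lambda>u. \<Sum>j\<le>n. ?t j u) has_integral (\<Sum>j\<le>n. ?r j)) {0..1}"
    by (intro has_integral_sum summand) auto
  then have "integral {0..1} (\<lambda>u. \<Sum>j\<le>n. ?t j u) = (\<Sum>j\<le>n. ?r j)"
    by (rule integral_unique)
  moreover have "integral {0..1} (\<lambda>u. \<Sum>j\<le>n. ?t j u) =
     integral {0..1} (\<lambda>u::real. ?D u powr (- complex_of_real s) *
      ((of_real (1 - u) * M + of_real u * N) / ?D u) ^ n * of_real (?d u))"
  proof (rule integral_cong)
    fix u :: real assume u: "u \<in> {0..1}"
    have D0: "?D u \<noteq> 0" using Im_segment_pos[OF P Q u] by (metis zero_complex.sel(2) less_irrefl)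
    have "?D u powr (- complex_of_real s) * (of_real (1 - u) * M + of_real u * N) ^ n / ?D u ^ n * of_real (?d u) =
        (\<Sum>j\<le>n. ?D u powr (- complex_of_real s) * (of_nat (n choose j) * (of_real (1 - u) * M) ^ j * (of_real u * N) ^ (n - j)) / ?D u ^ n * of_real (?d u))"
      unfolding binomial_ring by (simp add: sum_distrib_left sum_distrib_right sum_divide_distrib)
    also have "\<dots> = (\<Sum>j\<le>n. ?t j u)"
    proof (rule sum.cong[OF refl])
      fix j assume "j \<in> {..n}"
      \<comment> \<open>The exponents add up to s + n for every j, which absorbs the n-th power of
        the denominator.\<close>
      then have jn: "(a + real j) + (b + real (n - j)) = s + real n" by (simp add: s of_nat_diff)
      note e1 = powr_minus_add_nat[OF D0, of s n]
      have e2: "u powr ((b + real (n - j)) - 1) = u ^ (n - j) * u powr (b - 1)"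
        using power_times_powr[of u "n - j" "b - 1"] u by (simp add: algebra_simps)
      have e3: "(1 - u) powr ((a + real j) - 1) = (1 - u) ^ j * (1 - u) powr (a - 1)"
        using power_times_powr[of "1 - u" j "a - 1"] u by (simp add: algebra_simps)
      show "?D u powr (- complex_of_real s) * (of_nat (n choose j) * (of_real (1 - u) * M) ^ j * (of_real u * N) ^ (n - j)) / ?D u ^ n * of_real (?d u) =
        ?t j u"
        unfolding jn e1 e2 e3 power_mult_distrib of_real_mult of_real_power by (simp only: times_divide_eq_left times_divide_eq_right mult_ac)
    qed
    finally show "(\<Sum>j\<le>n. ?t j u) =
      ?D u powr (- complex_of_real s) * ((of_real (1 - u) * M + of_real u * N) / ?D u) ^ n * of_real (?d u)"
      by (simp only: power_divide times_divide_eq_right)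
  qed
  moreover have "(\<Sum>j\<le>n. ?r j) = ?rhs"
    unfolding convolution_def sum_distrib_left
  proof (rule sum.cong[OF refl])
    fix j assume "j \<in> {..n}"
    then have jn: "j \<le> n" by simp
    define k where "k = n - j"
    have n: "j + k = n" using jn by (simp add: k_def)
    have pz: "pochhammer (complex_of_real s) n \<noteq> 0"
      using pochhammer_pos[of s n] ab s unfolding pochhammer_of_real by simp
    have "Beta (a + real j) (b + real k) * pochhammer s n = Beta a b * pochhammer a j * pochhammer b k"
      using Beta_add_nat[OF ab, of j k] by (simp add: n s)
    then have "complex_of_real (Beta (a + real j) (b + real k)) * pochhammer (of_real s) n =
        of_real (Beta a b) * pochhammer (of_real a) j * pochhammer (of_real b) k"
      unfolding pochhammer_of_real by (metis of_real_mult)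
    then have B: "complex_of_real (Beta (a + real j) (b + real k)) =
        of_real (Beta a b) * pochhammer (of_real a) j * pochhammer (of_real b) k / pochhammer (of_real s) n"
      using pz by (simp add: eq_divide_eq)
    have C: "(of_nat (n choose j) :: complex) = fact n / (fact j * fact k)"
      using binomial_fact[OF jn, where 'a = complex] by (simp add: k_def)
    have "fact n / (fact j * fact k) * M ^ j * N ^ k * (B * A1 * A2 / p * (PP / P ^ j) * (QQ / Q ^ k)) =
        B * (fact n / p) * (PP * QQ * (A1 / fact j * (M / P) ^ j * (A2 / fact k * (N / Q) ^ k)))"
      for B A1 A2 p PP QQ :: complex
      by (simp add: power_divide mult_ac)
    then show "?r j =
      of_real (Beta a b) * (fact n / pochhammer (of_real s) n) *
      (P powr (- complex_of_real a) * Q powr (- complex_of_real b) *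
       (binomial_coeff a j * (M / P) ^ j * (binomial_coeff b (n - j) * (N / Q) ^ (n - j))))"
      unfolding k_def[symmetric] B C powr_minus_add_nat[OF P0] powr_minus_add_nat[OF Q0] binomial_coeff_def .
  qed
  ultimately show ?thesis by (simp only:)
qed


text \<open>The binomial coefficient (j + m over j) times q^j (1 - q)^m is one term in the expansion
  of 1 = (q + (1 - q))^(j + m), and the coefficient times m! is at least (j + 1)^m. The bound is
  uniform in q, also as q tends to 1, which the half-line to the cusp requires.\<close>

lemma power_mult_power_le:
  assumes "0 \<le> q" "q \<le> (1::real)"
  shows "q ^ j * (1 - q) ^ m * real (j + 1) ^ m \<le> fact m"
proof -
  have f: "real (j + 1) ^ m * fact j \<le> fact (j + m)"
  proof (induction m)
    case (Suc m)
    have "real (j + 1) ^ Suc m * fact j \<le> real (j + 1) * fact (j + m)"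
      using mult_left_mono[OF Suc, of "real (j + 1)"] by (simp add: mult_ac)
    also have "\<dots> \<le> real (j + m + 1) * fact (j + m)" by (intro mult_right_mono) auto
    also have "\<dots> = fact (j + Suc m)" by simp
    finally show ?case .
  qed simp
  have "real ((j + m) choose j) * q ^ j * (1 - q) ^ (j + m - j) \<le>
      (\<Sum>k\<le>j + m. real ((j + m) choose k) * q ^ k * (1 - q) ^ (j + m - k))"
    using assms by (intro member_le_sum[of j _ "\<lambda>k. real ((j + m) choose k) * q ^ k * (1 - q) ^ (j + m - k)"]) auto
  also have "\<dots> = (q + (1 - q)) ^ (j + m)" by (rule binomial_ring[symmetric])
  finally have "real ((j + m) choose j) * (q ^ j * (1 - q) ^ m) \<le> 1" by simp
  moreover have "real ((j + m) choose j) = fact (j + m) / (fact j * fact m)"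
    using binomial_fact[of j "j + m", where 'a = real] by simp
  ultimately have "fact (j + m) * (q ^ j * (1 - q) ^ m) \<le> fact j * fact m"
    by (simp add: field_simps)
  moreover have "(real (j + 1) ^ m * fact j) * (q ^ j * (1 - q) ^ m) \<le> fact (j + m) * (q ^ j * (1 - q) ^ m)"
    using assms by (intro mult_right_mono f) auto
  ultimately have "(real (j + 1) ^ m * fact j) * (q ^ j * (1 - q) ^ m) \<le> fact j * fact m"
    by linarith
  then have "fact j * (q ^ j * (1 - q) ^ m * real (j + 1) ^ m) \<le> fact j * fact m"
    by (simp only: mult_ac)
  then show ?thesis by (rule mult_left_le_imp_le) simp
qed

lemma rapidly_decaying_geometric:
  assumes "0 \<le> q" "q < 1"
  shows "rapidly_decaying (\<lambda>j. complex_of_real (q ^ j))"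
  unfolding rapidly_decaying_def
proof (intro allI exI)
  fix m j
  show "norm (complex_of_real (q ^ j)) * real (j + 1) ^ m \<le> fact m / (1 - q) ^ m"
    using power_mult_power_le[of q j m] assms by (simp add: norm_power field_simps)
qed

section \<open>Kernels integrated along a path\<close>

lemma continuous_on_kernel_coeff:
  assumes "continuous_on S \<gamma>" "\<And>x. x \<in> S \<Longrightarrow> Im (\<gamma> x) > 0"
  shows "continuous_on S (\<lambda>x. kernel_coeff a (\<gamma> x) j)"
proof -
  have nz: "\<gamma> x + \<i> \<noteq> 0" if "x \<in> S" for x using assms(2)[OF that] by (auto simp: complex_eq_iff)
  have re: "Re (2 * \<i> / (\<gamma> x + \<i>)) > 0" if "x \<in> S" for x
    using assms(2)[OF that] nz[OF that] by (auto simp: Re_divide complex_eq_iff intro!: divide_pos_pos sum_power2_gt_zero_iff[THEN iffD2])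
  show ?thesis unfolding kernel_coeff_def w_coord_def
    by (intro continuous_intros assms) (auto simp: nz intro: less_imp_le[OF re])
qed

lemma w_coord_uniform_bound:
  assumes "continuous_on {0..1} \<gamma>" "\<And>x::real. x \<in> {0..1} \<Longrightarrow> Im (\<gamma> x) > 0"
  obtains q where "0 \<le> q" "q < 1" "\<And>x. x \<in> {0..1} \<Longrightarrow> norm (w_coord (\<gamma> x)) \<le> q"
    and "continuous_on {0..1} (\<lambda>x. w_coord (\<gamma> x))"
proof -
  have "\<gamma> x + \<i> \<noteq> 0" if "x \<in> {0..1}" for x using assms(2)[OF that] by (auto simp: complex_eq_iff)
  then have cw: "continuous_on {0..1} (\<lambda>x. w_coord (\<gamma> x))"
    unfolding w_coord_def by (intro continuous_intros assms) auto
  obtain x0 where x0: "x0 \<in> {0..1}" "\<And>x. x \<in> {0..1} \<Longrightarrow> norm (w_coord (\<gamma> x)) \<le> norm (w_coord (\<gamma> x0))"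
    using continuous_attains_sup[of "{0..1::real}" "\<lambda>x. norm (w_coord (\<gamma> x))"] continuous_on_norm[OF cw] by auto
  then show ?thesis using that[OF _ norm_w_coord[OF assms(2)[OF x0(1)]] x0(2) cw] by simp
qed

text \<open>One frame for the arc and for the half-line to the cusp: \<gamma> is the path and \<phi>
  the automorphic form times the derivative of the path. The bound separates the index from the
  variable, with rapid decay in the index and integrability in the variable.\<close>

locale kernel_family =
  fixes S :: "real set" and \<phi> \<gamma> :: "real \<Rightarrow> complex" and a :: real
    and g :: "real \<Rightarrow> real" and \<beta> :: "nat \<Rightarrow> complex"
  assumes S: "S \<in> sets lebesgue"
    and cont_\<gamma>: "continuous_on S \<gamma>" and Im_\<gamma>: "\<And>x. x \<in> S \<Longrightarrow> Im (\<gamma> x) > 0"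
    and cont_\<phi>: "continuous_on S \<phi>"
    and g: "integrable (lebesgue_on S) g" "\<And>x. x \<in> S \<Longrightarrow> 0 \<le> g x"
    and \<beta>: "rapidly_decaying \<beta>"
    and bnd: "\<And>x j. x \<in> S \<Longrightarrow> norm (\<phi> x * kernel_coeff a (\<gamma> x) j) \<le> norm (\<beta> j) * g x"
begin

definition coeff :: "nat \<Rightarrow> complex" where
  "coeff j = integral S (\<lambda>x. \<phi> x * kernel_coeff a (\<gamma> x) j)"

lemma cont_term: "continuous_on S (\<lambda>x. \<phi> x * kernel_coeff a (\<gamma> x) j)"
  by (intro continuous_intros cont_\<phi> continuous_on_kernel_coeff cont_\<gamma> Im_\<gamma>)

lemma measurable_term: "(\<lambda>x. \<phi> x * kernel_coeff a (\<gamma> x) j) \<in> borel_measurable (lebesgue_on S)"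
  by (rule continuous_imp_measurable_on_sets_lebesgue[OF cont_term S])

lemma integrable_term: "integrable (lebesgue_on S) (\<lambda>x. \<phi> x * kernel_coeff a (\<gamma> x) j)"
proof (rule Bochner_Integration.integrable_bound[OF integrable_mult_right[OF g(1), of "norm (\<beta> j)"] measurable_term])
  show "AE x in lebesgue_on S. norm (\<phi> x * kernel_coeff a (\<gamma> x) j) \<le> norm (norm (\<beta> j) * g x)"
    by (rule AE_I2) (use bnd in \<open>auto intro: order_trans[OF bnd abs_ge_self]\<close>)
qed

lemma integrable_on_term: "(\<lambda>x. \<phi> x * kernel_coeff a (\<gamma> x) j) integrable_on S"
  by (rule integrable_on_lebesgue_on[OF integrable_term S])

lemma norm_coeff_le: "norm (coeff j) \<le> norm (\<beta> j) * integral S g"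
proof -
  have "norm (coeff j) \<le> integral S (\<lambda>x. norm (\<beta> j) * g x)"
    unfolding coeff_def
    by (rule integral_norm_bound_integral[OF integrable_on_term])
       (use bnd integrable_on_mult_right[OF integrable_on_lebesgue_on[OF g(1) S]] in auto)
  then show ?thesis by simp
qed

lemma rapidly_decaying_coeff: "rapidly_decaying coeff"
  unfolding rapidly_decaying_def
proof
  fix k
  have G0: "integral S g \<ge> 0" using g integrable_on_lebesgue_on[OF g(1) S] by (intro integral_nonneg) auto
  obtain C where C: "\<And>n. norm (\<beta> n) * real (n + 1) ^ k \<le> C"
    using \<beta> unfolding rapidly_decaying_def by blast
  have "norm (coeff n) * real (n + 1) ^ k \<le> C * integral S g" for n
  proof -
    have "norm (coeff n) * real (n + 1) ^ k \<le> (norm (\<beta> n) * integral S g) * real (n + 1) ^ k"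
      by (intro mult_right_mono norm_coeff_le) simp
    also have "\<dots> = (norm (\<beta> n) * real (n + 1) ^ k) * integral S g" by (simp only: mult_ac)
    also have "\<dots> \<le> C * integral S g" by (intro mult_right_mono C G0)
    finally show ?thesis .
  qed
  then show "\<exists>C. \<forall>n. norm (coeff n) * real (n + 1) ^ k \<le> C" by blast
qed

lemma disc_series_coeff:
  assumes \<zeta>: "norm \<zeta> < 1"
  defines "t \<equiv> \<i> * (\<zeta> + 1) / (\<zeta> - 1)"
  shows "disc_series coeff \<zeta> =
    (\<i> - t) powr complex_of_real a * integral S (\<lambda>x. \<phi> x * (\<gamma> x - t) powr (- complex_of_real a))"
proof -
  let ?f = "\<lambda>j x. \<phi> x * kernel_coeff a (\<gamma> x) j * \<zeta> ^ j"
  let ?F = "\<lambda>x. (\<i> - t) powr complex_of_real a * (\<phi> x * (\<gamma> x - t) powr (- complex_of_real a))"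
  have "(\<lambda>j. integral S (?f j)) sums integral S ?F"
  proof (rule integral_sums_swap(1)[OF S _ _ g(1) rapidly_decaying_summable[OF \<beta>]])
    show "?f j \<in> borel_measurable (lebesgue_on S)" for j
      by (intro borel_measurable_times measurable_term) simp
    show "norm (?f j x) \<le> norm (\<beta> j) * g x" if "x \<in> S" for j x
    proof -
      have "norm (?f j x) \<le> norm (\<phi> x * kernel_coeff a (\<gamma> x) j)"
        using norm_disc_term_le[of \<zeta>] \<zeta> by simp
      then show ?thesis using bnd[OF that, of j] by simp
    qed
    show "(\<lambda>j. ?f j x) sums ?F x" if "x \<in> S" for x
      using sums_mult[OF kernel_sums[OF Im_\<gamma>[OF that] \<zeta>, of a], of "\<phi> x"]
      unfolding t_def by (simp add: mult_ac)
  qed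
  moreover have "integral S (?f j) = coeff j * \<zeta> ^ j" for j
    unfolding coeff_def by simp
  ultimately have "(\<lambda>j. coeff j * \<zeta> ^ j) sums integral S ?F" by (simp only:)
  then have "disc_series coeff \<zeta> = integral S ?F"
    unfolding disc_series_def by (rule sums_unique[symmetric])
  then show ?thesis by simp
qed

end

text \<open>Two successive exchanges, in y for fixed x and afterwards in x. Both are dominated by p
  times a convolution of rapidly decaying majorants, which is summable because rapid decay survives
  convolution and polynomial factors. G is left open; it will be Feynman's integral.\<close>

lemma kernel_families_sums:
  assumes "kernel_family S1 \<phi>1 \<gamma>1 a g1 \<alpha>" "kernel_family S2 \<phi>2 \<gamma>2 b g2 \<beta>"
    and p: "polynomially_bounded p"
    and G: "\<And>x y. x \<in> S1 \<Longrightarrow> y \<in> S2 \<Longrightarrow>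
      (\<lambda>n. p n * convolution (kernel_coeff a (\<gamma>1 x)) (kernel_coeff b (\<gamma>2 y)) n) sums G x y"
  shows "(\<lambda>n. p n * convolution (kernel_family.coeff S1 \<phi>1 \<gamma>1 a) (kernel_family.coeff S2 \<phi>2 \<gamma>2 b) n) sums
    integral S1 (\<lambda>x. \<phi>1 x * integral S2 (\<lambda>y. \<phi>2 y * G x y))"
proof -
  interpret A: kernel_family S1 \<phi>1 \<gamma>1 a g1 \<alpha> by fact
  interpret B: kernel_family S2 \<phi>2 \<gamma>2 b g2 \<beta> by fact
  let ?u = "\<lambda>j x. \<phi>1 x * kernel_coeff a (\<gamma>1 x) j" and ?v = "\<lambda>k y. \<phi>2 y * kernel_coeff b (\<gamma>2 y) k"
  \<comment> \<open>\<open>H\<close> stands for the terms before the integration over y,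
    \<open>h\<close> for those after it.\<close>
  define H where "H n x y = p n * convolution (\<lambda>j. ?u j x) (\<lambda>k. ?v k y) n" for n x y
  define h where "h n x = p n * convolution (\<lambda>j. ?u j x) B.coeff n" for n x
  have Heq: "H n x y = \<phi>1 x * \<phi>2 y * (p n * convolution (kernel_coeff a (\<gamma>1 x)) (kernel_coeff b (\<gamma>2 y)) n)" for n x y
    by (simp add: H_def convolution_def sum_distrib_left mult_ac)
  have H_int: "integral S2 (H n x) = h n x" for n x
  proof -
    have "integral S2 (H n x) = p n * integral S2 (\<lambda>y. \<Sum>j\<le>n. ?u j x * ?v (n - j) y)"
      unfolding H_def[abs_def] convolution_def by simp
    also have "integral S2 (\<lambda>y. \<Sum>j\<le>n. ?u j x * ?v (n - j) y) = (\<Sum>j\<le>n. integral S2 (\<lambda>y. ?u j x * ?v (n - j) y))"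
      by (rule integral_sum) (auto intro!: integrable_on_mult_right B.integrable_on_term)
    finally show ?thesis unfolding h_def convolution_def B.coeff_def by simp
  qed
  have rapc: "summable (\<lambda>n. norm (p n) * (\<Sum>j\<le>n. norm (d j) * norm (e (n - j))))"
    if "rapidly_decaying d" "rapidly_decaying e" for d e
  proof -
    have r: "rapidly_decaying (\<lambda>n. complex_of_real (norm (d n)))" if "rapidly_decaying d" for d
      using that by (simp add: rapidly_decaying_def)
    have "rapidly_decaying (\<lambda>n. p n * convolution (\<lambda>n. complex_of_real (norm (d n))) (\<lambda>n. complex_of_real (norm (e n))) n)"
      by (intro rapidly_decaying_mult[OF p] rapidly_decaying_convolution r that)
    from rapidly_decaying_summable[OF this]
    have "summable (\<lambda>n. norm (p n) * norm (complex_of_real (\<Sum>j\<le>n. norm (d j) * norm (e (n - j)))))"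
      by (simp add: norm_mult convolution_def)
    then show ?thesis by (simp only: norm_of_real abs_of_nonneg[OF sum_nonneg[OF mult_nonneg_nonneg[OF norm_ge_zero norm_ge_zero]]])
  qed
  have inner: "(\<lambda>n. h n x) sums (\<phi>1 x * integral S2 (\<lambda>y. \<phi>2 y * G x y))" if x: "x \<in> S1" for x
  proof -
    have "(\<lambda>n. integral S2 (H n x)) sums integral S2 (\<lambda>y. \<phi>1 x * (\<phi>2 y * G x y))"
    proof (rule integral_sums_swap(1)[OF B.S _ _ B.g(1)])
      show "H n x \<in> borel_measurable (lebesgue_on S2)" for n
        unfolding H_def[abs_def] convolution_def
        by (intro borel_measurable_times borel_measurable_const borel_measurable_sum B.measurable_term)
      show "norm (H n x y) \<le> (g1 x * (norm (p n) * (\<Sum>j\<le>n. norm (\<alpha> j) * norm (\<beta> (n - j))))) * g2 y" if y: "y \<in> S2" for n y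
      proof -
        have "norm (convolution (\<lambda>j. ?u j x) (\<lambda>k. ?v k y) n) \<le> (\<Sum>j\<le>n. (norm (\<alpha> j) * g1 x) * (norm (\<beta> (n - j)) * g2 y))"
          by (rule norm_convolution_le[OF A.bnd[OF x] B.bnd[OF y]])
        also have "\<dots> = g1 x * (\<Sum>j\<le>n. norm (\<alpha> j) * norm (\<beta> (n - j))) * g2 y"
          by (simp add: sum_distrib_left sum_distrib_right mult_ac)
        finally have "norm (p n) * norm (convolution (\<lambda>j. ?u j x) (\<lambda>k. ?v k y) n) \<le>
            norm (p n) * (g1 x * (\<Sum>j\<le>n. norm (\<alpha> j) * norm (\<beta> (n - j))) * g2 y)"
          by (rule mult_left_mono) simp
        then show ?thesis unfolding H_def norm_mult by (simp only: mult_ac)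
      qed
      show "summable (\<lambda>n. g1 x * (norm (p n) * (\<Sum>j\<le>n. norm (\<alpha> j) * norm (\<beta> (n - j)))))"
        by (rule summable_mult[OF rapc[OF A.\<beta> B.\<beta>]])
      show "(\<lambda>n. H n x y) sums (\<phi>1 x * (\<phi>2 y * G x y))" if "y \<in> S2" for y
        unfolding Heq mult.assoc[symmetric, of "\<phi>1 x"] by (rule sums_mult[OF G[OF x that]])
    qed
    then show ?thesis unfolding H_int by simp
  qed
  have "(\<lambda>n. integral S1 (h n)) sums integral S1 (\<lambda>x. \<phi>1 x * integral S2 (\<lambda>y. \<phi>2 y * G x y))"
  proof (rule integral_sums_swap(1)[OF A.S _ _ A.g(1)])
    show "h n \<in> borel_measurable (lebesgue_on S1)" for n
      unfolding h_def[abs_def] convolution_def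
      by (intro borel_measurable_times borel_measurable_const borel_measurable_sum A.measurable_term)
    show "norm (h n x) \<le> (norm (p n) * (\<Sum>j\<le>n. norm (\<alpha> j) * norm (B.coeff (n - j)))) * g1 x" if x: "x \<in> S1" for n x
    proof -
      have "norm (convolution (\<lambda>j. ?u j x) B.coeff n) \<le> (\<Sum>j\<le>n. (norm (\<alpha> j) * g1 x) * norm (B.coeff (n - j)))"
        by (rule norm_convolution_le[OF A.bnd[OF x] order_refl])
      also have "\<dots> = (\<Sum>j\<le>n. norm (\<alpha> j) * norm (B.coeff (n - j))) * g1 x"
        unfolding sum_distrib_right by (simp only: mult_ac)
      finally have "norm (p n) * norm (convolution (\<lambda>j. ?u j x) B.coeff n) \<le>
          norm (p n) * ((\<Sum>j\<le>n. norm (\<alpha> j) * norm (B.coeff (n - j))) * g1 x)"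
        by (rule mult_left_mono) simp
      then show ?thesis unfolding h_def norm_mult by (simp only: mult_ac)
    qed
    show "summable (\<lambda>n. norm (p n) * (\<Sum>j\<le>n. norm (\<alpha> j) * norm (B.coeff (n - j))))"
      by (rule rapc[OF A.\<beta> B.rapidly_decaying_coeff])
  qed (rule inner)
  moreover have "integral S1 (h n) = p n * convolution A.coeff B.coeff n" for n
  proof -
    have "integral S1 (h n) = p n * integral S1 (\<lambda>x. \<Sum>j\<le>n. ?u j x * B.coeff (n - j))"
      unfolding h_def[abs_def] convolution_def by simp
    also have "integral S1 (\<lambda>x. \<Sum>j\<le>n. ?u j x * B.coeff (n - j)) = (\<Sum>j\<le>n. integral S1 (\<lambda>x. ?u j x * B.coeff (n - j)))"
      by (rule integral_sum) (auto intro!: integrable_on_mult_left A.integrable_on_term)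
    finally show ?thesis unfolding convolution_def A.coeff_def by simp
  qed
  ultimately show ?thesis by simp
qed


text \<open>The convex combinations of \<tau>1 + i and \<tau>2 + i, and of \<tau>1 - i and \<tau>2 -
  i, are z + i and z - i for the point z of the Euclidean segment, and the quotient of the latter by
  the former is the coordinate w of z. The constant (-2 i)^s arises on rewriting 2 i/(z + i) as -2
  i/(- i - z), in which - i - z is the base of the twist; the factor Gamma s/(Gamma a Gamma b) is
  1/B(a, b).\<close>

lemma kernel_convolution_integral:
  fixes \<tau>1 \<tau>2 :: complex
  assumes ab: "a > 0" "b > 0" and s: "s = a + b" and \<tau>: "Im \<tau>1 > 0" "Im \<tau>2 > 0"
    and near: "norm ((\<tau>2 - \<tau>1) / (\<tau>2 + \<i>)) < 1"
  defines "z \<equiv> \<lambda>u. \<tau>1 + complex_of_real u * (\<tau>2 - \<tau>1)"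
  shows "fact n / pochhammer (complex_of_real s) n * convolution (kernel_coeff a \<tau>1) (kernel_coeff b \<tau>2) n =
    (- 2 * \<i>) powr complex_of_real s * of_real (Gamma s / (Gamma a * Gamma b)) *
    integral {0..1} (\<lambda>u::real. (- \<i> - z u) powr (- complex_of_real s) * w_coord (z u) ^ n *
      of_real (u powr (b - 1) * (1 - u) powr (a - 1)))"
proof -
  let ?d = "\<lambda>u. complex_of_real (u powr (b - 1) * (1 - u) powr (a - 1))"
  define P Q M N where "P = \<tau>1 + \<i>" and "Q = \<tau>2 + \<i>" and "M = \<tau>1 - \<i>" and "N = \<tau>2 - \<i>"
  have PQ: "Im P > 0" "Im Q > 0" using \<tau> by (auto simp: P_def Q_def)
  then have PQ0: "P \<noteq> 0" "Q \<noteq> 0" by auto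
  have near': "norm (1 - P / Q) < 1" using near PQ0 by (simp add: P_def Q_def diff_divide_eq_iff)
  let ?D = "\<lambda>u::real. of_real (1 - u) * P + of_real u * Q"
  let ?c = "convolution (\<lambda>j. binomial_coeff a j * (M / P) ^ j) (\<lambda>k. binomial_coeff b k * (N / Q) ^ k) n"
  have i2: "(2 * \<i> / X) powr complex_of_real c = (2 * \<i>) powr complex_of_real c * X powr (- complex_of_real c)" if "Im X > 0" for X c
    by (rule powr_quotient_upper[symmetric]) (use that in auto)
  have conv: "convolution (kernel_coeff a \<tau>1) (kernel_coeff b \<tau>2) n =
      (2 * \<i>) powr complex_of_real s * (P powr (- complex_of_real a) * Q powr (- complex_of_real b) * ?c)"
  proof -
    have "(2 * \<i>) powr complex_of_real s = (2 * \<i>) powr complex_of_real a * (2 * \<i>) powr complex_of_real b"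
      by (simp add: s powr_add)
    then show ?thesis
      using i2[OF PQ(1), of a] i2[OF PQ(2), of b]
      by (simp add: convolution_def kernel_coeff_def w_coord_def P_def[symmetric] Q_def[symmetric]
          M_def[symmetric] N_def[symmetric] sum_distrib_left mult_ac)
  qed
  have integrand: "(- 2 * \<i>) powr complex_of_real s *
       ((- \<i> - z u) powr (- complex_of_real s) * w_coord (z u) ^ n * ?d u) =
     (2 * \<i>) powr complex_of_real s * (?D u powr (- complex_of_real s) *
       ((of_real (1 - u) * M + of_real u * N) / ?D u) ^ n * ?d u)"
    if u: "u \<in> {0..1}" for u
  proof -
    note ImD = Im_segment_pos[OF PQ u]
    then have D0: "?D u \<noteq> 0" by (metis zero_complex.sel(2) less_irrefl)
    have e: "- \<i> - z u = - ?D u" by (simp add: z_def P_def Q_def algebra_simps)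
    have w: "w_coord (z u) = (of_real (1 - u) * M + of_real u * N) / ?D u"
      by (simp add: w_coord_def z_def P_def Q_def M_def N_def algebra_simps)
    \<comment> \<open>Both bases lie in the lower half-plane, where principal arguments differ by
      less than pi.\<close>
    have lower: "- pi < Im (Ln X) \<and> Im (Ln X) < 0" if "Im X < 0" for X
    proof -
      have "X \<noteq> 0" using that by auto
      then show ?thesis using mpi_less_Im_Ln[of X] Im_Ln_less_pi[of X] Im_Ln_pos_le[of X] Im_Ln_le_pi[of X] that by auto
    qed
    have "(- 2 * \<i>) powr complex_of_real s * (- ?D u) powr (- complex_of_real s) = ((- 2 * \<i>) / (- ?D u)) powr complex_of_real s"
    proof (rule powr_quotient)
      show "\<bar>Im (Ln (- 2 * \<i>)) - Im (Ln (- ?D u))\<bar> < pi"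
      proof -
        have "Im (- ?D u) < 0" using ImD by (simp only: uminus_complex.sel neg_less_0_iff_less)
        moreover have "Im (- 2 * \<i>) < 0" by simp
        ultimately show ?thesis using lower[of "- ?D u"] lower[of "- 2 * \<i>"] by linarith
      qed
      show "- ?D u \<noteq> 0" using D0 by (simp only: neg_equal_0_iff_equal not_False_eq_True)
    qed simp
    also have "((- 2 * \<i>) / (- ?D u)) powr complex_of_real s = (2 * \<i> / ?D u) powr complex_of_real s"
      by (simp only: mult_minus_left minus_divide_divide)
    also have "\<dots> = (2 * \<i>) powr complex_of_real s * ?D u powr (- complex_of_real s)" by (rule i2[OF ImD])
    finally show ?thesis unfolding e w mult.assoc[symmetric] by (simp only:)
  qed
  have "(- 2 * \<i>) powr complex_of_real s * integral {0..1} (\<lambda>u::real. (- \<i> - z u) powr (- complex_of_real s) * w_coord (z u) ^ n *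
      ?d u) =
     integral {0..1} (\<lambda>u::real. (- 2 * \<i>) powr complex_of_real s * ((- \<i> - z u) powr (- complex_of_real s) * w_coord (z u) ^ n *
      ?d u))"
    by (rule integral_mult_right[symmetric])
  also have "\<dots> = integral {0..1} (\<lambda>u::real. (2 * \<i>) powr complex_of_real s * (?D u powr (- complex_of_real s) *
       ((of_real (1 - u) * M + of_real u * N) / ?D u) ^ n * ?d u))"
    by (rule integral_cong[OF integrand])
  also have "\<dots> = (2 * \<i>) powr complex_of_real s * (of_real (Beta a b) * (fact n / pochhammer (of_real s) n) *
      (P powr (- complex_of_real a) * Q powr (- complex_of_real b) * ?c))"
    unfolding integral_mult_right Feynman_power_integral[OF ab PQ near' s] ..
  finally have main: "(- 2 * \<i>) powr complex_of_real s * integral {0..1} (\<lambda>u::real. (- \<i> - z u) powr (- complex_of_real s) * w_coord (z u) ^ n *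
      ?d u) = of_real (Beta a b) * (fact n / pochhammer (of_real s) n * convolution (kernel_coeff a \<tau>1) (kernel_coeff b \<tau>2) n)"
    unfolding conv by (simp only: mult_ac)
  have GB: "complex_of_real (Gamma s / (Gamma a * Gamma b)) * of_real (Beta a b) = 1"
  proof -
    have "Gamma s > 0" "Gamma a > 0" "Gamma b > 0" using ab s by auto
    then have "Gamma s / (Gamma a * Gamma b) * Beta a b = 1" by (simp add: Beta_def s)
    then show ?thesis by (metis of_real_mult of_real_1)
  qed
  have "k * g * I = X" if "k * I = B * X" "g * B = 1" for k g I B X :: complex
  proof -
    have "k * g * I = g * (k * I)" by (simp only: mult_ac)
    also have "\<dots> = (g * B) * X" unfolding that(1) by (simp only: mult_ac)
    finally show ?thesis using that(2) by simp
  qed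
  from this[OF main GB] show ?thesis by (rule sym)
qed

text \<open>On the compact segment |w| stays below some q < 1, so the growth of the coefficients is
  harmless. The series sums to the twisted h at z, and (- i - z)^(-s) removes the twist.\<close>

lemma pairing_weight_convolution_sums:
  fixes \<tau>1 \<tau>2 :: complex
  assumes h: "h holomorphic_on upper_half_plane" and c: "polynomially_bounded (plus_coeff s h)"
    and ab: "a > 0" "b > 0" and s: "s = a + b" and \<tau>: "Im \<tau>1 > 0" "Im \<tau>2 > 0"
    and near: "norm ((\<tau>2 - \<tau>1) / (\<tau>2 + \<i>)) < 1"
  shows "(\<lambda>n. pairing_weight s h n * convolution (kernel_coeff a \<tau>1) (kernel_coeff b \<tau>2) n) sums
    ((- 2 * \<i>) powr complex_of_real s * of_real (Gamma s / (Gamma a * Gamma b)) *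
     integral {0..1} (\<lambda>u::real. h (\<tau>1 + complex_of_real u * (\<tau>2 - \<tau>1)) *
       of_real (u powr (b - 1) * (1 - u) powr (a - 1))))"
proof -
  define z where "z = (\<lambda>u::real. \<tau>1 + complex_of_real u * (\<tau>2 - \<tau>1))"
  let ?d = "\<lambda>u::real. u powr (b - 1) * (1 - u) powr (a - 1)"
  let ?k = "\<lambda>u. (- \<i> - z u) powr (- complex_of_real s)"
  have Imz: "Im (z u) > 0" if u: "u \<in> {0..1}" for u
  proof -
    have "z u = of_real (1 - u) * \<tau>1 + of_real u * \<tau>2" by (simp add: z_def algebra_simps)
    then show ?thesis using Im_segment_pos[OF \<tau> u] by (simp only:)
  qed
  have cz: "continuous_on {0..1} z" unfolding z_def by (intro continuous_intros)
  have ck: "continuous_on {0..1} ?k"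
  proof (intro continuous_on_powr_complex continuous_intros cz)
    show "{0..1} \<subseteq> {u. 0 \<le> Re (- \<i> - z u) \<or> Im (- \<i> - z u) \<noteq> 0}" using Imz by force
    show "0 < Re (- complex_of_real s)" if "u \<in> {0..1}" "- \<i> - z u = 0" for u
      using Imz[OF that(1)] that(2) by (simp add: complex_eq_iff)
  qed
  have zi: "z u + \<i> \<noteq> 0" if "u \<in> {0..1}" for u using Imz[OF that] by (auto simp: complex_eq_iff)
  obtain q where q: "0 \<le> q" "q < 1" "\<And>u. u \<in> {0..1} \<Longrightarrow> norm (w_coord (z u)) \<le> q"
    and cw: "continuous_on {0..1} (\<lambda>u. w_coord (z u))"
    using w_coord_uniform_bound[OF cz Imz] by blast
  obtain M where M: "\<And>u. u \<in> {0..1} \<Longrightarrow> norm (?k u) \<le> M"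
    using compact_norm_bound[OF compact_Icc ck] by blast
  have M0: "M \<ge> 0" by (rule order_trans[OF norm_ge_zero M[of 0]]) simp
  let ?c = "plus_coeff s h"
  let ?f = "\<lambda>n u. ?c n * (?k u * w_coord (z u) ^ n) * of_real (?d u)"
  have "(\<lambda>n. integral {0..1} (?f n)) sums integral {0..1} (\<lambda>u. h (z u) * of_real (?d u))"
  proof (rule integral_sums_swap(1))
    show "integrable (lebesgue_on {0..1}) ?d" by (rule integrable_Beta_density[OF ab])
    show "summable (\<lambda>n. M * norm (?c n * complex_of_real (q ^ n)))"
      by (rule summable_mult[OF rapidly_decaying_summable[OF rapidly_decaying_mult[OF c rapidly_decaying_geometric[OF q(1,2)]]]])
    show "?f n \<in> borel_measurable (lebesgue_on {0..1})" for n
      by (intro borel_measurable_times borel_measurable_powr_lebesgue_on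
          continuous_imp_measurable_on_sets_lebesgue continuous_intros ck cw) auto
    show "norm (?f n u) \<le> M * norm (?c n * complex_of_real (q ^ n)) * ?d u" if u: "u \<in> {0..1}" for n u
    proof -
      have "norm (w_coord (z u) ^ n) \<le> q ^ n" unfolding norm_power by (intro power_mono q(3) u) simp
      then have "norm (?k u * w_coord (z u) ^ n) \<le> M * q ^ n"
        unfolding norm_mult by (intro mult_mono M u M0) auto
      then have "norm (?c n) * norm (?k u * w_coord (z u) ^ n) \<le> norm (?c n) * (M * q ^ n)"
        by (rule mult_left_mono) simp
      then have "norm (?c n) * norm (?k u * w_coord (z u) ^ n) * ?d u \<le> (norm (?c n) * (M * q ^ n)) * ?d u"
        by (rule mult_right_mono) simp
      moreover have "norm (complex_of_real (?d u)) = ?d u" by (simp only: norm_of_real) simp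
      ultimately show ?thesis using q(1) by (simp add: norm_mult norm_power mult_ac)
    qed
    show "(\<lambda>n. ?f n u) sums (h (z u) * of_real (?d u))" if u: "u \<in> {0..1}" for u
    proof -
      have zm: "z u \<noteq> - \<i>" using zi[OF u] by (metis add.commute add.right_inverse)
      have "(\<lambda>n. ?c n * w_coord (z u) ^ n) sums plus_twist s h (z u)"
        using disc_coeff_sums[OF plus_twist_holomorphic[OF h] norm_w_coord[OF Imz[OF u]], of s]
        by (simp add: plus_coeff_def w_coord_inv_w_coord[OF zm])
      then have S0: "(\<lambda>n. ?k u * (?c n * w_coord (z u) ^ n) * of_real (?d u)) sums (?k u * plus_twist s h (z u) * of_real (?d u))"
        by (intro sums_mult sums_mult2)
      have "- \<i> - z u \<noteq> 0" using zm by (metis eq_iff_diff_eq_0 )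
      then have "?k u * (- \<i> - z u) powr complex_of_real s = 1" by (subst powr_add[symmetric]) simp
      then have e: "?k u * plus_twist s h (z u) = h (z u)"
        unfolding plus_twist_def mult.assoc[symmetric] by simp
      show ?thesis using S0 unfolding e by (simp only: mult_ac)
    qed
  qed auto
  from sums_mult[OF this, of "(- 2 * \<i>) powr complex_of_real s * of_real (Gamma s / (Gamma a * Gamma b))"]
  have S: "(\<lambda>n. (- 2 * \<i>) powr complex_of_real s * of_real (Gamma s / (Gamma a * Gamma b)) * integral {0..1} (?f n)) sums
    ((- 2 * \<i>) powr complex_of_real s * of_real (Gamma s / (Gamma a * Gamma b)) *
      integral {0..1} (\<lambda>u. h (z u) * of_real (?d u)))" .
  have "(- 2 * \<i>) powr complex_of_real s * of_real (Gamma s / (Gamma a * Gamma b)) * integral {0..1} (?f n) =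
      pairing_weight s h n * convolution (kernel_coeff a \<tau>1) (kernel_coeff b \<tau>2) n" for n
  proof -
    have I: "integral {0..1} (?f n) = ?c n * integral {0..1} (\<lambda>u. ?k u * w_coord (z u) ^ n * of_real (?d u))"
      by (subst integral_mult_right[symmetric]) (simp only: mult_ac)
    note K = kernel_convolution_integral[OF ab s \<tau> near, of n]
    have "K * (c * I) = (c * f) * C" if "f * C = K * I" for K c I f C :: complex
    proof -
      have "K * (c * I) = c * (K * I)" by (simp only: mult_ac)
      then show ?thesis unfolding that[symmetric] by (simp only: mult_ac)
    qed
    from this[OF K] show ?thesis unfolding I pairing_weight_def unfolding z_def .
  qed
  with S show ?thesis unfolding z_def by (simp only:)
qed


section \<open>The first formula\<close>

text \<open>On a compact path |w| \<le> q < 1, and the kernel coefficients decay geometrically up to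
  a polynomial factor.\<close>

lemma kernel_family_compact:
  assumes \<gamma>: "continuous_on {0..1} \<gamma>" "\<And>x. x \<in> {0..1} \<Longrightarrow> Im (\<gamma> x) > 0"
    and \<phi>: "continuous_on {0..1} \<phi>" and a: "a > 0"
  obtains \<beta> where "kernel_family {0..1} \<phi> \<gamma> a (\<lambda>_. 1) \<beta>"
proof -
  obtain q where q: "0 \<le> q" "q < 1" "\<And>x. x \<in> {0..1} \<Longrightarrow> norm (w_coord (\<gamma> x)) \<le> q"
    using w_coord_uniform_bound[OF \<gamma>] by blast
  \<comment> \<open>At index 0 the kernel coefficient is its prefactor alone.\<close>
  let ?k = "\<lambda>x. \<phi> x * kernel_coeff a (\<gamma> x) 0"
  have ck: "continuous_on {0..1} ?k" by (intro continuous_intros \<phi> continuous_on_kernel_coeff \<gamma>)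
  obtain M where M: "\<And>x. x \<in> {0..1} \<Longrightarrow> norm (?k x) \<le> M"
    using compact_norm_bound[OF compact_Icc ck] by blast
  have M0: "M \<ge> 0" by (rule order_trans[OF norm_ge_zero M[of 0]]) simp
  let ?\<beta> = "\<lambda>j. (of_real M * binomial_coeff a j) * complex_of_real (q ^ j)"
  have "kernel_family {0..1} \<phi> \<gamma> a (\<lambda>_. 1) ?\<beta>"
  proof
    have "polynomially_bounded (\<lambda>j. of_real M)"
      unfolding polynomially_bounded_def by (intro exI[of _ "norm M"] exI[of _ 0]) simp
    then show "rapidly_decaying ?\<beta>"
      by (intro rapidly_decaying_mult[OF _ rapidly_decaying_geometric[OF q(1,2)]] polynomially_bounded_mult
          polynomially_bounded_binomial_coeff a)
    show "integrable (lebesgue_on {0..1::real}) (\<lambda>_. 1 :: real)"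
      by (rule absolutely_integrable_imp_integrable[OF absolutely_integrable_continuous_real]) auto
    fix x :: real and j assume x: "x \<in> {0..1}"
    have "\<phi> x * kernel_coeff a (\<gamma> x) j = ?k x * (binomial_coeff a j * w_coord (\<gamma> x) ^ j)"
      by (simp add: kernel_coeff_def binomial_coeff_def)
    then have "norm (\<phi> x * kernel_coeff a (\<gamma> x) j) = norm (?k x) * (norm (binomial_coeff a j) * norm (w_coord (\<gamma> x)) ^ j)"
      by (simp only: norm_mult norm_power)
    also have "\<dots> \<le> M * (norm (binomial_coeff a j) * q ^ j)"
      by (intro mult_mono M x mult_left_mono power_mono q(3) M0) auto
    also have "\<dots> = norm (?\<beta> j) * 1" using M0 q(1) by (simp add: norm_mult norm_power)
    finally show "norm (\<phi> x * kernel_coeff a (\<gamma> x) j) \<le> norm (?\<beta> j) * 1" .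
  qed (use \<gamma> \<phi> in auto)
  then show ?thesis by (rule that)
qed

lemma integrable_inverse_square_half_line:
  "integrable (lebesgue_on {1..}) (\<lambda>y::real. y powr (- 2))"
proof (rule absolutely_integrable_imp_integrable[OF nonnegative_absolutely_integrable_1])
  show "(\<lambda>y::real. y powr (- 2)) integrable_on {1..}"
    by (rule has_integral_integrable[OF has_integral_powr_to_inf]) auto
qed auto

text \<open>No q < 1 works on the whole half-line, since w = (y - 1)/(y + 1) tends to 1. The bound
  q^k (1 - q)^m (k + 1)^m \<le> m! with 1 - q \<ge> 1/y gives decay in k at the price of y^m, and
  the decay of \<phi> pays for it.\<close>

lemma kernel_family_half_line:
  assumes \<phi>: "continuous_on {1..} \<phi>" and dec: "\<And>m::nat. \<exists>C. \<forall>y\<ge>1. norm (\<phi> y) * y ^ m \<le> C" and a: "a > 0"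
  obtains \<beta> where "kernel_family {1..} \<phi> (Complex 0) a (\<lambda>y. y powr (- 2)) \<beta>"
proof -
  define q where "q y = (y - 1) / (y + 1)" for y :: real
  \<comment> \<open>The best majorant in y of the index part, with y^2 set aside for the integrable
    y^(-2).\<close>
  define e where "e k = (SUP y\<in>{1..}. norm (\<phi> y) * y ^ 2 * q y ^ k)" for k
  \<comment> \<open>1 - q y = 2/(y + 1) is at least 1/y because y \<ge> 1.\<close>
  have q: "0 \<le> q y" "q y \<le> 1" "1 / y \<le> 1 - q y" if "y \<ge> 1" for y
    using that by (auto simp: q_def field_simps)
  have bound: "\<exists>C\<ge>0. \<forall>y\<ge>1. \<forall>k. norm (\<phi> y) * y ^ 2 * q y ^ k * real (k + 1) ^ m \<le> C" for m
  proof -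
    obtain C where C: "\<And>y. y \<ge> 1 \<Longrightarrow> norm (\<phi> y) * y ^ (m + 2) \<le> C" using dec[of "m + 2"] by blast
    have "0 \<le> norm (\<phi> 1) * 1 ^ (m + 2)" by simp
    also have "\<dots> \<le> C" by (rule C) simp
    finally have C0: "C \<ge> 0" .
    have "norm (\<phi> y) * y ^ 2 * q y ^ k * real (k + 1) ^ m \<le> C * fact m" if y: "y \<ge> 1" for y k
    proof -
      have "q y ^ k * (1 / y) ^ m * real (k + 1) ^ m \<le> q y ^ k * (1 - q y) ^ m * real (k + 1) ^ m"
        using q[OF y] y by (intro mult_right_mono mult_left_mono power_mono) auto
      also have "\<dots> \<le> fact m" by (rule power_mult_power_le) (use q[OF y] in auto)
      finally have "q y ^ k * real (k + 1) ^ m \<le> fact m * y ^ m"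
        using y by (simp add: power_one_over field_simps)
      then have "(norm (\<phi> y) * y ^ 2) * (q y ^ k * real (k + 1) ^ m) \<le> (norm (\<phi> y) * y ^ 2) * (fact m * y ^ m)"
        using y by (intro mult_left_mono) auto
      also have "\<dots> = (norm (\<phi> y) * y ^ (m + 2)) * fact m" by (simp only: power_add mult_ac)
      also have "\<dots> \<le> C * fact m" using C[OF y] by (intro mult_right_mono) auto
      finally show ?thesis by (simp only: mult_ac)
    qed
    moreover have "C * fact m \<ge> 0" using C0 by simp
    ultimately show ?thesis by blast
  qed
  have bdd: "bdd_above ((\<lambda>y. norm (\<phi> y) * y ^ 2 * q y ^ k) ` {1..})" for k
  proof -
    obtain C where "\<forall>y\<ge>1. \<forall>k. norm (\<phi> y) * y ^ 2 * q y ^ k * real (k + 1) ^ 0 \<le> C" using bound[of 0] by blast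
    then show ?thesis by (intro bdd_aboveI2[of _ _ C]) auto
  qed
  have e0: "e k \<ge> 0" for k
    unfolding e_def by (rule cSUP_upper2[OF bdd, of 1]) (auto simp: q_def)
  have rap: "rapidly_decaying (\<lambda>k. complex_of_real (e k))"
    unfolding rapidly_decaying_def
  proof
    fix m
    obtain C where C: "C \<ge> 0" "\<And>y k. y \<ge> 1 \<Longrightarrow> norm (\<phi> y) * y ^ 2 * q y ^ k * real (k + 1) ^ m \<le> C"
      using bound[of m] by blast
    have "e k \<le> C / real (k + 1) ^ m" for k
      unfolding e_def
    proof (rule cSUP_least)
      fix y :: real assume "y \<in> {1..}"
      then have "norm (\<phi> y) * y ^ 2 * q y ^ k * real (k + 1) ^ m \<le> C" using C(2)[of y k] by simp
      then show "norm (\<phi> y) * y ^ 2 * q y ^ k \<le> C / real (k + 1) ^ m"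
        by (subst pos_le_divide_eq) auto
    qed auto
    then have "norm (complex_of_real (e k)) * real (k + 1) ^ m \<le> C" for k
      using e0[of k] by (simp add: pos_le_divide_eq[symmetric] del: of_nat_Suc of_nat_add)
    then show "\<exists>C. \<forall>n. norm (complex_of_real (e n)) * real (n + 1) ^ m \<le> C" by blast
  qed
  let ?\<beta> = "\<lambda>k. binomial_coeff a k * complex_of_real (e k)"
  have "kernel_family {1..} \<phi> (Complex 0) a (\<lambda>y. y powr (- 2)) ?\<beta>"
  proof
    show "rapidly_decaying ?\<beta>" by (rule rapidly_decaying_mult[OF polynomially_bounded_binomial_coeff[OF a] rap])
    show "integrable (lebesgue_on {1..}) (\<lambda>y::real. y powr (- 2))" by (rule integrable_inverse_square_half_line)
    show "continuous_on {1..} (Complex 0)" by (intro continuous_intros)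
    fix y :: real and j assume "y \<in> {1..}"
    then have y: "y \<ge> 1" by simp
    have ye: "Complex 0 y + \<i> = \<i> * complex_of_real (y + 1)" "Complex 0 y - \<i> = \<i> * complex_of_real (y - 1)"
      by (simp_all add: complex_eq_iff)
    have w: "w_coord (Complex 0 y) = complex_of_real (q y)"
      unfolding w_coord_def ye q_def of_real_divide by simp
    have "norm (2 * \<i> / (Complex 0 y + \<i>)) = 2 / (y + 1)"
      using y unfolding ye by (simp add: norm_divide norm_mult del: of_real_add)
    then have p: "norm ((2 * \<i> / (Complex 0 y + \<i>)) powr complex_of_real a) \<le> 1"
      using y a by (simp only: norm_powr_of_real) (auto intro!: powr_le1)
    have "norm (\<phi> y * kernel_coeff a (Complex 0 y) j) =
        norm ((2 * \<i> / (Complex 0 y + \<i>)) powr complex_of_real a) * (norm (\<phi> y) * (norm (binomial_coeff a j) * q y ^ j))"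
      unfolding kernel_coeff_def w using q(1)[OF y] by (simp add: norm_mult norm_power)
    also have "\<dots> \<le> 1 * (norm (\<phi> y) * (norm (binomial_coeff a j) * q y ^ j))"
      using p q(1)[OF y] by (intro mult_right_mono) auto
    also have "\<dots> = norm (binomial_coeff a j) * (norm (\<phi> y) * y ^ 2 * q y ^ j) * y powr (- 2)"
      using y by (simp add: powr_minus powr_numeral)
    also have "\<dots> \<le> norm (binomial_coeff a j) * e j * y powr (- 2)"
      unfolding e_def using y by (intro mult_right_mono mult_left_mono cSUP_upper bdd) auto
    also have "\<dots> = norm (?\<beta> j) * y powr (- 2)" using e0 by (simp add: norm_mult)
    finally show "norm (\<phi> y * kernel_coeff a (Complex 0 y) j) \<le> norm (?\<beta> j) * y powr (- 2)" .
  qed (use \<phi> in auto)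
  then show ?thesis by (rule that)
qed

lemma cusp_form_decay:
  assumes f: "f \<in> cusp_forms r v"
  shows "\<exists>C. \<forall>y\<ge>1. norm (f (Complex 0 y)) * y ^ m \<le> C"
proof -
  have hol: "f holomorphic_on upper_half_plane"
    and O': "\<forall>a>0. f \<in> O[filtercomap Im at_top](\<lambda>z. complex_of_real (Im z powr (- a)))"
    using f by (auto simp: cusp_forms_def modular_forms_def automorphic_forms_def)
  \<comment> \<open>One order more than m, because the decay condition is stated for positive
    exponents and m may be 0.\<close>
  have O: "f \<in> O[filtercomap Im at_top](\<lambda>z. complex_of_real (Im z powr (- real (m + 1))))"
    by (rule O'[rule_format]) simp
  obtain c where c: "c > 0" "\<forall>\<^sub>F z in filtercomap Im at_top. norm (f z) \<le> c * norm (complex_of_real (Im z powr (- real (m + 1))))"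
    using landau_o.bigE[OF O] by blast
  then obtain Y where Y: "\<And>z. Im z \<ge> Y \<Longrightarrow> norm (f z) \<le> c * norm (complex_of_real (Im z powr (- real (m + 1))))"
    unfolding eventually_filtercomap_at_top_linorder by blast
  have cont: "continuous_on {1..max 1 Y} (\<lambda>y. norm (f (Complex 0 y)) * y ^ m)"
    by (intro continuous_intros continuous_on_compose2[OF holomorphic_on_imp_continuous_on[OF hol]])
       (auto simp: upper_half_plane_def)
  obtain B where B: "\<And>y. y \<in> {1..max 1 Y} \<Longrightarrow> norm (f (Complex 0 y)) * y ^ m \<le> B"
    using continuous_attains_sup[OF compact_Icc _ cont] by fastforce
  have "norm (f (Complex 0 y)) * y ^ m \<le> max B c" if y: "y \<ge> 1" for y
  proof (cases "y \<le> Y")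
    case True
    then show ?thesis using B[of y] y by (simp add: le_max_iff_disj)
  next
    case False
    then have "norm (f (Complex 0 y)) \<le> c * y powr (- real (m + 1))" using Y[of "Complex 0 y"] by simp
    then have "norm (f (Complex 0 y)) * y ^ m \<le> c * y powr (- real (m + 1)) * y ^ m"
      using y by (intro mult_right_mono) auto
    also have "\<dots> = c * (y powr (- real (m + 1)) * y powr real m)" using y by (simp add: powr_realpow)
    also have "y powr (- real (m + 1)) * y powr real m = y powr (- 1)" by (simp add: powr_add[symmetric])
    also have "c * y powr (- 1) \<le> c * 1" using y c(1) by (intro mult_left_mono) (auto simp: powr_minus field_simps)
    finally show ?thesis by (simp add: le_max_iff_disj)
  qed
  then show ?thesis by blast
qed

section \<open>The arc from rho - 1 to rho\<close>

lemma rho_eq: "rho = Complex (1 / 2) (sqrt 3 / 2)"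
proof -
  have "rho = cis (pi / 3)" by (simp add: rho_def cis_conv_exp mult.commute)
  then show ?thesis by (simp add: complex_eq_iff cos_60 sin_60)
qed

lemma geodesic_path_rho: "geodesic_path (rho - 1) rho = part_circlepath 0 1 (2 * pi / 3) (pi / 3)"
proof -
  have n: "norm rho = 1" "norm (rho - 1) = 1"
    by (simp_all add: rho_eq cmod_def power_divide)
  have A1: "Arg rho = pi / 3" by (rule cis_Arg_unique) (auto simp: rho_eq sgn_eq n complex_eq_iff cos_60 sin_60 cmod_def power_divide)
  have A2: "Arg (rho - 1) = 2 * pi / 3"
    by (rule cis_Arg_unique) (auto simp: rho_eq sgn_eq complex_eq_iff cos_120 sin_120 cmod_def power_divide)
  show ?thesis by (simp add: geodesic_path_def geodesic_center_def n A1 A2)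
qed

lemma arc_rho:
  assumes "x \<in> {0..1}"
  shows "Im (geodesic_path (rho - 1) rho x) > 0" "norm (geodesic_path (rho - 1) rho x) = 1"
proof -
  let ?\<theta> = "linepath (2 * pi / 3) (pi / 3) x"
  have \<theta>: "?\<theta> = 2 * pi / 3 - x * (pi / 3)" by (simp add: linepath_def field_simps)
  have eq: "geodesic_path (rho - 1) rho x = cis ?\<theta>"
    unfolding geodesic_path_rho by (simp add: part_circlepath_def cis_conv_exp)
  have "x * (pi / 3) \<le> 1 * (pi / 3)" "0 \<le> x * (pi / 3)" using assms by (intro mult_right_mono, auto)
  then have "0 < ?\<theta>" "?\<theta> < pi" unfolding \<theta> using pi_gt_zero by linarith+
  then show "Im (geodesic_path (rho - 1) rho x) > 0" unfolding eq by (simp add: sin_gt_zero)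
  show "norm (geodesic_path (rho - 1) rho x) = 1" unfolding eq by simp
qed

text \<open>|i y - \<tau>|^2 = 1 + y^2 - 2 y Im \<tau> for |\<tau>| = 1, which is below (y + 1)^2.
  This position of arc and half-line supplies the convergence condition of Feynman's
  formula.\<close>

lemma near_arc_half_line:
  assumes "norm \<tau> = 1" "Im \<tau> > 0" "y \<ge> 1"
  shows "norm ((Complex 0 y - \<tau>) / (Complex 0 y + \<i>)) < 1"
proof -
  have "(Re \<tau>)\<^sup>2 + (Im \<tau>)\<^sup>2 = 1" using assms(1) cmod_power2[of \<tau>] by simp
  moreover have "0 < y * Im \<tau>" using assms by simp
  ultimately have "(norm (Complex 0 y - \<tau>))\<^sup>2 < (norm (Complex 0 y + \<i>))\<^sup>2"
    using assms(3) unfolding cmod_power2 by (simp add: power2_eq_square algebra_simps)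
  then have lt: "norm (Complex 0 y - \<tau>) < norm (Complex 0 y + \<i>)" by (rule power2_less_imp_less) simp
  then have "norm (Complex 0 y + \<i>) > 0" by (rule le_less_trans[OF norm_ge_zero])
  with lt show ?thesis by (simp add: norm_divide)
qed

theorem trilinear_form_eq_integral:
  assumes r: "r1 + r2 + r3 = 4" "r1 < 2" "r2 < 2"
    and f1: "f1 \<in> automorphic_forms r1 v1" and f2: "f2 \<in> cusp_forms r2 v2" and f3: "f3 \<in> modular_forms r3 v3"
  shows "trilinear_form r1 r2 f1 f2 f3 =
      (- 2 * \<i>) powr complex_of_real r3 *
      complex_of_real (Gamma r3 / (Gamma (2 - r1) * Gamma (2 - r2))) *
      contour_integral (geodesic_path (rho - 1) rho) (\<lambda>\<tau>1. f1 \<tau>1 *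
        integral_to_cusp \<i> (\<lambda>\<tau>2. f2 \<tau>2 *
          integral {0..1} (\<lambda>u::real. f3 (\<tau>1 + complex_of_real u * (\<tau>2 - \<tau>1)) *
            complex_of_real (u powr (1 - r2) * (1 - u) powr (1 - r1)))))"
proof -
  \<comment> \<open>The kernels are (\<tau> - t)^(-a) and (\<tau> - t)^(-b). Since a + b = r3, the
    twist (i - t)^r3 splits between the two factors of \<open>cp\<close>.\<close>
  define a b where "a = 2 - r1" and "b = 2 - r2"
  have ab: "a > 0" "b > 0" and s: "r3 = a + b" and s': "4 - r1 - r2 = r3" using r by (auto simp: a_def b_def)
  have r3: "r3 > 0" using ab s by simp
  define \<gamma> where "\<gamma> = geodesic_path (rho - 1) rho"
  let ?v = "\<lambda>x. vector_derivative \<gamma> (at x)"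
  define \<phi>1 where "\<phi>1 x = f1 (\<gamma> x) * ?v x" for x
  define \<phi>2 where "\<phi>2 y = \<i> * f2 (Complex 0 y)" for y
  have hol1: "f1 holomorphic_on upper_half_plane" and hol2: "f2 holomorphic_on upper_half_plane"
    and hol3: "f3 holomorphic_on upper_half_plane"
    using f1 f2 f3 by (auto simp: automorphic_forms_def modular_forms_def cusp_forms_def)
  have c\<gamma>: "continuous_on {0..1} \<gamma>"
    unfolding \<gamma>_def geodesic_path_rho using path_part_circlepath[unfolded path_def] by blast
  \<comment> \<open>The derivative of the arc is written out so that continuity of
    \<open>\<phi>1\<close> can be read off.\<close>
  have v: "?v x = \<i> * (of_real (pi / 3) - of_real (2 * pi / 3)) * exp (\<i> * of_real (linepath (2 * pi / 3) (pi / 3) x))" for x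
    unfolding \<gamma>_def geodesic_path_rho by (simp add: vector_derivative_part_circlepath)
  have Im\<gamma>: "Im (\<gamma> x) > 0" "norm (\<gamma> x) = 1" if "x \<in> {0..1}" for x
    using arc_rho[OF that] by (simp_all add: \<gamma>_def)
  have c\<phi>1: "continuous_on {0..1} \<phi>1"
    unfolding \<phi>1_def v
    by (intro continuous_intros continuous_on_compose2[OF holomorphic_on_imp_continuous_on[OF hol1] c\<gamma>])
       (use Im\<gamma> in \<open>auto simp: upper_half_plane_def linepath_def intro!: continuous_intros\<close>)
  have c\<phi>2: "continuous_on {1..} \<phi>2"
    unfolding \<phi>2_def
    by (intro continuous_intros continuous_on_compose2[OF holomorphic_on_imp_continuous_on[OF hol2]])
       (auto simp: upper_half_plane_def)
  obtain \<alpha> where "kernel_family {0..1} \<phi>1 \<gamma> a (\<lambda>_. 1) \<alpha>"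
    using kernel_family_compact[OF c\<gamma> Im\<gamma>(1) c\<phi>1 ab(1)] by blast
  then interpret A: kernel_family "{0..1}" \<phi>1 \<gamma> a "\<lambda>_. 1" \<alpha> .
  have dec: "\<exists>C. \<forall>y\<ge>1. norm (\<phi>2 y) * y ^ m \<le> C" for m
    using cusp_form_decay[OF f2, of m] by (simp add: \<phi>2_def norm_mult)
  obtain \<beta> where "kernel_family {1..} \<phi>2 (Complex 0) b (\<lambda>y. y powr (- 2)) \<beta>"
    using kernel_family_half_line[OF c\<phi>2 dec ab(2)] by blast
  then interpret B: kernel_family "{1..}" \<phi>2 "Complex 0" b "\<lambda>y. y powr (- 2)" \<beta> .
  let ?cp = "cp r1 r2 f1 f2"
  have rapAB: "rapidly_decaying (convolution A.coeff B.coeff)"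
    by (rule rapidly_decaying_convolution[OF A.rapidly_decaying_coeff B.rapidly_decaying_coeff])
  have disc: "minus_disc r3 ?cp \<zeta> = disc_series (convolution A.coeff B.coeff) \<zeta>" if \<zeta>: "norm \<zeta> < 1" for \<zeta>
  proof -
    define t where "t = \<i> * (\<zeta> + 1) / (\<zeta> - 1)"
    have 1: "period_fun r1 f1 (rho - 1) rho t = integral {0..1} (\<lambda>x. \<phi>1 x * (\<gamma> x - t) powr (- complex_of_real a))"
      unfolding period_fun_def contour_integral_integral \<gamma>_def[symmetric] \<phi>1_def
      by (simp add: a_def mult_ac)
    have 2: "period_fun_cusp r2 f2 \<i> t = integral {1..} (\<lambda>y. \<phi>2 y * (Complex 0 y - t) powr (- complex_of_real b))"
      unfolding period_fun_cusp_def integral_to_cusp_def \<phi>2_def by (simp add: b_def mult_ac)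
    have "minus_disc r3 ?cp \<zeta> = (\<i> - t) powr complex_of_real r3 * (period_fun r1 f1 (rho - 1) rho t * period_fun_cusp r2 f2 \<i> t)"
      by (simp add: minus_disc_def minus_twist_def cp_def t_def)
    also have "(\<i> - t) powr complex_of_real r3 = (\<i> - t) powr complex_of_real a * (\<i> - t) powr complex_of_real b"
      by (simp add: s powr_add)
    also have "(\<i> - t) powr complex_of_real a * (\<i> - t) powr complex_of_real b * (period_fun r1 f1 (rho - 1) rho t * period_fun_cusp r2 f2 \<i> t) =
        disc_series A.coeff \<zeta> * disc_series B.coeff \<zeta>"
      unfolding A.disc_series_coeff[OF \<zeta>] B.disc_series_coeff[OF \<zeta>] t_def[symmetric] 1 2 by (simp only: mult_ac)
    also have "\<dots> = disc_series (convolution A.coeff B.coeff) \<zeta>"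
      by (rule disc_series_convolution[symmetric, OF A.rapidly_decaying_coeff B.rapidly_decaying_coeff]) (use \<zeta> in simp)
    finally show ?thesis .
  qed
  have cpD: "?cp \<in> D_infty r3" "minus_coeff r3 ?cp = convolution A.coeff B.coeff"
    by (rule in_D_infty_of_disc_series[OF rapAB disc], assumption)+
  note pb = polynomially_bounded_plus_coeff[OF f3 r3]
  define K where "K = (- 2 * \<i>) powr complex_of_real r3 * complex_of_real (Gamma r3 / (Gamma a * Gamma b))"
  define I where "I \<tau>1 \<tau>2 = integral {0..1} (\<lambda>u::real. f3 (\<tau>1 + complex_of_real u * (\<tau>2 - \<tau>1)) *
            complex_of_real (u powr (b - 1) * (1 - u) powr (a - 1)))" for \<tau>1 \<tau>2
  have "(\<lambda>n. pairing_weight r3 f3 n * convolution A.coeff B.coeff n) sums pairing r3 f3 ?cp"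
    using pairing_sums[OF hol3 r3 pb cpD(1)] unfolding cpD(2) .
  moreover have "(\<lambda>n. pairing_weight r3 f3 n * convolution A.coeff B.coeff n) sums
      integral {0..1} (\<lambda>x. \<phi>1 x * integral {1..} (\<lambda>y. \<phi>2 y * (K * I (\<gamma> x) (Complex 0 y))))"
  proof (rule kernel_families_sums[OF A.kernel_family_axioms B.kernel_family_axioms
        polynomially_bounded_pairing_weight[OF r3 pb]])
    fix x y :: real assume xy: "x \<in> {0..1}" "y \<in> {1..}"
    show "(\<lambda>n. pairing_weight r3 f3 n * convolution (kernel_coeff a (\<gamma> x)) (kernel_coeff b (Complex 0 y)) n) sums
        (K * I (\<gamma> x) (Complex 0 y))"
      unfolding K_def I_def
      by (rule pairing_weight_convolution_sums[OF hol3 pb ab s])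
         (use Im\<gamma>[OF xy(1)] xy near_arc_half_line in auto)
  qed
  ultimately have "pairing r3 f3 ?cp = integral {0..1} (\<lambda>x. \<phi>1 x * integral {1..} (\<lambda>y. \<phi>2 y * (K * I (\<gamma> x) (Complex 0 y))))"
    by (rule sums_unique2)
  also have "\<dots> = K * integral {0..1} (\<lambda>x. \<phi>1 x * integral {1..} (\<lambda>y. \<phi>2 y * I (\<gamma> x) (Complex 0 y)))"
    by (simp add: mult.left_commute[of _ K])
  also have "integral {0..1} (\<lambda>x. \<phi>1 x * integral {1..} (\<lambda>y. \<phi>2 y * I (\<gamma> x) (Complex 0 y))) =
      contour_integral \<gamma> (\<lambda>\<tau>1. f1 \<tau>1 * integral_to_cusp \<i> (\<lambda>\<tau>2. f2 \<tau>2 * I \<tau>1 \<tau>2))"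
    unfolding contour_integral_integral integral_to_cusp_def \<phi>1_def \<phi>2_def by (simp add: mult_ac)
  finally show ?thesis
    unfolding trilinear_form_def s' K_def I_def \<gamma>_def a_def b_def by simp
qed


section \<open>A chart that straightens a geodesic\<close>

definition strip :: "complex set" where
  "strip = {\<omega>. 0 < Im \<omega> \<and> Im \<omega> < pi}"

text \<open>This chart maps the strip onto the upper half-plane and the imaginary axis onto the geodesic
  with centre \<open>x\<close> and radius \<open>R\<close>.\<close>

definition chart :: "real \<Rightarrow> real \<Rightarrow> complex \<Rightarrow> complex" where
  "chart x R \<omega> = of_real x + of_real R * exp \<omega>"

definition chart_inv :: "real \<Rightarrow> real \<Rightarrow> complex \<Rightarrow> complex" where
  "chart_inv x R z = Ln ((z - of_real x) / of_real R)"

definition region :: "real \<Rightarrow> real \<Rightarrow> complex set \<Rightarrow> complex set" where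
  "region x R A = {z \<in> upper_half_plane. chart_inv x R z \<in> A}"

text \<open>In the chart the geodesic is the imaginary axis, so this is C cut along that line with
  the gap J left open.\<close>

definition slit_set :: "complex set \<Rightarrow> real set \<Rightarrow> complex set" where
  "slit_set C J = {\<omega> \<in> C. Re \<omega> \<noteq> 0 \<or> Im \<omega> \<in> J}"

text \<open>The product form describes the side of t1 on which t2 lies without deciding which of the
  two is larger.\<close>

definition beyond :: "real \<Rightarrow> real \<Rightarrow> real set" where
  "beyond t1 t2 = {t. 0 < (t2 - t1) * (t - t1)}"

lemma chart_in_upper_half_plane:
  assumes "R > 0" "\<omega> \<in> strip"
  shows "chart x R \<omega> \<in> upper_half_plane"
  using assms by (auto simp: chart_def upper_half_plane_def strip_def Im_exp intro!: mult_pos_pos sin_gt_zero)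

lemma chart_inv_in_strip:
  assumes "R > 0" "z \<in> upper_half_plane"
  shows "chart_inv x R z \<in> strip"
proof -
  have "Im ((z - of_real x) / of_real R) > 0" using assms by (simp add: upper_half_plane_def)
  moreover from this have "(z - of_real x) / of_real R \<noteq> 0" by auto
  ultimately show ?thesis using Im_Ln_pos_lt by (simp add: chart_inv_def strip_def)
qed

lemma chart_chart_inv:
  assumes "R > 0" "z \<in> upper_half_plane"
  shows "chart x R (chart_inv x R z) = z"
proof -
  have "Im (z - of_real x) > 0" using assms by (simp add: upper_half_plane_def)
  then have "z - of_real x \<noteq> 0" by auto
  then show ?thesis using assms(1) by (simp add: chart_def chart_inv_def)
qed

lemma chart_inv_chart:
  assumes "R > 0" "\<omega> \<in> strip"
  shows "chart_inv x R (chart x R \<omega>) = \<omega>"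
  using assms by (simp add: chart_def chart_inv_def strip_def)

lemma Re_chart_inv:
  assumes "R > 0" "z \<in> upper_half_plane"
  shows "Re (chart_inv x R z) = ln (cmod (z - of_real x) / R)"
proof -
  have "Im (z - of_real x) > 0" using assms by (simp add: upper_half_plane_def)
  then have "z - of_real x \<noteq> 0" by auto
  then show ?thesis using assms(1) by (simp add: chart_inv_def norm_divide)
qed

lemma Re_chart_inv_eq_0_iff:
  assumes "R > 0" "z \<in> upper_half_plane"
  shows "Re (chart_inv x R z) = 0 \<longleftrightarrow> cmod (z - of_real x) = R"
proof -
  have "Im (z - of_real x) > 0" using assms by (simp add: upper_half_plane_def)
  then have "z - of_real x \<noteq> 0" by auto
  then have "cmod (z - of_real x) / R > 0" using assms(1) by simp
  then show ?thesis unfolding Re_chart_inv[OF assms] using assms(1) by auto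
qed

lemma continuous_on_chart: "continuous_on A (chart x R)"
  unfolding chart_def[abs_def] by (intro continuous_intros)

lemma holomorphic_on_chart_inv:
  assumes "R > 0"
  shows "chart_inv x R holomorphic_on upper_half_plane"
  unfolding chart_inv_def[abs_def]
  by (intro holomorphic_intros) (use assms in \<open>auto simp: upper_half_plane_def complex_nonpos_Reals_iff\<close>)

lemma open_upper_half_plane: "open upper_half_plane"
  unfolding upper_half_plane_def by (rule open_halfspace_Im_gt)

lemma convex_upper_half_plane: "convex upper_half_plane"
  unfolding upper_half_plane_def by (rule convex_halfspace_Im_gt)

lemma open_strip: "open strip" and convex_strip: "convex strip"
proof -
  have eq: "strip = {\<omega>. 0 < Im \<omega>} \<inter> {\<omega>. Im \<omega> < pi}" by (auto simp: strip_def)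
  show "open strip" unfolding eq by (intro open_Int open_halfspace_Im_gt open_halfspace_Im_lt)
  show "convex strip" unfolding eq by (intro convex_Int convex_halfspace_Im_gt convex_halfspace_Im_lt)
qed

lemma region_eq_image:
  assumes "R > 0" "A \<subseteq> strip"
  shows "region x R A = chart x R ` A"
proof
  show "region x R A \<subseteq> chart x R ` A"
  proof
    fix z assume z: "z \<in> region x R A"
    then have "z = chart x R (chart_inv x R z)" by (simp add: region_def chart_chart_inv[OF assms(1)])
    then show "z \<in> chart x R ` A" using z unfolding region_def by blast
  qed
  show "chart x R ` A \<subseteq> region x R A"
  proof
    fix z assume "z \<in> chart x R ` A"
    then obtain \<omega> where \<omega>: "\<omega> \<in> A" "z = chart x R \<omega>" by blast
    then have "\<omega> \<in> strip" using assms(2) by blast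
    then show "z \<in> region x R A"
      using \<omega> chart_in_upper_half_plane[OF assms(1)] chart_inv_chart[OF assms(1)] by (simp add: region_def)
  qed
qed

lemma open_region:
  assumes "R > 0" "open A"
  shows "open (region x R A)"
proof -
  have "region x R A = upper_half_plane \<inter> chart_inv x R -` A" by (auto simp: region_def)
  then show ?thesis
    using continuous_open_preimage[OF holomorphic_on_imp_continuous_on[OF holomorphic_on_chart_inv[OF assms(1)]]
        open_upper_half_plane assms(2)] by simp
qed

text \<open>This is why the geodesic is straightened: in the chart the cut domain is starlike, and
  the chart is a homeomorphism.\<close>

lemma simply_connected_region:
  assumes R: "R > 0" and A: "A \<subseteq> strip" and st: "starlike A"
  shows "simply_connected (region x R A)"
proof -
  have "homeomorphism A (region x R A) (chart x R) (chart_inv x R)"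
  proof (rule homeomorphismI)
    show "continuous_on A (chart x R)" by (rule continuous_on_chart)
    show "continuous_on (region x R A) (chart_inv x R)"
      by (rule continuous_on_subset[OF holomorphic_on_imp_continuous_on[OF holomorphic_on_chart_inv[OF R]]])
         (auto simp: region_def)
    show "chart x R ` A \<subseteq> region x R A" by (simp add: region_eq_image[OF R A])
    show "chart_inv x R ` region x R A \<subseteq> A" by (auto simp: region_def)
    show "chart_inv x R (chart x R \<omega>) = \<omega>" if "\<omega> \<in> A" for \<omega>
      by (rule chart_inv_chart[OF R]) (use that A in auto)
    show "chart x R (chart_inv x R z) = z" if "z \<in> region x R A" for z
      by (rule chart_chart_inv[OF R]) (use that in \<open>simp add: region_def\<close>)
  qed
  then have "A homeomorphic region x R A" unfolding homeomorphic_def by blast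
  then show ?thesis using homeomorphic_simply_connected starlike_imp_simply_connected[OF st] by blast
qed

text \<open>Seen from a point of the gap, a point off the axis is reached by a segment that meets
  the axis only at its start; a point on the axis is reached inside J by convexity.\<close>

lemma starlike_slit_set:
  assumes C: "convex C" and J: "convex J" and m: "Complex 0 m \<in> C" "m \<in> J"
  shows "starlike (slit_set C J)"
  unfolding starlike_def
proof (intro bexI ballI subsetI)
  show "Complex 0 m \<in> slit_set C J" using m by (simp add: slit_set_def)
  fix \<omega> z assume \<omega>: "\<omega> \<in> slit_set C J" and z: "z \<in> closed_segment (Complex 0 m) \<omega>"
  obtain u where u: "0 \<le> u" "u \<le> 1" "z = (1 - u) *\<^sub>R Complex 0 m + u *\<^sub>R \<omega>"
    using z by (auto simp: closed_segment_def)
  have "z \<in> C" using closed_segment_subset[OF m(1) _ C, of \<omega>] \<omega> z by (auto simp: slit_set_def)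
  moreover have "Re z \<noteq> 0 \<or> Im z \<in> J"
  proof (cases "Re \<omega> = 0 \<or> u = 0")
    case False
    then show ?thesis by (simp add: u(3))
  next
    case True
    then have "u = 0 \<or> Im \<omega> \<in> J" using \<omega> by (auto simp: slit_set_def)
    then have "(1 - u) *\<^sub>R m + u *\<^sub>R Im \<omega> \<in> J"
      using m(2) convexD_alt[OF J m(2) _ u(1,2), of "Im \<omega>"] by (cases "u = 0") auto
    then show ?thesis by (simp add: u(3))
  qed
  ultimately show "z \<in> slit_set C J" by (simp add: slit_set_def)
qed

lemma open_slit_set:
  assumes "open C" "open J"
  shows "open (slit_set C J)"
proof -
  have "slit_set C J = C \<inter> (Re -` (- {0}) \<union> Im -` J)" by (auto simp: slit_set_def)
  then show ?thesis using assms
    by (auto intro!: open_Int open_Un open_vimage continuous_intros)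
qed

lemma beyond_eq: "beyond t1 t2 = (if t1 < t2 then {t1<..} else if t2 < t1 then {..<t1} else {})"
proof -
  consider "t1 < t2" | "t2 < t1" | "t1 = t2" by linarith
  then show ?thesis by cases (auto simp: beyond_def zero_less_mult_iff)
qed

lemma beyond_Int: "beyond t1 t2 \<inter> beyond t2 t1 = open_segment t1 t2"
  unfolding beyond_eq open_segment_eq_real_ivl by auto

lemma convex_beyond: "convex (beyond t1 t2)" and open_beyond: "open (beyond t1 t2)"
  unfolding beyond_eq by auto

section \<open>The domain cut along the ends of a geodesic\<close>

text \<open>The case of a half-circle; vertical lines, for which the chart has no centre, are
  excluded.\<close>

locale geodesic_arc =
  fixes \<tau>1 \<tau>2 :: complex
  assumes \<tau>1: "Im \<tau>1 > 0" and \<tau>2: "Im \<tau>2 > 0" and Re_neq: "Re \<tau>1 \<noteq> Re \<tau>2"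
begin

definition centre :: real where "centre = geodesic_center \<tau>1 \<tau>2"
definition radius :: real where "radius = cmod (\<tau>1 - centre)"
definition t1 :: real where "t1 = Arg (\<tau>1 - centre)"
definition t2 :: real where "t2 = Arg (\<tau>2 - centre)"

lemma Im_sub: "Im (\<tau>1 - centre) > 0" "Im (\<tau>2 - centre) > 0"
  using \<tau>1 \<tau>2 by auto

lemma radius_pos: "radius > 0"
proof -
  have "\<tau>1 - complex_of_real centre \<noteq> 0" using Im_sub(1) by (metis less_irrefl zero_complex.sel(2))
  then show ?thesis by (simp add: radius_def)
qed

lemma radius_eq: "cmod (\<tau>2 - centre) = radius"
proof -
  have "2 * (Re \<tau>2 - Re \<tau>1) * centre = (cmod \<tau>2)\<^sup>2 - (cmod \<tau>1)\<^sup>2"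
    using Re_neq by (simp add: centre_def geodesic_center_def)
  then have "(cmod (\<tau>2 - centre))\<^sup>2 = (cmod (\<tau>1 - centre))\<^sup>2"
    unfolding cmod_power2 by (simp add: power2_eq_square algebra_simps)
  then show ?thesis unfolding radius_def by (rule power2_eq_imp_eq) auto
qed

lemma chart_inv_ends:
  "chart_inv centre radius \<tau>1 = Complex 0 t1" "chart_inv centre radius \<tau>2 = Complex 0 t2"
proof -
  have polar: "chart_inv centre radius \<tau> = Complex 0 (Arg (\<tau> - complex_of_real centre))"
    if "Im (\<tau> - complex_of_real centre) > 0" "cmod (\<tau> - complex_of_real centre) = radius" for \<tau>
  proof -
    have nz: "\<tau> - complex_of_real centre \<noteq> 0" using that(1) by (metis less_irrefl zero_complex.sel(2))
    have "Re (chart_inv centre radius \<tau>) = 0"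
      using Re_chart_inv_eq_0_iff[OF radius_pos, of \<tau> centre] that by (simp add: upper_half_plane_def)
    moreover have "Im (chart_inv centre radius \<tau>) = Arg (\<tau> - centre)"
      unfolding chart_inv_def using nz radius_pos
      by (subst Arg_eq_Im_Ln[symmetric]) (auto simp: Arg_divide_of_real)
    ultimately show ?thesis by (simp add: complex_eq_iff)
  qed
  show "chart_inv centre radius \<tau>1 = Complex 0 t1"
    unfolding t1_def by (rule polar[OF Im_sub(1)]) (simp add: radius_def)
  show "chart_inv centre radius \<tau>2 = Complex 0 t2"
    unfolding t2_def by (rule polar[OF Im_sub(2) radius_eq])
qed

lemma upper: "\<tau>1 \<in> upper_half_plane" "\<tau>2 \<in> upper_half_plane"
  using \<tau>1 \<tau>2 by (auto simp: upper_half_plane_def)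

lemma t_bounds: "0 < t1" "t1 < pi" "0 < t2" "t2 < pi"
  using chart_inv_in_strip[OF radius_pos upper(1), of centre] chart_inv_in_strip[OF radius_pos upper(2), of centre]
  unfolding chart_inv_ends by (auto simp: strip_def)

lemma t_neq: "t1 \<noteq> t2"
proof
  assume "t1 = t2"
  then have "chart centre radius (chart_inv centre radius \<tau>1) = chart centre radius (chart_inv centre radius \<tau>2)"
    unfolding chart_inv_ends by simp
  then show False using Re_neq by (simp add: chart_chart_inv[OF radius_pos] upper)
qed

text \<open>Cut only along the end of the geodesic from \<tau>1 away from \<tau>2. The set is open
  and contains \<tau>2, so the power that is singular at \<tau>1 is holomorphic near \<tau>2; the
  limit of the primitive there depends on this.\<close>

definition slit :: "complex set" where
  "slit = region centre radius (slit_set strip (beyond t1 t2))"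

definition gap :: "complex set" where
  "gap = region centre radius (slit_set strip (open_segment t1 t2))"

lemma mid_in_open_segment: "(t1 + t2) / 2 \<in> open_segment t1 t2"
  using t_neq by (auto simp: open_segment_eq_real_ivl)

lemma starlike_slit: "starlike (slit_set strip (beyond t1 t2))"
  by (rule starlike_slit_set[OF convex_strip convex_beyond, of "(t1 + t2) / 2"])
     (use t_bounds mid_in_open_segment beyond_Int[of t1 t2] in \<open>auto simp: strip_def\<close>)

lemma starlike_gap: "starlike (slit_set strip (open_segment t1 t2))"
  by (rule starlike_slit_set[OF convex_strip convex_open_segment, of "(t1 + t2) / 2"])
     (use t_bounds mid_in_open_segment in \<open>auto simp: strip_def\<close>)

lemma slit: "open slit" "simply_connected slit"
  unfolding slit_def
  by (intro open_region radius_pos open_slit_set open_strip open_beyond)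
     (rule simply_connected_region[OF radius_pos _ starlike_slit], auto simp: slit_set_def)

lemma gap: "open gap" "simply_connected gap"
  unfolding gap_def
proof -
  have "open (open_segment t1 t2)" by (auto simp: open_segment_eq_real_ivl)
  then show "open (region centre radius (slit_set strip (open_segment t1 t2)))"
    by (intro open_region radius_pos open_slit_set open_strip)
  show "simply_connected (region centre radius (slit_set strip (open_segment t1 t2)))"
    by (rule simply_connected_region[OF radius_pos _ starlike_gap]) (auto simp: slit_set_def)
qed

lemma gap_subset_upper: "gap \<subseteq> upper_half_plane" by (auto simp: gap_def region_def)

lemma slit_subset_upper: "slit \<subseteq> upper_half_plane" by (auto simp: slit_def region_def)

lemma \<tau>1_notin_slit: "\<tau>1 \<notin> slit"
  by (simp add: slit_def region_def chart_inv_ends slit_set_def beyond_def)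

lemma \<tau>2_in_slit: "\<tau>2 \<in> slit"
  using t_neq t_bounds by (auto simp: slit_def region_def chart_inv_ends slit_set_def beyond_def strip_def upper zero_less_mult_iff)

lemma gap_subset_slit: "gap \<subseteq> slit"
  using beyond_Int[of t1 t2] by (auto simp: slit_def gap_def region_def slit_set_def)

lemma cut_domain_iff:
  assumes z: "z \<in> upper_half_plane"
  shows "z \<in> cut_domain \<tau>1 \<tau>2 \<longleftrightarrow>
    Re (chart_inv centre radius z) \<noteq> 0 \<or> Im (chart_inv centre radius z) \<in> closed_segment t1 t2"
proof -
  have line: "z \<in> geodesic_line \<tau>1 \<tau>2 \<longleftrightarrow> Re (chart_inv centre radius z) = 0"
    using Re_neq z Re_chart_inv_eq_0_iff[OF radius_pos z, of centre]
    by (simp add: geodesic_line_def Let_def centre_def[symmetric] radius_def)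
  have seg: "geodesic_segment \<tau>1 \<tau>2 = {chart centre radius (Complex 0 t) | t. t \<in> closed_segment t1 t2}"
    using Re_neq
    by (auto simp: geodesic_segment_def geodesic_path_def Let_def centre_def[symmetric] radius_def[symmetric]
        t1_def[symmetric] t2_def[symmetric] path_image_part_circlepath' chart_def Complex_eq cis_conv_exp)
  have "z \<in> geodesic_segment \<tau>1 \<tau>2 \<longleftrightarrow>
      Re (chart_inv centre radius z) = 0 \<and> Im (chart_inv centre radius z) \<in> closed_segment t1 t2"
  proof
    assume "z \<in> geodesic_segment \<tau>1 \<tau>2"
    then obtain t where t: "t \<in> closed_segment t1 t2" "z = chart centre radius (Complex 0 t)"
      unfolding seg by blast
    have "Complex 0 t \<in> strip"
      using t(1) t_bounds by (auto simp: strip_def closed_segment_eq_real_ivl split: if_splits)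
    then show "Re (chart_inv centre radius z) = 0 \<and> Im (chart_inv centre radius z) \<in> closed_segment t1 t2"
      unfolding t(2) chart_inv_chart[OF radius_pos \<open>Complex 0 t \<in> strip\<close>] using t(1) by simp
  next
    assume *: "Re (chart_inv centre radius z) = 0 \<and> Im (chart_inv centre radius z) \<in> closed_segment t1 t2"
    then have "chart_inv centre radius z = Complex 0 (Im (chart_inv centre radius z))"
      by (simp add: complex_eq_iff)
    then have "z = chart centre radius (Complex 0 (Im (chart_inv centre radius z)))"
      using chart_chart_inv[OF radius_pos z, of centre] by metis
    then show "z \<in> geodesic_segment \<tau>1 \<tau>2" unfolding seg using * by blast
  qed
  then show ?thesis using z line by (auto simp: cut_domain_def)
qed

lemma cut_domain_minus_ends: "cut_domain \<tau>1 \<tau>2 - {\<tau>1, \<tau>2} = gap"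
proof -
  have "z \<in> cut_domain \<tau>1 \<tau>2 - {\<tau>1, \<tau>2} \<longleftrightarrow> z \<in> gap" if z: "z \<in> upper_half_plane" for z
  proof -
    let ?c = "chart_inv centre radius"
    have ends: "?c z = Complex 0 t1 \<longleftrightarrow> z = \<tau>1" "?c z = Complex 0 t2 \<longleftrightarrow> z = \<tau>2"
      using chart_inv_ends chart_chart_inv[OF radius_pos z, of centre]
        chart_chart_inv[OF radius_pos upper(1), of centre] chart_chart_inv[OF radius_pos upper(2), of centre] by metis+
    have strip: "?c z \<in> strip" by (rule chart_inv_in_strip[OF radius_pos z])
    show ?thesis
      using z cut_domain_iff[OF z] ends strip
      by (auto simp: gap_def region_def slit_set_def open_segment_def complex_eq_iff)
  qed
  moreover have "cut_domain \<tau>1 \<tau>2 - {\<tau>1, \<tau>2} \<subseteq> upper_half_plane" by (auto simp: cut_domain_def)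
  ultimately show ?thesis using gap_subset_upper by blast
qed

lemma ends_in_cut_domain: "\<tau>1 \<in> cut_domain \<tau>1 \<tau>2" "\<tau>2 \<in> cut_domain \<tau>1 \<tau>2"
  using cut_domain_iff[OF upper(1)] cut_domain_iff[OF upper(2)] by (simp_all add: chart_inv_ends)

lemma cut_domain_minus_left: "cut_domain \<tau>1 \<tau>2 - {\<tau>1} = insert \<tau>2 gap"
  using cut_domain_minus_ends ends_in_cut_domain Re_neq by blast

lemma cut_domain_subset_slit: "cut_domain \<tau>1 \<tau>2 - {\<tau>1} \<subseteq> slit"
  unfolding cut_domain_minus_left using \<tau>2_in_slit gap_subset_slit by blast

text \<open>A chord lies strictly inside its circle: |z - c|^2 = R^2 - u (1 - u) |\<tau>1 -
  \<tau>2|^2. So it avoids the geodesic line.\<close>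

lemma open_segment_subset_gap: "open_segment \<tau>1 \<tau>2 \<subseteq> gap"
proof
  fix z assume "z \<in> open_segment \<tau>1 \<tau>2"
  then obtain u where u: "0 < u" "u < 1" "z = (1 - u) *\<^sub>R \<tau>1 + u *\<^sub>R \<tau>2" by (auto simp: in_segment)
  have z: "z \<in> upper_half_plane"
    using convexD_alt[OF convex_upper_half_plane upper, of u] u by simp
  let ?A = "\<tau>1 - complex_of_real centre" and ?B = "\<tau>2 - complex_of_real centre"
  have zc: "z - complex_of_real centre = (1 - u) *\<^sub>R ?A + u *\<^sub>R ?B" by (simp add: u(3) algebra_simps scaleR_conv_of_real)
  have A: "(Re ?A)\<^sup>2 + (Im ?A)\<^sup>2 = radius\<^sup>2" and B: "(Re ?B)\<^sup>2 + (Im ?B)\<^sup>2 = radius\<^sup>2"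
    using radius_eq unfolding cmod_power2[symmetric] by (simp_all add: radius_def)
  have alg: "((1 - u) * p + u * r)\<^sup>2 + ((1 - u) * q + u * s)\<^sup>2 = R2 - u * (1 - u) * ((p - r)\<^sup>2 + (q - s)\<^sup>2)"
    if "p\<^sup>2 + q\<^sup>2 = R2" "r\<^sup>2 + s\<^sup>2 = R2" for p q r s R2 :: real
  proof -
    have "((1 - u) * p + u * r)\<^sup>2 + ((1 - u) * q + u * s)\<^sup>2 =
        (1 - u)\<^sup>2 * (p\<^sup>2 + q\<^sup>2) + u\<^sup>2 * (r\<^sup>2 + s\<^sup>2) + 2 * u * (1 - u) * (p * r + q * s)"
      by (simp add: power2_eq_square algebra_simps)
    moreover have "(p - r)\<^sup>2 + (q - s)\<^sup>2 = (p\<^sup>2 + q\<^sup>2) + (r\<^sup>2 + s\<^sup>2) - 2 * (p * r + q * s)"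
      by (simp add: power2_eq_square algebra_simps)
    ultimately show ?thesis unfolding that by (simp add: power2_eq_square algebra_simps)
  qed
  have "(cmod (z - complex_of_real centre))\<^sup>2 = radius\<^sup>2 - u * (1 - u) * ((Re ?A - Re ?B)\<^sup>2 + (Im ?A - Im ?B)\<^sup>2)"
    unfolding zc cmod_power2 using alg[OF A B] by simp
  moreover have "u * (1 - u) * ((Re ?A - Re ?B)\<^sup>2 + (Im ?A - Im ?B)\<^sup>2) > 0"
    using u Re_neq by (intro mult_pos_pos sum_power2_gt_zero_iff[THEN iffD2]) auto
  ultimately have "cmod (z - complex_of_real centre) \<noteq> radius" by auto
  then have "Re (chart_inv centre radius z) \<noteq> 0" using Re_chart_inv_eq_0_iff[OF radius_pos z] by simp
  then show "z \<in> gap"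
    using z chart_inv_in_strip[OF radius_pos z] by (simp add: gap_def region_def slit_set_def)
qed

text \<open>The set is not open, since it contains \<tau>2 at the tip of a cut. It lies between the
  connected \<open>gap\<close> and its closure.\<close>

lemma connected_cut_domain_minus_left: "connected (cut_domain \<tau>1 \<tau>2 - {\<tau>1})"
proof (rule connected_intermediate_closure)
  show "connected gap" using gap(2) by (rule simply_connected_imp_connected)
  show "gap \<subseteq> cut_domain \<tau>1 \<tau>2 - {\<tau>1}" unfolding cut_domain_minus_left by blast
  have "\<tau>2 \<in> closure (open_segment \<tau>1 \<tau>2)" using Re_neq by (auto simp: closure_open_segment)
  then have "\<tau>2 \<in> closure gap" using closure_mono[OF open_segment_subset_gap] by blast
  then show "cut_domain \<tau>1 \<tau>2 - {\<tau>1} \<subseteq> closure gap"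
    unfolding cut_domain_minus_left using closure_subset by blast
qed

end

text \<open>By this symmetry everything shown at \<tau>1 can be used at \<tau>2.\<close>

lemma geodesic_arc_swap:
  assumes "geodesic_arc \<tau>1 \<tau>2"
  shows "geodesic_arc \<tau>2 \<tau>1" "cut_domain \<tau>2 \<tau>1 = cut_domain \<tau>1 \<tau>2" "geodesic_arc.gap \<tau>2 \<tau>1 = geodesic_arc.gap \<tau>1 \<tau>2"
proof -
  interpret A: geodesic_arc \<tau>1 \<tau>2 by fact
  show B: "geodesic_arc \<tau>2 \<tau>1" using A.\<tau>1 A.\<tau>2 A.Re_neq by unfold_locales auto
  then interpret B: geodesic_arc \<tau>2 \<tau>1 .
  have "geodesic_center \<tau>2 \<tau>1 = geodesic_center \<tau>1 \<tau>2"
    unfolding geodesic_center_def using A.Re_neq by (simp add: divide_simps) (simp add: algebra_simps)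
  then have c: "B.centre = A.centre" by (simp add: A.centre_def B.centre_def)
  have r: "B.radius = A.radius" using A.radius_eq by (simp add: B.radius_def c)
  have t: "B.t1 = A.t2" "B.t2 = A.t1" by (simp_all add: A.t1_def A.t2_def B.t1_def B.t2_def c)
  have "z \<in> cut_domain \<tau>2 \<tau>1 \<longleftrightarrow> z \<in> cut_domain \<tau>1 \<tau>2" if "z \<in> upper_half_plane" for z
    using A.cut_domain_iff[OF that] B.cut_domain_iff[OF that] unfolding c r t by (simp add: closed_segment_commute)
  then show "cut_domain \<tau>2 \<tau>1 = cut_domain \<tau>1 \<tau>2" by (auto simp: cut_domain_def)
  then show "B.gap = A.gap"
    using A.cut_domain_minus_ends B.cut_domain_minus_ends by (simp add: insert_commute)
qed


section \<open>Branches of powers\<close>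

text \<open>The values lie in the discrete set of multiples of 2 pi i; 1 is a convenient lower bound
  for its gaps.\<close>

lemma exp_eq_1_on_connected:
  fixes d :: "'a::topological_space \<Rightarrow> complex"
  assumes "connected S" "continuous_on S d" "\<And>x. x \<in> S \<Longrightarrow> exp (d x) = 1" "S \<noteq> {}"
  obtains c where "exp c = 1" "\<And>x. x \<in> S \<Longrightarrow> d x = c"
proof -
  have "d constant_on S"
  proof (rule continuous_discrete_range_constant[OF assms(1,2)])
    fix x assume x: "x \<in> S"
    show "\<exists>e>0. \<forall>y. y \<in> S \<and> d y \<noteq> d x \<longrightarrow> e \<le> norm (d y - d x)"
    proof (intro exI[of _ 1] conjI allI impI)
      fix y assume y: "y \<in> S \<and> d y \<noteq> d x"
      have "exp (d y - d x) = 1" using assms(3) x y by (simp add: exp_diff)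
      then obtain n :: int where n: "Re (d y - d x) = 0" "Im (d y - d x) = of_int (2 * n) * pi"
        unfolding exp_eq_1 by blast
      then have "n \<noteq> 0" using y by (auto simp: complex_eq_iff)
      then have "1 \<le> \<bar>real_of_int (2 * n)\<bar>" by linarith
      then have "1 * 1 \<le> \<bar>real_of_int (2 * n)\<bar> * pi" using pi_gt3 by (intro mult_mono) auto
      also have "\<dots> = \<bar>Im (d y - d x)\<bar>" unfolding n(2) abs_mult by simp
      also have "\<dots> \<le> norm (d y - d x)" by (rule abs_Im_le_cmod)
      finally show "1 \<le> norm (d y - d x)" by simp
    qed simp
  qed
  then obtain c where c: "\<And>x. x \<in> S \<Longrightarrow> d x = c" unfolding constant_on_def by blast
  moreover obtain x where "x \<in> S" using assms(4) by blast
  ultimately have "exp c = 1" using assms(3) by metis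
  then show ?thesis using c by (rule that)
qed

text \<open>The condition in \<open>branch_power\<close> fixes the power but not the logarithm. Two
  logarithms differ by a constant c with exp c = 1, and positivity on S makes exp (a c) a positive
  real of modulus 1. D is only assumed connected because the cut domain is not open.\<close>

lemma branch_power_eq:
  assumes D: "connected D" and S: "S \<subseteq> D" "S \<noteq> {}" and L: "L holomorphic_on D"
    and q: "\<And>x. x \<in> D \<Longrightarrow> exp (L x) = q x" and re: "\<And>x. x \<in> S \<Longrightarrow> \<exists>s::real. L x = complex_of_real s"
    and z: "z \<in> D"
  shows "branch_power D S q a z = exp (complex_of_real a * L z)"
  unfolding branch_power_def
proof (rule the_equality)
  have pos: "\<exists>s>0. exp (complex_of_real a * L x) = complex_of_real s" if xS: "x \<in> S" for x
  proof -
    obtain s where "L x = complex_of_real s" using re[OF xS] by blast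
    then have "exp (complex_of_real a * L x) = complex_of_real (exp (a * s))"
      by (simp only: of_real_mult[symmetric] exp_of_real)
    then show ?thesis using exp_gt_zero by blast
  qed
  show "\<exists>L'. L' holomorphic_on D \<and> (\<forall>x\<in>D. exp (L' x) = q x) \<and>
      (\<forall>x\<in>S. \<exists>s>0. exp (complex_of_real a * L' x) = complex_of_real s) \<and>
      exp (complex_of_real a * L z) = exp (complex_of_real a * L' z)"
    by (intro exI[of _ L]) (use L q pos in auto)
  fix y assume "\<exists>L'. L' holomorphic_on D \<and> (\<forall>x\<in>D. exp (L' x) = q x) \<and>
      (\<forall>x\<in>S. \<exists>s>0. exp (complex_of_real a * L' x) = complex_of_real s) \<and>
      y = exp (complex_of_real a * L' z)"
  then obtain L' where L': "L' holomorphic_on D" "\<And>x. x \<in> D \<Longrightarrow> exp (L' x) = q x"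
      "\<And>x. x \<in> S \<Longrightarrow> \<exists>s>0. exp (complex_of_real a * L' x) = complex_of_real s" "y = exp (complex_of_real a * L' z)"
    by blast
  have "exp (L' x - L x) = 1" if "x \<in> D" for x
    using L'(2)[OF that] q[OF that] exp_not_eq_zero[of "L x"] by (simp add: exp_diff)
  then obtain c where c: "exp c = 1" "\<And>x. x \<in> D \<Longrightarrow> L' x - L x = c"
    using exp_eq_1_on_connected[OF D continuous_on_diff[OF holomorphic_on_imp_continuous_on[OF L'(1)]
        holomorphic_on_imp_continuous_on[OF L]]] z by blast
  have L'eq: "L' x = L x + c" if "x \<in> D" for x using c(2)[OF that] by (simp add: algebra_simps)
  obtain x where x: "x \<in> S" using S(2) by blast
  obtain s s' where s: "s > 0" "exp (complex_of_real a * L x) = complex_of_real s"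
    "s' > 0" "exp (complex_of_real a * L' x) = complex_of_real s'"
    using pos[OF x] L'(3)[OF x] by blast
  have "complex_of_real s' = complex_of_real s * exp (complex_of_real a * c)"
    using s L'eq[of x] x S(1) by (auto simp: distrib_left exp_add)
  then have e: "exp (complex_of_real a * c) = complex_of_real (s' / s)" using s(1) by (simp add: field_simps)
  have "Re c = 0" using c(1) unfolding exp_eq_1 by blast
  then have "norm (exp (complex_of_real a * c)) = 1" by simp
  then have "s' / s = 1" unfolding e norm_of_real using s by simp
  then have "exp (complex_of_real a * c) = 1" using e by simp
  then show "y = exp (complex_of_real a * L z)"
    using L'eq[OF z] by (simp add: L'(4) distrib_left exp_add)
qed

context geodesic_arc
begin

lemma neq: "\<tau>2 - \<tau>1 \<noteq> 0" using Re_neq by auto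

lemma segment_point_in_open_segment:
  assumes "0 < u" "u < 1"
  shows "\<tau>1 + complex_of_real u * (\<tau>2 - \<tau>1) \<in> open_segment \<tau>1 \<tau>2"
proof -
  have "\<tau>1 + complex_of_real u * (\<tau>2 - \<tau>1) = (1 - u) *\<^sub>R \<tau>1 + u *\<^sub>R \<tau>2"
    by (simp add: scaleR_conv_of_real algebra_simps)
  then show ?thesis using assms neq by (auto simp: in_segment)
qed

text \<open>A logarithm exists because \<open>slit\<close> is simply connected. On the open
  Euclidean segment it differs from ln u by a constant multiple of 2 pi i, which is subtracted so
  that the branch is real there.\<close>

lemma left_log_exists:
  "\<exists>L. L holomorphic_on slit \<and> (\<forall>z\<in>slit. exp (L z) = (z - \<tau>1) / (\<tau>2 - \<tau>1)) \<and>
    (\<forall>u\<in>{0<..<1}. L (\<tau>1 + complex_of_real u * (\<tau>2 - \<tau>1)) = complex_of_real (ln u))"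
proof -
  let ?q = "\<lambda>z. (z - \<tau>1) / (\<tau>2 - \<tau>1)" and ?p = "\<lambda>u. \<tau>1 + complex_of_real u * (\<tau>2 - \<tau>1)"
  have "?q holomorphic_on slit" by (intro holomorphic_intros) (use neq in auto)
  moreover have "\<forall>z\<in>slit. ?q z \<noteq> 0" using \<tau>1_notin_slit neq by auto
  ultimately have "\<exists>g. g holomorphic_on slit \<and> (\<forall>z\<in>slit. ?q z = exp (g z))"
    by (intro conjunct2[OF iffD1[OF simply_connected_eq_holomorphic_log[OF slit(1)] slit(2)], THEN spec, THEN mp] conjI)
  then obtain L0 where L0': "L0 holomorphic_on slit \<and> (\<forall>z\<in>slit. ?q z = exp (L0 z))" by (rule exE)
  note L0 = conjunct1[OF L0'] bspec[OF conjunct2[OF L0']]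
  have p: "?p u \<in> slit" if "u \<in> {0<..<1}" for u
    by (rule subsetD[OF gap_subset_slit subsetD[OF open_segment_subset_gap segment_point_in_open_segment]])
       (use that in auto)
  have cont: "continuous_on {0<..<1} (\<lambda>u. L0 (?p u) - complex_of_real (ln u))"
    by (intro continuous_intros continuous_on_compose2[OF holomorphic_on_imp_continuous_on[OF L0(1)]])
       (use p in auto)
  have ex: "exp (L0 (?p u) - complex_of_real (ln u)) = 1" if u: "u \<in> {0<..<1}" for u
    using L0(2)[OF p[OF u]] neq u by (simp add: exp_diff exp_of_real)
  have ne: "{0<..<1::real} \<noteq> {}" by simp
  obtain c where c: "exp c = 1" "\<And>u. u \<in> {0<..<1} \<Longrightarrow> L0 (?p u) - complex_of_real (ln u) = c"
    by (rule exp_eq_1_on_connected[OF connected_Ioo cont ex ne]) (assumption | rule that)+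
  show ?thesis
  proof (intro exI[of _ "\<lambda>z. L0 z - c"] conjI ballI)
    show "(\<lambda>z. L0 z - c) holomorphic_on slit" by (intro holomorphic_intros L0)
    show "exp (L0 z - c) = ?q z" if "z \<in> slit" for z using L0(2)[OF that] c(1) by (simp add: exp_diff)
    show "L0 (?p u) - c = complex_of_real (ln u)" if "u \<in> {0<..<1}" for u
      using c(2)[OF that] by (simp add: algebra_simps)
  qed
qed

definition left_log :: "complex \<Rightarrow> complex" where
  "left_log = (SOME L. L holomorphic_on slit \<and> (\<forall>z\<in>slit. exp (L z) = (z - \<tau>1) / (\<tau>2 - \<tau>1)) \<and>
    (\<forall>u\<in>{0<..<1}. L (\<tau>1 + complex_of_real u * (\<tau>2 - \<tau>1)) = complex_of_real (ln u)))"

lemma left_log: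
  "left_log holomorphic_on slit"
  "z \<in> slit \<Longrightarrow> exp (left_log z) = (z - \<tau>1) / (\<tau>2 - \<tau>1)"
  "0 < u \<Longrightarrow> u < 1 \<Longrightarrow> left_log (\<tau>1 + complex_of_real u * (\<tau>2 - \<tau>1)) = complex_of_real (ln u)"
proof -
  have P: "left_log holomorphic_on slit \<and> (\<forall>z\<in>slit. exp (left_log z) = (z - \<tau>1) / (\<tau>2 - \<tau>1)) \<and>
    (\<forall>u\<in>{0<..<1}. left_log (\<tau>1 + complex_of_real u * (\<tau>2 - \<tau>1)) = complex_of_real (ln u))"
    unfolding left_log_def by (rule someI_ex[OF left_log_exists])
  show "left_log holomorphic_on slit" using P by (rule conjunct1)
  show "z \<in> slit \<Longrightarrow> exp (left_log z) = (z - \<tau>1) / (\<tau>2 - \<tau>1)"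
    by (rule bspec[OF conjunct1[OF conjunct2[OF P]]])
  show "0 < u \<Longrightarrow> u < 1 \<Longrightarrow> left_log (\<tau>1 + complex_of_real u * (\<tau>2 - \<tau>1)) = complex_of_real (ln u)"
    by (rule bspec[OF conjunct2[OF conjunct2[OF P]]]) simp
qed

lemma left_log_derivative:
  assumes z: "z \<in> slit"
  shows "(left_log has_field_derivative 1 / (z - \<tau>1)) (at z)"
proof -
  have d: "(left_log has_field_derivative deriv left_log z) (at z)"
    by (rule holomorphic_derivI[OF left_log(1) slit(1) z])
  have "((\<lambda>z. exp (left_log z)) has_field_derivative exp (left_log z) * deriv left_log z) (at z)"
    using d by (auto intro!: derivative_eq_intros)
  then have "((\<lambda>z. (z - \<tau>1) / (\<tau>2 - \<tau>1)) has_field_derivative exp (left_log z) * deriv left_log z) (at z)"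
    by (rule has_field_derivative_transform_within_open[OF _ slit(1) z]) (simp add: left_log(2))
  moreover have "((\<lambda>z. (z - \<tau>1) / (\<tau>2 - \<tau>1)) has_field_derivative 1 / (\<tau>2 - \<tau>1)) (at z)"
    using neq by (auto intro!: derivative_eq_intros)
  ultimately have "(z - \<tau>1) / (\<tau>2 - \<tau>1) * deriv left_log z = 1 / (\<tau>2 - \<tau>1)"
    using DERIV_unique left_log(2)[OF z] by metis
  moreover have "z - \<tau>1 \<noteq> 0" using z \<tau>1_notin_slit by auto
  ultimately have "deriv left_log z = 1 / (z - \<tau>1)" using neq by (simp add: field_simps)
  with d show ?thesis by simp
qed

lemma left_power_eq:
  assumes "z \<in> cut_domain \<tau>1 \<tau>2 - {\<tau>1}"
  shows "left_power \<tau>1 \<tau>2 c z = exp (complex_of_real c * left_log z)"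
  unfolding left_power_def
proof (rule branch_power_eq[OF connected_cut_domain_minus_left _ _ _ _ _ assms])
  show "open_segment \<tau>1 \<tau>2 \<subseteq> cut_domain \<tau>1 \<tau>2 - {\<tau>1}"
    using open_segment_subset_gap unfolding cut_domain_minus_left by blast
  show "open_segment \<tau>1 \<tau>2 \<noteq> {}" using neq by auto
  show "left_log holomorphic_on cut_domain \<tau>1 \<tau>2 - {\<tau>1}"
    by (rule holomorphic_on_subset[OF left_log(1) cut_domain_subset_slit])
  show "exp (left_log x) = (x - \<tau>1) / (\<tau>2 - \<tau>1)" if "x \<in> cut_domain \<tau>1 \<tau>2 - {\<tau>1}" for x
    using left_log(2) that cut_domain_subset_slit by blast
  fix x assume "x \<in> open_segment \<tau>1 \<tau>2"
  then obtain u where u: "0 < u" "u < 1" "x = (1 - u) *\<^sub>R \<tau>1 + u *\<^sub>R \<tau>2" by (auto simp: in_segment)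
  then have "x = \<tau>1 + complex_of_real u * (\<tau>2 - \<tau>1)" by (simp add: scaleR_conv_of_real algebra_simps)
  then show "\<exists>s::real. left_log x = complex_of_real s" using left_log(3)[OF u(1,2)] by blast
qed

end

lemma right_power_eq_left_power:
  assumes "geodesic_arc \<tau>1 \<tau>2"
  shows "right_power \<tau>1 \<tau>2 = left_power \<tau>2 \<tau>1"
proof -
  have "(\<tau>2 - z) / (\<tau>2 - \<tau>1) = (z - \<tau>2) / (\<tau>1 - \<tau>2)" for z
    by (metis minus_diff_eq minus_divide_divide)
  then show ?thesis
    unfolding right_power_def left_power_def geodesic_arc_swap(2)[OF assms] open_segment_commute[of \<tau>2] by simp
qed

section \<open>Primitives near the end points\<close>

text \<open>If h solves this equation, (z - p)^b h is a primitive of (z - p)^(b - 1) K. The equation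
  is solved termwise by division by n + b, which is nonzero as b > 0.\<close>

lemma Euler_equation:
  fixes p :: complex and b :: real
  assumes K: "K holomorphic_on ball p \<epsilon>" and b: "b > 0"
  obtains h h' where "\<And>z. z \<in> ball p \<epsilon> \<Longrightarrow> (h has_field_derivative h' z) (at z)"
    "\<And>z. z \<in> ball p \<epsilon> \<Longrightarrow> (z - p) * h' z + of_real b * h z = K z"
proof -
  define F where "F w = K (p + w)" for w
  have F: "F holomorphic_on ball 0 \<epsilon>"
    unfolding F_def
    by (rule holomorphic_on_compose_gen[OF _ K, of "\<lambda>w. p + w", unfolded o_def])
       (auto intro!: holomorphic_intros simp: dist_norm)
  define c where "c n = disc_coeff F n / (of_nat n + of_real b)" for n
  have nb: "norm (of_nat n + complex_of_real b) = real n + b" "of_nat n + complex_of_real b \<noteq> 0" for n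
  proof -
    have e: "of_nat n + complex_of_real b = complex_of_real (real n + b)" by simp
    show "norm (of_nat n + complex_of_real b) = real n + b" unfolding e norm_of_real using b by simp
    then show "of_nat n + complex_of_real b \<noteq> 0" using b by (metis norm_zero add_nonneg_pos less_irrefl of_nat_0_le_iff)
  qed
  have sc: "summable (\<lambda>n. c n * w ^ n)" if w: "norm w < \<epsilon>" for w :: complex
  proof -
    obtain r where r: "norm w < r" "r < \<epsilon>" using dense[OF w] by blast
    define w' :: complex where "w' = of_real r"
    have "norm w' = r" unfolding w'_def norm_of_real using r(1) norm_ge_zero[of w] by linarith
    then have w': "norm w < norm w'" "norm w' < \<epsilon>" using r by auto
    have "summable (\<lambda>n. norm (disc_coeff F n * w ^ n))"
      by (rule powser_insidea[OF sums_summable[OF disc_coeff_sums[OF F w'(2)]] w'(1)])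
    then have "summable (\<lambda>n. (1 / b) * norm (disc_coeff F n * w ^ n))" by (rule summable_mult)
    then show ?thesis
    proof (rule summable_comparison_test'[where N = 0])
      fix n
      have "norm (c n * w ^ n) = (1 / (real n + b)) * norm (disc_coeff F n * w ^ n)"
        by (simp add: c_def norm_mult norm_divide nb)
      also have "\<dots> \<le> (1 / b) * norm (disc_coeff F n * w ^ n)"
        using b by (intro mult_right_mono divide_left_mono) auto
      finally show "norm (c n * w ^ n) \<le> (1 / b) * norm (disc_coeff F n * w ^ n)" .
    qed
  qed
  define H where "H w = (\<Sum>n. c n * w ^ n)" for w
  define H' where "H' w = (\<Sum>n. diffs c n * w ^ n)" for w
  have dH: "(H has_field_derivative H' w) (at w)" if "norm w < \<epsilon>" for w
    unfolding H_def[abs_def] H'_def by (rule termdiffs_strong'[OF sc that])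
  have eq: "w * H' w + of_real b * H w = F w" if w: "norm w < \<epsilon>" for w
  proof -
    have "summable (\<lambda>n. diffs c n * w ^ n)" by (rule termdiff_converges[OF w sc])
    then have "(\<lambda>n. w * (diffs c n * w ^ n)) sums (w * H' w)" unfolding H'_def by (intro sums_mult summable_sums)
    then have "(\<lambda>n. of_nat (Suc n) * c (Suc n) * w ^ Suc n) sums (w * H' w)"
      by (simp add: diffs_def mult_ac del: of_nat_Suc)
    then have s1: "(\<lambda>n. of_nat n * c n * w ^ n) sums (w * H' w)"
      by (subst (asm) sums_Suc_iff) simp
    have s2: "(\<lambda>n. of_real b * (c n * w ^ n)) sums (of_real b * H w)"
      unfolding H_def by (intro sums_mult summable_sums sc w)
    have "of_nat n * c n * w ^ n + of_real b * (c n * w ^ n) = disc_coeff F n * w ^ n" for n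
    proof -
      have "of_nat n * c n * w ^ n + of_real b * (c n * w ^ n) = ((of_nat n + of_real b) * c n) * w ^ n"
        by (simp only: distrib_right mult.assoc)
      also have "(of_nat n + of_real b) * c n = disc_coeff F n" unfolding c_def using nb(2)[of n] by simp
      finally show ?thesis .
    qed
    then have "(\<lambda>n. disc_coeff F n * w ^ n) sums (w * H' w + of_real b * H w)"
      using sums_add[OF s1 s2] by simp
    then show ?thesis using disc_coeff_sums[OF F w] by (rule sums_unique2)
  qed
  show ?thesis
  proof (rule that[of "\<lambda>z. H (z - p)" "\<lambda>z. H' (z - p)"])
    fix z assume "z \<in> ball p \<epsilon>"
    then have z: "norm (z - p) < \<epsilon>" by (simp add: dist_norm norm_minus_commute)
    show "((\<lambda>z. H (z - p)) has_field_derivative H' (z - p)) (at z)"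
    proof -
      have "((\<lambda>z. z - p) has_field_derivative 1) (at z)" by (auto intro!: derivative_eq_intros)
      then show ?thesis using DERIV_chain2[of H "H' (z - p)" "\<lambda>z. z - p" z 1 UNIV] dH[OF z] by simp
    qed
    show "(z - p) * H' (z - p) + of_real b * H (z - p) = K z" using eq[OF z] by (simp add: F_def)
  qed
qed

context geodesic_arc
begin

text \<open>Near \<tau>1 the function E, a constant multiple of (z - \<tau>1)^b h with h from
  \<open>Euler_equation\<close>, is an explicit primitive, and it tends to 0 since b > 0. On a
  connected piece of \<open>gap\<close> next to \<tau>1 the given primitive differs from E by a
  constant.\<close>

lemma endpoint_limit:
  assumes b: "b > 0" and V: "open V" "\<tau>1 \<in> V" and K: "K holomorphic_on V"
    and \<Phi>: "\<And>z. z \<in> gap \<Longrightarrow> (\<Phi> has_field_derivative exp (complex_of_real (b - 1) * left_log z) * K z) (at z)"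
  shows "\<exists>l. (\<Phi> \<longlongrightarrow> l) (at \<tau>1 within gap)"
proof -
  let ?F = "at \<tau>1 within gap"
  obtain \<epsilon> where \<epsilon>: "\<epsilon> > 0" "ball \<tau>1 \<epsilon> \<subseteq> V" using V open_contains_ball by blast
  obtain h h' where h: "\<And>z. z \<in> ball \<tau>1 \<epsilon> \<Longrightarrow> (h has_field_derivative h' z) (at z)"
    "\<And>z. z \<in> ball \<tau>1 \<epsilon> \<Longrightarrow> (z - \<tau>1) * h' z + of_real b * h z = K z"
    using Euler_equation[OF holomorphic_on_subset[OF K \<epsilon>(2)] b] by blast
  define E where "E z = exp (complex_of_real (b - 1) * left_log z) * ((z - \<tau>1) * h z)" for z
  have dE: "(E has_field_derivative exp (complex_of_real (b - 1) * left_log z) * K z) (at z)"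
    if z: "z \<in> gap" "z \<in> ball \<tau>1 \<epsilon>" for z
  proof -
    have zs: "z \<in> slit" using z gap_subset_slit by blast
    then have nz: "z - \<tau>1 \<noteq> 0" using \<tau>1_notin_slit by auto
    let ?e = "exp (complex_of_real (b - 1) * left_log z)"
    have "(E has_field_derivative (?e * (complex_of_real (b - 1) * (1 / (z - \<tau>1)))) * ((z - \<tau>1) * h z) + (1 * h z + (z - \<tau>1) * h' z) * ?e) (at z)"
      unfolding E_def[abs_def]
      by (rule derivative_eq_intros left_log_derivative[OF zs] h(1)[OF z(2)] refl | simp)+
    moreover have "(?e * (complex_of_real (b - 1) * (1 / (z - \<tau>1)))) * ((z - \<tau>1) * h z) + (1 * h z + (z - \<tau>1) * h' z) * ?e = ?e * K z"
    proof -
      have "(?e * (complex_of_real (b - 1) * (1 / (z - \<tau>1)))) * ((z - \<tau>1) * h z) = ?e * (complex_of_real (b - 1) * h z)"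
        using nz by simp
      then show ?thesis unfolding h(2)[OF z(2), symmetric] by (simp add: algebra_simps)
    qed
    ultimately show ?thesis by simp
  qed
  let ?i = "Complex 0 t1"
  have chart_i: "chart centre radius ?i = \<tau>1"
    using chart_chart_inv[OF radius_pos upper(1), of centre] by (simp add: chart_inv_ends)
  have "isCont (chart centre radius) ?i"
    using continuous_on_chart[of UNIV] by (simp add: continuous_on_eq_continuous_at)
  then obtain \<delta> where \<delta>: "\<delta> > 0" "\<And>\<omega>. dist \<omega> ?i < \<delta> \<Longrightarrow> dist (chart centre radius \<omega>) \<tau>1 < \<epsilon>"
    using \<epsilon>(1) unfolding continuous_at_eps_delta chart_i by blast
  \<comment> \<open>The neighbourhood is taken in the chart, where a ball cut by the strip is
    convex; its part in the gap is then starlike and therefore connected.\<close>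
  define C where "C = ball ?i \<delta> \<inter> strip"
  define N where "N = region centre radius (slit_set C (open_segment t1 t2))"
  \<comment> \<open>The entry 1/2 keeps m strictly between t1 and t2, the other keeps it within
    \<delta> of t1.\<close>
  define s where "s = min (1 / 2) (\<delta> / (2 * \<bar>t2 - t1\<bar>))"
  define m where "m = t1 + s * (t2 - t1)"
  have s: "0 < s" "s < 1" "s * \<bar>t2 - t1\<bar> < \<delta>"
  proof -
    show "0 < s" "s < 1" using \<delta>(1) t_neq by (auto simp: s_def)
    have "s * \<bar>t2 - t1\<bar> \<le> \<delta> / (2 * \<bar>t2 - t1\<bar>) * \<bar>t2 - t1\<bar>" by (intro mult_right_mono) (auto simp: s_def)
    also have "\<dots> < \<delta>" using \<delta>(1) t_neq by simp
    finally show "s * \<bar>t2 - t1\<bar> < \<delta>" .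
  qed
  have m: "m \<in> open_segment t1 t2"
    using s t_neq unfolding in_segment m_def by (auto intro!: exI[of _ s] simp: algebra_simps)
  have mC: "Complex 0 m \<in> C"
  proof -
    have "dist ?i (Complex 0 m) = \<bar>t1 - m\<bar>" by (simp add: dist_norm cmod_def)
    also have "\<dots> = s * \<bar>t2 - t1\<bar>" using s(1) by (simp add: m_def abs_mult)
    finally have "Complex 0 m \<in> ball ?i \<delta>" using s(3) by simp
    moreover have "Complex 0 m \<in> strip"
      using m t_bounds by (auto simp: strip_def open_segment_eq_real_ivl split: if_splits)
    ultimately show ?thesis by (simp add: C_def)
  qed
  have Cs: "C \<subseteq> strip" by (simp add: C_def)
  have oC: "open C" "convex C" unfolding C_def by (auto intro: open_Int convex_Int open_strip convex_strip)
  have "starlike (slit_set C (open_segment t1 t2))"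
    by (rule starlike_slit_set[OF oC(2) convex_open_segment mC m])
  then have connN: "connected N"
    unfolding N_def using Cs
    by (intro simply_connected_imp_connected simply_connected_region radius_pos) (auto simp: slit_set_def)
  have openN: "open N"
    unfolding N_def by (intro open_region radius_pos open_slit_set oC) (auto simp: open_segment_eq_real_ivl)
  have Ngap: "N \<subseteq> gap" using Cs by (auto simp: N_def gap_def region_def slit_set_def)
  have Nball: "N \<subseteq> ball \<tau>1 \<epsilon>"
  proof
    fix z assume z: "z \<in> N"
    then have "dist (chart_inv centre radius z) ?i < \<delta>"
      by (auto simp: N_def region_def slit_set_def C_def dist_commute)
    from \<delta>(2)[OF this] have "dist z \<tau>1 < \<epsilon>"
      using chart_chart_inv[OF radius_pos, of z centre] z by (simp add: N_def region_def)
    then show "z \<in> ball \<tau>1 \<epsilon>" by (simp add: dist_commute)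
  qed
  have "(\<lambda>z. \<Phi> z - E z) constant_on N"
  proof (rule has_field_derivative_0_imp_constant_on[OF _ connN openN])
    fix z assume z: "z \<in> N"
    show "((\<lambda>z. \<Phi> z - E z) has_field_derivative 0) (at z)"
    proof -
      have zg: "z \<in> gap" "z \<in> ball \<tau>1 \<epsilon>" using z Ngap Nball by blast+
      show ?thesis using DERIV_diff[OF \<Phi>[OF zg(1)] dE[OF zg]] by simp
    qed
  qed
  then obtain c where c: "\<And>z. z \<in> N \<Longrightarrow> \<Phi> z - E z = c" unfolding constant_on_def by blast
  have evN: "eventually (\<lambda>z. z \<in> N) ?F"
  proof -
    have "isCont (chart_inv centre radius) \<tau>1"
      using holomorphic_on_imp_continuous_on[OF holomorphic_on_chart_inv[OF radius_pos]] upper(1)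
        continuous_on_eq_continuous_at[OF open_upper_half_plane] by blast
    then have "(chart_inv centre radius \<longlongrightarrow> ?i) ?F"
      unfolding chart_inv_ends(1)[symmetric] by (intro tendsto_within_subset[of _ _ _ UNIV gap]) (auto simp: isCont_def)
    then have "eventually (\<lambda>z. dist (chart_inv centre radius z) ?i < \<delta>) ?F"
      using \<delta>(1) by (rule tendstoD)
    moreover have "eventually (\<lambda>z. z \<in> gap) ?F" by (simp add: eventually_at_filter)
    ultimately show ?thesis
      by eventually_elim (auto simp: N_def gap_def region_def slit_set_def C_def dist_commute)
  qed
  have limE: "(E \<longlongrightarrow> 0) ?F"
  proof -
    let ?q = "\<lambda>z. (z - \<tau>1) / (\<tau>2 - \<tau>1)"
    have "(?q \<longlongrightarrow> (\<tau>1 - \<tau>1) / (\<tau>2 - \<tau>1)) ?F"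
      by (intro tendsto_intros) (use neq in auto)
    then have "((\<lambda>z. norm (?q z)) \<longlongrightarrow> 0) ?F" by (intro tendsto_norm_zero) simp
    then have 1: "((\<lambda>z. norm (?q z) powr b) \<longlongrightarrow> 0) ?F"
      by (rule tendsto_zero_powrI[OF _ tendsto_const]) (use b in auto)
    have "isCont h \<tau>1" by (rule DERIV_isCont[OF h(1)]) (use \<epsilon> in simp)
    then have "(h \<longlongrightarrow> h \<tau>1) ?F" by (intro tendsto_within_subset[of _ _ _ UNIV gap]) (auto simp: isCont_def)
    then have "((\<lambda>z. norm (?q z) powr b * (norm (\<tau>2 - \<tau>1) * norm (h z))) \<longlongrightarrow> 0 * (norm (\<tau>2 - \<tau>1) * norm (h \<tau>1))) ?F"
      by (intro tendsto_intros 1)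
    then have 2: "((\<lambda>z. norm (?q z) powr b * (norm (\<tau>2 - \<tau>1) * norm (h z))) \<longlongrightarrow> 0) ?F"
      by simp
    \<comment> \<open>Absorbing z - \<tau>1 raises the exponent from b - 1 to b. The modulus of the
      power does not depend on the branch.\<close>
    have "norm (E z) = norm (?q z) powr b * (norm (\<tau>2 - \<tau>1) * norm (h z))" if z: "z \<in> gap" for z
    proof -
      have zs: "z \<in> slit" using z gap_subset_slit by blast
      have q: "exp (left_log z) = ?q z" by (rule left_log(2)[OF zs])
      have "exp (complex_of_real (b - 1) * left_log z) * ?q z = exp (complex_of_real b * left_log z)"
        unfolding q[symmetric] exp_add[symmetric] by (simp add: algebra_simps)
      then have "E z = exp (complex_of_real b * left_log z) * ((\<tau>2 - \<tau>1) * h z)"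
        unfolding E_def using neq by (metis (no_types, lifting) mult.assoc mult.commute nonzero_mult_div_cancel_left times_divide_eq_left)
      moreover have "norm (exp (complex_of_real b * left_log z)) = norm (?q z) powr b"
        unfolding q[symmetric] by (simp add: powr_def)
      ultimately show ?thesis by (simp only: norm_mult)
    qed
    then have "eventually (\<lambda>z. norm (?q z) powr b * (norm (\<tau>2 - \<tau>1) * norm (h z)) = norm (E z)) ?F"
      by (simp add: eventually_at_filter)
    then have "((\<lambda>z. norm (E z)) \<longlongrightarrow> 0) ?F"
      by (rule Lim_transform_eventually[OF 2])
    then show ?thesis by (rule tendsto_norm_zero_cancel)
  qed
  have "((\<lambda>z. E z + c) \<longlongrightarrow> 0 + c) ?F" by (intro tendsto_intros limE)
  moreover have "eventually (\<lambda>z. E z + c = \<Phi> z) ?F"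
    using evN by eventually_elim (use c in \<open>force simp: algebra_simps\<close>)
  ultimately have "(\<Phi> \<longlongrightarrow> 0 + c) ?F" by (rule Lim_transform_eventually)
  then show ?thesis by blast
qed

end


section \<open>The second formula\<close>

context geodesic_arc
begin

text \<open>The integrand is read in two ways: at \<tau>1 as the left power times \<open>K1\<close>,
  at \<tau>2 as the right power times \<open>K2\<close>. \<open>K1\<close> is holomorphic on
  \<open>B.slit\<close>, which contains \<tau>1, and \<open>K2\<close> on \<open>slit\<close>, which
  contains \<tau>2; so one limit lemma serves both ends.\<close>

lemma path_integral_exists:
  assumes f: "f holomorphic_on upper_half_plane" and a: "a > 0" and b: "b > 0"
  obtains I where "\<And>g. admissible_path \<tau>1 \<tau>2 g \<Longrightarrow>
    contour_integral g (\<lambda>z. f z * left_power \<tau>1 \<tau>2 (b - 1) z * right_power \<tau>1 \<tau>2 (a - 1) z / (\<tau>2 - \<tau>1)) = I"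
proof -
  interpret B: geodesic_arc \<tau>2 \<tau>1 by (rule geodesic_arc_swap(1)) (rule geodesic_arc_axioms)
  have gap_swap: "B.gap = gap" by (rule geodesic_arc_swap(3)) (rule geodesic_arc_axioms)
  let ?F = "\<lambda>z. f z * left_power \<tau>1 \<tau>2 (b - 1) z * right_power \<tau>1 \<tau>2 (a - 1) z / (\<tau>2 - \<tau>1)"
  define K1 where "K1 z = f z * exp (complex_of_real (a - 1) * B.left_log z) / (\<tau>2 - \<tau>1)" for z
  define K2 where "K2 z = f z * exp (complex_of_real (b - 1) * left_log z) / (\<tau>2 - \<tau>1)" for z
  have K1: "K1 holomorphic_on B.slit"
    unfolding K1_def
    by (intro holomorphic_intros B.left_log(1) holomorphic_on_subset[OF f] B.slit_subset_upper) (use neq in auto)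
  have K2: "K2 holomorphic_on slit"
    unfolding K2_def
    by (intro holomorphic_intros left_log(1) holomorphic_on_subset[OF f] slit_subset_upper) (use neq in auto)
  define G where "G z = exp (complex_of_real (b - 1) * left_log z) * K1 z" for z
  have G2: "G z = exp (complex_of_real (a - 1) * B.left_log z) * K2 z" for z
    by (simp add: G_def K1_def K2_def)
  have GF: "?F z = G z" if z: "z \<in> gap" for z
  proof -
    have "z \<in> cut_domain \<tau>1 \<tau>2 - {\<tau>1}" using z unfolding cut_domain_minus_left by blast
    then have l: "left_power \<tau>1 \<tau>2 (b - 1) z = exp (complex_of_real (b - 1) * left_log z)" by (rule left_power_eq)
    have "z \<in> cut_domain \<tau>2 \<tau>1 - {\<tau>2}" using z unfolding B.cut_domain_minus_left gap_swap by blast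
    then have r: "right_power \<tau>1 \<tau>2 (a - 1) z = exp (complex_of_real (a - 1) * B.left_log z)"
      unfolding right_power_eq_left_power[OF geodesic_arc_axioms] by (rule B.left_power_eq)
    show ?thesis unfolding l r by (simp add: G_def K1_def)
  qed
  have "G holomorphic_on gap"
    unfolding G_def
    by (intro holomorphic_intros holomorphic_on_subset[OF left_log(1) gap_subset_slit]
        holomorphic_on_subset[OF K1 B.gap_subset_slit[unfolded gap_swap]])
  then have "\<exists>h. \<forall>z. z \<in> gap \<longrightarrow> (h has_field_derivative G z) (at z)"
    by (rule conjunct2[OF iffD1[OF simply_connected_eq_global_primitive[OF gap(1)] gap(2)], THEN spec, THEN mp])
  then obtain \<Phi> where "\<forall>z. z \<in> gap \<longrightarrow> (\<Phi> has_field_derivative G z) (at z)" by (rule exE)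
  then have \<Phi>: "(\<Phi> has_field_derivative G z) (at z)" if "z \<in> gap" for z using that by blast
  have "\<exists>l. (\<Phi> \<longlongrightarrow> l) (at \<tau>1 within gap)"
    by (rule endpoint_limit[OF b B.slit(1) B.\<tau>2_in_slit K1]) (use \<Phi> in \<open>simp add: G_def\<close>)
  then obtain l1 where l1: "(\<Phi> \<longlongrightarrow> l1) (at \<tau>1 within gap)" by blast
  have "\<exists>l. (\<Phi> \<longlongrightarrow> l) (at \<tau>2 within B.gap)"
    by (rule B.endpoint_limit[OF a slit(1) \<tau>2_in_slit K2]) (use \<Phi> in \<open>simp add: G2 gap_swap\<close>)
  then obtain l2 where l2: "(\<Phi> \<longlongrightarrow> l2) (at \<tau>2 within gap)" unfolding gap_swap by blast
  show ?thesis
  proof (rule that[of "l2 - l1"])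
    fix g assume "admissible_path \<tau>1 \<tau>2 g"
    then have g: "valid_path g" "g 0 = \<tau>1" "g 1 = \<tau>2" "path_image g \<subseteq> cut_domain \<tau>1 \<tau>2"
      "\<And>t. t \<in> {0<..<1} \<Longrightarrow> g t \<noteq> \<tau>1 \<and> g t \<noteq> \<tau>2"
      by (auto simp: admissible_path_def pathstart_def pathfinish_def)
    have ggap: "g t \<in> gap" if "t \<in> {0<..<1}" for t
      using g(4,5) that unfolding cut_domain_minus_ends[symmetric] path_image_def by auto
    have gcont: "continuous_on {0..1} g" using valid_path_imp_path[OF g(1)] by (simp add: path_def)
    obtain S where S: "finite S" "\<And>t. t \<in> {0..1} - S \<Longrightarrow> g differentiable (at t)"
      using g(1) unfolding valid_path_def piecewise_C1_differentiable_on_def C1_differentiable_on_eq by blast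
    \<comment> \<open>The primitive along the path, completed by its limits at the ends. The
      fundamental theorem then needs continuity on the closed interval and a derivative only inside
      it, off a finite set.\<close>
    define H where "H t = (if t = 0 then l1 else if t = 1 then l2 else \<Phi> (g t))" for t :: real
    have Hderiv: "(H has_vector_derivative ?F (g t) * vector_derivative g (at t)) (at t)" if t: "t \<in> {0<..<1} - S" for t
    proof -
      have gd: "(g has_vector_derivative vector_derivative g (at t)) (at t)"
        using S(2)[of t] t by (simp add: vector_derivative_works)
      have "(\<Phi> has_field_derivative G (g t)) (at (g t) within g ` UNIV)"
        by (rule has_field_derivative_at_within[OF \<Phi>[OF ggap]]) (use t in simp)
      from field_vector_diff_chain_within[OF gd this]
      have "((\<Phi> \<circ> g) has_vector_derivative vector_derivative g (at t) * G (g t)) (at t)" .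
      then have "(H has_vector_derivative vector_derivative g (at t) * G (g t)) (at t)"
        by (rule has_vector_derivative_transform_within_open[of _ _ _ "{0<..<1}"]) (use t in \<open>auto simp: H_def\<close>)
      then show ?thesis using GF[OF ggap[of t]] t by (simp add: mult.commute)
    qed
    have lim: "(H \<longlongrightarrow> l) (at s within {0..1})"
      if s: "s = 0 \<and> l = l1 \<and> p = \<tau>1 \<or> s = 1 \<and> l = l2 \<and> p = \<tau>2" for s l p
    proof -
      have ev: "eventually (\<lambda>t. t \<in> {0<..<1}) (at s within {0..1})"
      proof -
        have "eventually (\<lambda>t. t \<in> - {1 - s}) (nhds s)"
          by (rule eventually_nhds_in_open) (use s in auto)
        then show ?thesis
          unfolding eventually_at_filter by eventually_elim (use s in auto)
      qed
      \<comment> \<open>The limit of \<Phi> is a punctured one, so the path must avoid both end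
        points for 0 < t < 1.\<close>
      have "filterlim g (at p within gap) (at s within {0..1})"
        unfolding filterlim_at
      proof
        show "(g \<longlongrightarrow> p) (at s within {0..1})"
          using gcont s g(2,3) unfolding continuous_on_def by force
        show "eventually (\<lambda>t. g t \<in> gap \<and> g t \<noteq> p) (at s within {0..1})"
          using ev by eventually_elim (use s g(5) ggap in blast)
      qed
      then have "((\<lambda>t. \<Phi> (g t)) \<longlongrightarrow> l) (at s within {0..1})"
        by (rule filterlim_compose[rotated]) (use s l1 l2 in auto)
      moreover have "eventually (\<lambda>t. \<Phi> (g t) = H t) (at s within {0..1})"
        using ev by eventually_elim (auto simp: H_def)
      ultimately show ?thesis by (rule Lim_transform_eventually)
    qed
    have Hcont: "continuous_on {0..1} H"
      unfolding continuous_on_def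
    proof
      fix s :: real assume s: "s \<in> {0..1}"
      consider "s = 0" | "s = 1" | "s \<in> {0<..<1}" using s by force
      then show "(H \<longlongrightarrow> H s) (at s within {0..1})"
      proof cases
        case 1
        then show ?thesis using lim[of s l1 \<tau>1] by (simp add: H_def)
      next
        case 2
        then show ?thesis using lim[of s l2 \<tau>2] by (simp add: H_def)
      next
        case 3
        have "isCont \<Phi> (g s)" by (rule DERIV_isCont[OF \<Phi>[OF ggap[OF 3]]])
        moreover have "(g \<longlongrightarrow> g s) (at s within {0..1})" using gcont s unfolding continuous_on_def by blast
        ultimately have "((\<lambda>t. \<Phi> (g t)) \<longlongrightarrow> \<Phi> (g s)) (at s within {0..1})" by (rule isCont_tendsto_compose)
        moreover have "eventually (\<lambda>t. \<Phi> (g t) = H t) (at s within {0..1})"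
        proof -
          have "eventually (\<lambda>t. t \<in> {0<..<1}) (nhds s)" by (rule eventually_nhds_in_open) (use 3 in auto)
          then show ?thesis unfolding eventually_at_filter by eventually_elim (auto simp: H_def)
        qed
        ultimately have "(H \<longlongrightarrow> \<Phi> (g s)) (at s within {0..1})" by (rule Lim_transform_eventually)
        then show ?thesis using 3 by (simp add: H_def)
      qed
    qed
    have "((\<lambda>t. ?F (g t) * vector_derivative g (at t)) has_integral (H 1 - H 0)) {0..1}"
      by (rule fundamental_theorem_of_calculus_interior_strong[OF S(1) _ Hderiv Hcont]) auto
    then have "(?F has_contour_integral (l2 - l1)) g"
      unfolding has_contour_integral by (simp add: H_def)
    then show "contour_integral g ?F = l2 - l1" by (rule contour_integral_unique)
  qed
qed

lemma admissible_linepath: "admissible_path \<tau>1 \<tau>2 (linepath \<tau>1 \<tau>2)"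
  unfolding admissible_path_def
proof (intro conjI ballI)
  show "path_image (linepath \<tau>1 \<tau>2) \<subseteq> cut_domain \<tau>1 \<tau>2"
    unfolding path_image_linepath closed_segment_eq_open
    using open_segment_subset_gap ends_in_cut_domain cut_domain_minus_ends by auto
  fix t :: real assume t: "t \<in> {0<..<1}"
  have "linepath \<tau>1 \<tau>2 t = \<tau>1 + complex_of_real t * (\<tau>2 - \<tau>1)"
    by (simp add: linepath_def scaleR_conv_of_real algebra_simps)
  then have "linepath \<tau>1 \<tau>2 t \<in> open_segment \<tau>1 \<tau>2" using segment_point_in_open_segment[of t] t by simp
  then show "linepath \<tau>1 \<tau>2 t \<noteq> \<tau>1" "linepath \<tau>1 \<tau>2 t \<noteq> \<tau>2" by (auto simp: open_segment_def)
qed auto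

text \<open>On the Euclidean segment the two logarithms are the real numbers ln u and ln (1 - u), so
  the powers become the Beta density. The factor \<tau>2 - \<tau>1 from dz cancels the
  denominator.\<close>

lemma path_integral_eq:
  assumes f: "f holomorphic_on upper_half_plane" and a: "a > 0" and b: "b > 0" and g: "admissible_path \<tau>1 \<tau>2 g"
  shows "contour_integral g (\<lambda>z. f z * left_power \<tau>1 \<tau>2 (b - 1) z * right_power \<tau>1 \<tau>2 (a - 1) z / (\<tau>2 - \<tau>1)) =
    integral {0..1} (\<lambda>u::real. f (\<tau>1 + complex_of_real u * (\<tau>2 - \<tau>1)) *
      complex_of_real (u powr (b - 1) * (1 - u) powr (a - 1)))"
proof -
  interpret B: geodesic_arc \<tau>2 \<tau>1 by (rule geodesic_arc_swap(1)) (rule geodesic_arc_axioms)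
  let ?F = "\<lambda>z. f z * left_power \<tau>1 \<tau>2 (b - 1) z * right_power \<tau>1 \<tau>2 (a - 1) z / (\<tau>2 - \<tau>1)"
  obtain I where I: "\<And>g. admissible_path \<tau>1 \<tau>2 g \<Longrightarrow> contour_integral g ?F = I"
    using path_integral_exists[OF f a b] by blast
  have "contour_integral g ?F = contour_integral (linepath \<tau>1 \<tau>2) ?F"
    using I[OF g] I[OF admissible_linepath] by simp
  also have "\<dots> = integral {0..1} (\<lambda>u. ?F (linepath \<tau>1 \<tau>2 u) * (\<tau>2 - \<tau>1))"
    unfolding contour_integral_integral by simp
  also have "\<dots> = integral {0..1} (\<lambda>u::real. f (\<tau>1 + complex_of_real u * (\<tau>2 - \<tau>1)) *
      complex_of_real (u powr (b - 1) * (1 - u) powr (a - 1)))"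
  proof (rule integral_spike[of "{0, 1}"])
    fix u :: real assume "u \<in> {0..1} - {0, 1}"
    then have u: "0 < u" "u < 1" by auto
    let ?z = "\<tau>1 + complex_of_real u * (\<tau>2 - \<tau>1)"
    have z1: "linepath \<tau>1 \<tau>2 u = ?z" by (simp add: linepath_def scaleR_conv_of_real algebra_simps)
    \<comment> \<open>Seen from \<tau>2 the parameter is 1 - u, which evaluates the left logarithm
      of the swapped arc.\<close>
    have z2: "?z = \<tau>2 + complex_of_real (1 - u) * (\<tau>1 - \<tau>2)" by (simp add: algebra_simps)
    have "?z \<in> gap" using segment_point_in_open_segment[OF u] open_segment_subset_gap by blast
    then have zz: "?z \<in> cut_domain \<tau>1 \<tau>2 - {\<tau>1}" "?z \<in> cut_domain \<tau>2 \<tau>1 - {\<tau>2}"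
      unfolding cut_domain_minus_left B.cut_domain_minus_left geodesic_arc_swap(3)[OF geodesic_arc_axioms] by auto
    have l: "left_power \<tau>1 \<tau>2 (b - 1) ?z = complex_of_real (u powr (b - 1))"
      unfolding left_power_eq[OF zz(1)] left_log(3)[OF u] using u
      by (simp only: of_real_mult[symmetric] exp_of_real powr_def) simp
    have "B.left_log ?z = complex_of_real (ln (1 - u))" unfolding z2 by (rule B.left_log(3)) (use u in auto)
    then have r: "right_power \<tau>1 \<tau>2 (a - 1) ?z = complex_of_real ((1 - u) powr (a - 1))"
      unfolding right_power_eq_left_power[OF geodesic_arc_axioms] B.left_power_eq[OF zz(2)] using u
      by (simp only: of_real_mult[symmetric] exp_of_real powr_def) simp
    show "f ?z * complex_of_real (u powr (b - 1) * (1 - u) powr (a - 1)) = ?F (linepath \<tau>1 \<tau>2 u) * (\<tau>2 - \<tau>1)"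
      unfolding z1 l r using neq by simp
  qed simp
  finally show ?thesis .
qed

end

lemma Re_arc_rho_eq_0:
  assumes "x \<in> {0..1}" "Re (geodesic_path (rho - 1) rho x) = 0"
  shows "x = 1 / 2"
proof -
  let ?\<theta> = "linepath (2 * pi / 3) (pi / 3) x"
  have \<theta>: "?\<theta> = 2 * pi / 3 - x * (pi / 3)" by (simp add: linepath_def field_simps)
  have "geodesic_path (rho - 1) rho x = cis ?\<theta>"
    unfolding geodesic_path_rho by (simp add: part_circlepath_def cis_conv_exp)
  then have "cos ?\<theta> = cos (pi / 2)" using assms(2) by simp
  moreover have "x * (pi / 3) \<le> 1 * (pi / 3)" "0 \<le> x * (pi / 3)" using assms by (intro mult_right_mono, auto)
  then have "0 \<le> ?\<theta>" "?\<theta> \<le> pi" unfolding \<theta> using pi_gt_zero by linarith+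
  ultimately have "?\<theta> = pi / 2" using cos_inj_pi[of ?\<theta> "pi / 2"] pi_gt_zero by simp
  then have "x * (pi / 3) = (1 / 2) * (pi / 3)" unfolding \<theta> by linarith
  then show ?thesis using pi_neq_zero by simp
qed

text \<open>At parameter 1/2 the arc passes through i, so this one point carries both the vertical
  geodesics and the only case \<tau>1 = \<tau>2. For every other \<tau>1 the integrals over z and
  over u agree for each \<tau>2.\<close>

lemma contour_integral_admissible_paths:
  assumes f: "f3 holomorphic_on upper_half_plane" and r: "r1 < 2" "r2 < 2"
    and P: "\<And>\<tau>1 \<tau>2. \<tau>1 \<in> geodesic_segment (rho - 1) rho \<Longrightarrow> Re \<tau>2 = 0 \<Longrightarrow> 1 \<le> Im \<tau>2 \<Longrightarrow> \<tau>1 \<noteq> \<tau>2 \<Longrightarrow>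
      admissible_path \<tau>1 \<tau>2 (P \<tau>1 \<tau>2)"
  shows "contour_integral (geodesic_path (rho - 1) rho) (\<lambda>\<tau>1. f1 \<tau>1 *
        integral_to_cusp \<i> (\<lambda>\<tau>2. f2 \<tau>2 *
          integral {0..1} (\<lambda>u::real. f3 (\<tau>1 + complex_of_real u * (\<tau>2 - \<tau>1)) *
            complex_of_real (u powr (1 - r2) * (1 - u) powr (1 - r1))))) =
     contour_integral (geodesic_path (rho - 1) rho) (\<lambda>\<tau>1. f1 \<tau>1 *
            integral_to_cusp \<i> (\<lambda>\<tau>2. f2 \<tau>2 *
              contour_integral (P \<tau>1 \<tau>2) (\<lambda>z. f3 z *
                left_power \<tau>1 \<tau>2 (1 - r2) z * right_power \<tau>1 \<tau>2 (1 - r1) z / (\<tau>2 - \<tau>1))))"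
  unfolding contour_integral_integral[of "geodesic_path (rho - 1) rho"]
proof (rule integral_spike[of "{1 / 2}"])
  let ?\<gamma> = "geodesic_path (rho - 1) rho"
  fix x :: real assume x: "x \<in> {0..1} - {1 / 2}"
  have Re: "Re (?\<gamma> x) \<noteq> 0" using Re_arc_rho_eq_0[of x] x by auto
  have seg: "?\<gamma> x \<in> geodesic_segment (rho - 1) rho" using x by (auto simp: geodesic_segment_def path_image_def)
  let ?C = "\<lambda>\<tau>2. contour_integral (P (?\<gamma> x) \<tau>2) (\<lambda>z. f3 z *
      left_power (?\<gamma> x) \<tau>2 (1 - r2) z * right_power (?\<gamma> x) \<tau>2 (1 - r1) z / (\<tau>2 - ?\<gamma> x))"
  let ?I = "\<lambda>\<tau>2. integral {0..1} (\<lambda>u::real. f3 (?\<gamma> x + complex_of_real u * (\<tau>2 - ?\<gamma> x)) *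
      complex_of_real (u powr (1 - r2) * (1 - u) powr (1 - r1)))"
  have eq: "?C \<tau>2 = ?I \<tau>2"
    if half_line: "Re \<tau>2 = 0" "1 \<le> Im \<tau>2" for \<tau>2
  proof -
    interpret geodesic_arc "?\<gamma> x" \<tau>2
      by unfold_locales (use arc_rho(1)[of x] x half_line Re in auto)
    have "admissible_path (?\<gamma> x) \<tau>2 (P (?\<gamma> x) \<tau>2)" by (rule P[OF seg half_line]) (use Re half_line in auto)
    from path_integral_eq[OF f _ _ this, of "2 - r1" "2 - r2"] show ?thesis using r by simp
  qed
  have "integral_to_cusp \<i> (\<lambda>\<tau>2. f2 \<tau>2 * ?C \<tau>2) = integral_to_cusp \<i> (\<lambda>\<tau>2. f2 \<tau>2 * ?I \<tau>2)"
    unfolding integral_to_cusp_def by (rule integral_cong) (subst eq, auto)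
  then show "f1 (?\<gamma> x) * integral_to_cusp \<i> (\<lambda>\<tau>2. f2 \<tau>2 * ?C \<tau>2) * vector_derivative ?\<gamma> (at x) =
      f1 (?\<gamma> x) * integral_to_cusp \<i> (\<lambda>\<tau>2. f2 \<tau>2 * ?I \<tau>2) * vector_derivative ?\<gamma> (at x)"
    by (simp only:)
qed simp

theorem theorem1p1:
  fixes r1 r2 r3 :: real
    and v1 v2 v3 :: "int ^ 2 ^ 2 \<Rightarrow> complex"
    and f1 f2 f3 :: "complex \<Rightarrow> complex"
  assumes "r1 + r2 + r3 = 4" and "r1 < 2" and "0 < r2" and "r2 < 2"
    and "multiplier_system r1 v1" and "multiplier_system r2 v2" and "multiplier_system r3 v3"
    and "\<And>\<gamma>. \<gamma> \<in> SL2Z \<Longrightarrow> v1 \<gamma> * v2 \<gamma> * v3 \<gamma> = 1"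
    and "f1 \<in> automorphic_forms r1 v1"
    and "f2 \<in> cusp_forms r2 v2"
    and "f3 \<in> modular_forms r3 v3"
  shows "trilinear_form r1 r2 f1 f2 f3 =
      (- 2 * \<i>) powr complex_of_real r3 *
      complex_of_real (Gamma r3 / (Gamma (2 - r1) * Gamma (2 - r2))) *
      contour_integral (geodesic_path (rho - 1) rho) (\<lambda>\<tau>1. f1 \<tau>1 *
        integral_to_cusp \<i> (\<lambda>\<tau>2. f2 \<tau>2 *
          integral {0..1} (\<lambda>u::real. f3 (\<tau>1 + complex_of_real u * (\<tau>2 - \<tau>1)) *
            complex_of_real (u powr (1 - r2) * (1 - u) powr (1 - r1)))))
    \<and> (\<forall>P :: complex \<Rightarrow> complex \<Rightarrow> real \<Rightarrow> complex.
        (\<forall>\<tau>1\<in>geodesic_segment (rho - 1) rho. \<forall>\<tau>2\<in>{z. Re z = 0 \<and> 1 \<le> Im z}.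
           \<tau>1 \<noteq> \<tau>2 \<longrightarrow> admissible_path \<tau>1 \<tau>2 (P \<tau>1 \<tau>2)) \<longrightarrow>
        trilinear_form r1 r2 f1 f2 f3 =
          (- 2 * \<i>) powr complex_of_real r3 *
          complex_of_real (Gamma r3 / (Gamma (2 - r1) * Gamma (2 - r2))) *
          contour_integral (geodesic_path (rho - 1) rho) (\<lambda>\<tau>1. f1 \<tau>1 *
            integral_to_cusp \<i> (\<lambda>\<tau>2. f2 \<tau>2 *
              contour_integral (P \<tau>1 \<tau>2) (\<lambda>z. f3 z *
                left_power \<tau>1 \<tau>2 (1 - r2) z * right_power \<tau>1 \<tau>2 (1 - r1) z / (\<tau>2 - \<tau>1)))))"
proof -
  note first = trilinear_form_eq_integral[OF assms(1,2,4,9-11)]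
  have "f3 holomorphic_on upper_half_plane"
    using assms(11) by (simp add: modular_forms_def automorphic_forms_def)
  note second = contour_integral_admissible_paths[OF this assms(2,4)]
  show ?thesis
  proof (intro conjI allI impI)
    fix P
    assume P: "\<forall>\<tau>1\<in>geodesic_segment (rho - 1) rho. \<forall>\<tau>2\<in>{z. Re z = 0 \<and> 1 \<le> Im z}.
       \<tau>1 \<noteq> \<tau>2 \<longrightarrow> admissible_path \<tau>1 \<tau>2 (P \<tau>1 \<tau>2)"
    show "trilinear_form r1 r2 f1 f2 f3 =
        (- 2 * \<i>) powr complex_of_real r3 *
        complex_of_real (Gamma r3 / (Gamma (2 - r1) * Gamma (2 - r2))) *
        contour_integral (geodesic_path (rho - 1) rho) (\<lambda>\<tau>1. f1 \<tau>1 *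
          integral_to_cusp \<i> (\<lambda>\<tau>2. f2 \<tau>2 *
            contour_integral (P \<tau>1 \<tau>2) (\<lambda>z. f3 z *
              left_power \<tau>1 \<tau>2 (1 - r2) z * right_power \<tau>1 \<tau>2 (1 - r1) z / (\<tau>2 - \<tau>1))))"
      unfolding first by (subst second[where P = P]) (use P in auto)
  qed (rule first)
qed

end
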